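(* The theory $T_G^*$ (defined in the context) has burden $2$.
   Context: Let $\mathcal{L}=\{+,<,0,1,\lfloor\;\rfloor,S,\lambda\}_{\lambda\in\mathbb{Q}}$ and let $T$ be the complete $\mathcal{L}$-theory of the real numbers $\mathbb{R}$ with the usual $+,<,0,1$, where $\lfloor x\rfloor=\max\{y\in\mathbb{Z}: y\le x\}$, $S$ is a unary predicate interpreted as the interval $(0,1)$, and each $\lambda\in\mathbb{Q}$ is a unary function symbol interpreted as multiplication by $\lambda$ (so $T$ is the theory of $\langle\mathbb{R};+,<,\mathbb{Z}\rangle$ in this language). In models of $T$, $\mathrm{acl}=\mathrm{dcl}$; write $\mathrm{acl}_T$ for algebraic closure in the sense of $T$. Let $\mathcal{L}(P)=\mathcal{L}\cup\{P\}$ with $P$ a new unary predicate, and $T_S=T\cup\{\forall x\,(P(x)\to S(x))\}$. The theory $T_G$ is the model companion of $T_S$. Its models are the structures $(\mathcal{M},P)$ with $\mathcal{M}\models T$, $P\subseteq S(M)$, such that: for every $\mathcal{L}$-formula $\varphi(x_1,\dots,x_n,\overline{z})$ with $T\models\forall \overline{x}\,(\varphi(\overline{x},\overline{z})\to\bigwedge_{i}S(x_i))$, every $I\subseteq\{1,\dots,n\}$, and every tuple $\overline{c}$ from $M$, if in some elementary extension of $\mathcal{M}$ (as an $\mathcal{L}$-structure) there are pairwise distinct $a_1,\dots,a_n$ with $\varphi(\overline{a},\overline{c})$ and no $a_i$ in $\mathrm{acl}_T(\overline{c})$, then there is $\overline{a}$ in $M$ with $\varphi(\overline{a},\overline{c})$,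 $a_i\in P$ for all $i\in I$, and $a_i\notin P$ for all $i\notin I$. The theory $T_G^*$ is the completion of $T_G$ obtained by specifying $P(M)\cap\mathrm{dcl}(\emptyset)=\emptyset$ (with $\mathrm{dcl}$ in the sense of $T$). Burden of a complete theory: an inp-pattern of depth $\kappa$ is a sequence of formulas $\{\varphi_i(x;\overline{y}_i) : i<\kappa\}$ in a single variable $x$, a sequence of positive integers $\{k_i : i<\kappa\}$, and a sequence of tuples $\{\overline{a}_{i,j} : i<\kappa, j<\omega\}$ from some model of the theory such that for each $i<\kappa$ the set $\{\varphi_i(x;\overline{a}_{i,j}) : j<\omega\}$ is $k_i$-inconsistent, and for each $\eta:\kappa\to\omega$ the set $\{\varphi_i(x;\overline{a}_{i,\eta(i)}) : i<\kappa\}$ is consistent. The theory has burden less than $\kappa$ if there is no inp-pattern of depth $\kappa$; it has burden $\lambda$ if the least $\kappa$ such that the burden is less than $\kappa$ is $\lambda^+$. (So burden $2$ means that there is an inp-pattern of depth $2$ but none of depth $3$.) *)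

theory Defs
  imports Complex_Main "HOL-Library.Infinite_Typeclass"
begin

section \<open>Syntax and semantics\<close>

text \<open>
  The function symbols and the order are fixed; the type \<open>'p\<close> collects the unary predicate
  symbols, so that \<open>L_pred fm\<close> are the \<open>L\<close>-formulas and \<open>LP_pred fm\<close> the \<open>L(P)\<close>-formulas.
\<close>

datatype L_pred = S_L
datatype LP_pred = S_LP | P_LP

datatype tm =
    Var nat
  | Zero
  | One
  | Add tm tm
  | Floor tm
  | Scale rat tm

datatype 'p fm =
    Eq tm tm
  | Less tm tm
  | Holds 'p tm
  | Neg "'p fm"
  | Conj "'p fm" "'p fm"
  | Ex nat "'p fm"

primrec fv_tm :: "tm \<Rightarrow> nat set" where
  "fv_tm (Var n) = {n}"
| "fv_tm Zero = {}"
| "fv_tm One = {}"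
| "fv_tm (Add s t) = fv_tm s \<union> fv_tm t"
| "fv_tm (Floor t) = fv_tm t"
| "fv_tm (Scale q t) = fv_tm t"

primrec fv :: "'p fm \<Rightarrow> nat set" where
  "fv (Eq s t) = fv_tm s \<union> fv_tm t"
| "fv (Less s t) = fv_tm s \<union> fv_tm t"
| "fv (Holds p t) = fv_tm t"
| "fv (Neg \<phi>) = fv \<phi>"
| "fv (Conj \<phi> \<psi>) = fv \<phi> \<union> fv \<psi>"
| "fv (Ex n \<phi>) = fv \<phi> - {n}"

record ('p, 'a) struct =
  univ :: "'a set"
  zeroI :: 'a
  oneI :: 'a
  addI :: "'a \<Rightarrow> 'a \<Rightarrow> 'a"
  floorI :: "'a \<Rightarrow> 'a"
  scaleI :: "rat \<Rightarrow> 'a \<Rightarrow> 'a"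
  lessI :: "'a \<Rightarrow> 'a \<Rightarrow> bool"
  predI :: "'p \<Rightarrow> 'a set"

definition wf_struct :: "('p, 'a) struct \<Rightarrow> bool" where
  "wf_struct M \<longleftrightarrow>
     zeroI M \<in> univ M \<and> oneI M \<in> univ M \<and>
     (\<forall>x\<in>univ M. \<forall>y\<in>univ M. addI M x y \<in> univ M) \<and>
     (\<forall>x\<in>univ M. floorI M x \<in> univ M) \<and>
     (\<forall>q. \<forall>x\<in>univ M. scaleI M q x \<in> univ M) \<and>
     (\<forall>p. predI M p \<subseteq> univ M)"

primrec eval_tm :: "('p, 'a) struct \<Rightarrow> (nat \<Rightarrow> 'a) \<Rightarrow> tm \<Rightarrow> 'a" where
  "eval_tm M e (Var n) = e n"
| "eval_tm M e Zero = zeroI M"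
| "eval_tm M e One = oneI M"
| "eval_tm M e (Add s t) = addI M (eval_tm M e s) (eval_tm M e t)"
| "eval_tm M e (Floor t) = floorI M (eval_tm M e t)"
| "eval_tm M e (Scale q t) = scaleI M q (eval_tm M e t)"

primrec sat :: "('p, 'a) struct \<Rightarrow> (nat \<Rightarrow> 'a) \<Rightarrow> 'p fm \<Rightarrow> bool" where
  "sat M e (Eq s t) \<longleftrightarrow> eval_tm M e s = eval_tm M e t"
| "sat M e (Less s t) \<longleftrightarrow> lessI M (eval_tm M e s) (eval_tm M e t)"
| "sat M e (Holds p t) \<longleftrightarrow> eval_tm M e t \<in> predI M p"
| "sat M e (Neg \<phi>) \<longleftrightarrow> \<not> sat M e \<phi>"
| "sat M e (Conj \<phi> \<psi>) \<longleftrightarrow> sat M e \<phi> \<and> sat M e \<psi>"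
| "sat M e (Ex n \<phi>) \<longleftrightarrow> (\<exists>a\<in>univ M. sat M (e(n := a)) \<phi>)"

text \<open>
  Satisfaction by a tuple: the variable \<open>i\<close> takes the value \<open>xs ! i\<close>. It is only used when all
  free variables of the formula are below \<open>length xs\<close>.
\<close>

definition sat_at :: "('p, 'a) struct \<Rightarrow> 'a list \<Rightarrow> 'p fm \<Rightarrow> bool" where
  "sat_at M xs \<phi> \<longleftrightarrow> sat M (\<lambda>i. xs ! i) \<phi>"

definition is_model :: "('p, 'a) struct \<Rightarrow> 'p fm set \<Rightarrow> bool" where
  "is_model M Th \<longleftrightarrow> wf_struct M \<and>
     (\<forall>\<sigma>\<in>Th. \<forall>e. range e \<subseteq> univ M \<longrightarrow> sat M e \<sigma>)"

text \<open>
  Elementary extensions are taken up to isomorphism, that is, as elementary embeddings into a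
  structure over the same type \<open>'a\<close> (an inclusion would exclude proper extensions when
  \<open>univ M = UNIV\<close>). The language is countable, so by the downward Loewenheim-Skolem theorem
  anything that an infinite \<open>M\<close> realises for a finite tuple in some elementary extension it
  already realises in one of cardinality \<open>|M|\<close>, and hence in one over \<open>'a\<close>.
\<close>

definition elementary_embedding ::
    "('p, 'a) struct \<Rightarrow> ('p, 'a) struct \<Rightarrow> ('a \<Rightarrow> 'a) \<Rightarrow> bool" where
  "elementary_embedding M N f \<longleftrightarrow>
     wf_struct N \<and> f ` univ M \<subseteq> univ N \<and>
     (\<forall>\<phi> e. range e \<subseteq> univ M \<longrightarrow> (sat N (f \<circ> e) \<phi> \<longleftrightarrow> sat M e \<phi>))"

definition acl :: "('p, 'a) struct \<Rightarrow> 'a set \<Rightarrow> 'a set" where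
  "acl M A = {a \<in> univ M. \<exists>\<psi> cs. set cs \<subseteq> A \<and> fv \<psi> \<subseteq> {..length cs} \<and>
     sat_at M (a # cs) \<psi> \<and> finite {x \<in> univ M. sat_at M (x # cs) \<psi>}}"

definition dcl :: "('p, 'a) struct \<Rightarrow> 'a set \<Rightarrow> 'a set" where
  "dcl M A = {a \<in> univ M. \<exists>\<psi> cs. set cs \<subseteq> A \<and> fv \<psi> \<subseteq> {..length cs} \<and>
     {x \<in> univ M. sat_at M (x # cs) \<psi>} = {a}}"


section \<open>The theory \<open>T\<close> and the models of \<open>T\<^sub>G\<close> and \<open>T\<^sub>G\<^sup>*\<close>\<close>

definition real_struct :: "(L_pred, real) struct" where
  "real_struct = \<lparr>univ = UNIV, zeroI = 0, oneI = 1, addI = (+),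
     floorI = (\<lambda>x. of_int \<lfloor>x\<rfloor>), scaleI = (\<lambda>q x. of_rat q * x), lessI = (<),
     predI = (\<lambda>_. {0<..<1})\<rparr>"

definition theory_T :: "L_pred fm set" where
  "theory_T = {\<sigma>. fv \<sigma> = {} \<and> (\<forall>e. sat real_struct e \<sigma>)}"

text \<open>
  In a formula \<open>\<phi>(x\<^sub>1,\<dots>,x\<^sub>n,z\<^sub>1,\<dots>,z\<^sub>m)\<close> the variables \<open>x\<close> are those with
  numbers \<open>0,\<dots>,n-1\<close> and the variables \<open>z\<close> those with numbers \<open>n,\<dots>,n+m-1\<close>.
  The definition says \<open>T \<Turnstile> \<forall>x z (\<phi>(x,z) \<longrightarrow> S(x\<^sub>1) \<and> \<dots> \<and> S(x\<^sub>n))\<close>, where the models of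
  \<open>T\<close> are taken over the type \<open>'a\<close>; as \<open>T\<close> has models of every infinite cardinality and is
  complete, the choice of an infinite type does not matter.
\<close>

definition entails_S :: "'a itself \<Rightarrow> nat \<Rightarrow> nat \<Rightarrow> L_pred fm \<Rightarrow> bool" where
  "entails_S _ n m \<phi> \<longleftrightarrow>
     (\<forall>N :: (L_pred, 'a) struct. is_model N theory_T \<longrightarrow>
       (\<forall>as cs. length as = n \<longrightarrow> length cs = m \<longrightarrow> set as \<subseteq> univ N \<longrightarrow> set cs \<subseteq> univ N \<longrightarrow>
          sat_at N (as @ cs) \<phi> \<longrightarrow> set as \<subseteq> predI N S_L))"

definition TG_model :: "(L_pred, 'a) struct \<Rightarrow> 'a set \<Rightarrow> bool" where
  "TG_model M P \<longleftrightarrow>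
     is_model M theory_T \<and> P \<subseteq> predI M S_L \<and>
     (\<forall>n m \<phi> I cs.
        fv \<phi> \<subseteq> {..<n + m} \<longrightarrow> entails_S TYPE('a) n m \<phi> \<longrightarrow> I \<subseteq> {..<n} \<longrightarrow>
        length cs = m \<longrightarrow> set cs \<subseteq> univ M \<longrightarrow>
        (\<exists>N f as. elementary_embedding M N f \<and>
           length as = n \<and> set as \<subseteq> univ N \<and> distinct as \<and>
           sat_at N (as @ map f cs) \<phi> \<and> set as \<inter> acl N (f ` set cs) = {}) \<longrightarrow>
        (\<exists>as. length as = n \<and> set as \<subseteq> univ M \<and> sat_at M (as @ cs) \<phi> \<and>
           (\<forall>i<n. as ! i \<in> P \<longleftrightarrow> i \<in> I)))"

definition expand :: "(L_pred, 'a) struct \<Rightarrow> 'a set \<Rightarrow> (LP_pred, 'a) struct" where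
  "expand M P = \<lparr>univ = univ M, zeroI = zeroI M, oneI = oneI M, addI = addI M,
     floorI = floorI M, scaleI = scaleI M, lessI = lessI M,
     predI = (\<lambda>p. case p of S_LP \<Rightarrow> predI M S_L | P_LP \<Rightarrow> P)\<rparr>"

text \<open>The theory \<open>T\<^sub>G\<^sup>*\<close>, given by its class of models.\<close>

definition TG_star :: "(LP_pred, 'a) struct \<Rightarrow> bool" where
  "TG_star \<MM> \<longleftrightarrow> (\<exists>M P. \<MM> = expand M P \<and> TG_model M P \<and> P \<inter> dcl M {} = {})"


section \<open>Burden\<close>

text \<open>
  An instance \<open>\<phi>(x; a)\<close> is a pair \<open>(\<phi>, a)\<close> with \<open>x\<close> the variable \<open>0\<close> and the parameter
  variables numbered from \<open>1\<close>. A set of instances over \<open>\<MM>\<close> is consistent when one element of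
  some elementary extension of \<open>\<MM>\<close> satisfies all of them.
\<close>

definition consistent :: "('p, 'a) struct \<Rightarrow> ('p fm \<times> 'a list) set \<Rightarrow> bool" where
  "consistent \<MM> \<Phi> \<longleftrightarrow>
     (\<exists>N f. elementary_embedding \<MM> N f \<and>
       (\<exists>b\<in>univ N. \<forall>(\<phi>, as)\<in>\<Phi>. sat_at N (b # map f as) \<phi>))"

text \<open>
  As usual, \<open>k\<close>-inconsistency refers to the indexed family: any \<open>k\<close> members with distinct
  indices are inconsistent together. (Read as a statement about the underlying set, a constant
  family would be \<open>2\<close>-inconsistent.)
\<close>

definition k_inconsistent ::
    "('p, 'a) struct \<Rightarrow> nat \<Rightarrow> (nat \<Rightarrow> 'p fm \<times> 'a list) \<Rightarrow> bool" where
  "k_inconsistent \<MM> k F \<longleftrightarrow>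
     (\<forall>J. finite J \<longrightarrow> card J = k \<longrightarrow> \<not> consistent \<MM> (F ` J))"

definition inp_pattern ::
    "('p, 'a) struct \<Rightarrow> nat \<Rightarrow> (nat \<Rightarrow> 'p fm) \<Rightarrow> (nat \<Rightarrow> nat) \<Rightarrow>
     (nat \<Rightarrow> nat \<Rightarrow> 'a list) \<Rightarrow> bool" where
  "inp_pattern \<MM> \<kappa> \<phi> k a \<longleftrightarrow>
     (\<forall>i<\<kappa>. k i > 0 \<and>
        (\<exists>l. fv (\<phi> i) \<subseteq> {..l} \<and> (\<forall>j. length (a i j) = l \<and> set (a i j) \<subseteq> univ \<MM>)) \<and>
        k_inconsistent \<MM> (k i) (\<lambda>j. (\<phi> i, a i j))) \<and>
     (\<forall>\<eta> :: nat \<Rightarrow> nat. consistent \<MM> ((\<lambda>i. (\<phi> i, a i (\<eta> i))) ` {..<\<kappa>}))"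

text \<open>
  A theory is given by its class \<open>C\<close> of models. Only finite burdens are considered; the burden
  is \<open>d\<close> when the least \<open>\<kappa>\<close> such that the burden is less than \<open>\<kappa>\<close> is \<open>d\<^sup>+ = d + 1\<close>.
\<close>

definition burden_less :: "(('p, 'a) struct \<Rightarrow> bool) \<Rightarrow> nat \<Rightarrow> bool" where
  "burden_less C \<kappa> \<longleftrightarrow> \<not> (\<exists>\<MM> \<phi> k a. C \<MM> \<and> inp_pattern \<MM> \<kappa> \<phi> k a)"

definition has_burden :: "(('p, 'a) struct \<Rightarrow> bool) \<Rightarrow> nat \<Rightarrow> bool" where
  "has_burden C d \<longleftrightarrow>
     burden_less C (Suc d) \<and> (\<forall>\<kappa>. burden_less C \<kappa> \<longrightarrow> Suc d \<le> \<kappa>)"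

end

theory Submission
  imports Defs "HOL-Library.Countable_Set" "HOL-Library.Ramsey"
begin

text \<open>
  Two coordinates of an element are independent of each other, its integral part and its fractional
  part: the instances \<open>\<lfloor>x\<rfloor> = y\<close> and \<open>x - \<lfloor>x\<rfloor> = y\<close> form an inp-pattern of depth 2. The point of the
  theorem is that the generic predicate adds no third coordinate.

  Write \<open>x = N q + s\<close> with \<open>q\<close> an integer and \<open>0 \<le> s < N\<close>. When \<open>N\<close> is divisible enough, every term
  satisfies \<open>t(N q + s) = c q + t(s)\<close> for a rational constant \<open>c\<close>, so no congruence condition on \<open>q\<close>
  is ever needed, and \<open>t(s)\<close> is piecewise affine with a bounded number of pieces because \<open>s\<close> is
  bounded. The truth of a formula without quantifiers is therefore determined by the position of \<open>q\<close>
  among finitely many parameters, the position of \<open>s\<close> among finitely many parameters, finitely many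
  conditions \<open>P(\<beta> s + u)\<close>, and conditions on the parameters alone (\<open>determined_qf\<close>). All of this is
  proved for the real numbers, with \<open>P\<close> an arbitrary subset of \<open>(0,1)\<close>; since a model of \<open>T\<close>
  satisfies everything that holds in the real numbers, it passes to every model with a predicate
  (\<open>transfer_P\<close>, \<open>ex_basics\<close>). For \<open>T\<close> itself it yields finitely many test terms for each existential
  quantifier, so \<open>T\<close> eliminates quantifiers and is axiomatised by its universal part
  (\<open>sat_qelim\<close>, \<open>univ_model_is_model\<close>).

  The axioms of \<open>T\<^sub>G\<close> are equivalent to a condition on one variable: on every interval, finitely many
  distinct nonconstant affine functions with values in \<open>(0,1)\<close> can be sent into and out of \<open>P\<close> by one point in any
  prescribed way. The axioms imply it because an infinitesimal step \<open>\<epsilon>\<close> can be adjoined to any model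
  (\<open>TG_model_generic\<close>). Conversely, a tuple that avoids the algebraic closure of the parameters can
  be moved along a line with rational direction, all coordinates of which are nonzero, without
  leaving the set defined by the formula (\<open>generic_TG_model\<close>). With this condition \<open>T\<^sub>G\<close> eliminates
  quantifiers (\<open>quantifier_elimination\<close>), and it is easy to satisfy by a countable recursion inside
  \<open>\<rat> + \<rat> \<surd>2\<close> (\<open>ex_generic_predicate\<close>), which gives the model needed for the lower bound.

  For the upper bound, a definable set in one variable is a finite union of cells, each given by a
  convex set of \<open>q\<close>, a convex set of \<open>s\<close>, and conditions \<open>\<plusminus>P(\<beta> s + u)\<close>. The latter contradict each
  other only if the same element is required to be inside and outside \<open>P\<close>, and by Ramsey's theorem
  this does not happen along a suitable infinite subfamily of a row. Hence, by Helly's theorem on the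
  line, the inconsistency of a row forces each kind of cell occurring in it to have pairwise disjoint
  sets of \<open>q\<close> or pairwise disjoint sets of \<open>s\<close> (\<open>row_separated\<close>). In a pattern of depth 3, each path
  runs through two rows separated by the same coordinate. But two families of \<open>m\<close> pairwise disjoint
  convex sets have at most \<open>2 m\<close> incidences, so this accounts for only \<open>O(m\<^sup>2)\<close> of the \<open>m\<^sup>3\<close> paths
  through \<open>m\<close> members of each row (\<open>no_inp_pattern\<close>).
\<close>

section \<open>Formulas and transfer from the real numbers\<close>

definition Or :: "'p fm \<Rightarrow> 'p fm \<Rightarrow> 'p fm" where
  "Or \<phi> \<psi> = Neg (Conj (Neg \<phi>) (Neg \<psi>))"

definition Imp :: "'p fm \<Rightarrow> 'p fm \<Rightarrow> 'p fm" where
  "Imp \<phi> \<psi> = Neg (Conj \<phi> (Neg \<psi>))"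

definition Iff :: "'p fm \<Rightarrow> 'p fm \<Rightarrow> 'p fm" where
  "Iff \<phi> \<psi> = Conj (Imp \<phi> \<psi>) (Imp \<psi> \<phi>)"

definition All :: "nat \<Rightarrow> 'p fm \<Rightarrow> 'p fm" where
  "All n \<phi> = Neg (Ex n (Neg \<phi>))"

definition Conjs :: "'p fm list \<Rightarrow> 'p fm" where
  "Conjs \<phi>s = foldr Conj \<phi>s (Eq Zero Zero)"

definition Disjs :: "'p fm list \<Rightarrow> 'p fm" where
  "Disjs \<phi>s = Neg (Conjs (map Neg \<phi>s))"

definition Alls :: "nat list \<Rightarrow> 'p fm \<Rightarrow> 'p fm" where
  "Alls ns \<phi> = foldr All ns \<phi>"

primrec qf :: "'p fm \<Rightarrow> bool" where
  "qf (Eq s t) \<longleftrightarrow> True"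
| "qf (Less s t) \<longleftrightarrow> True"
| "qf (Holds p t) \<longleftrightarrow> True"
| "qf (Neg \<phi>) \<longleftrightarrow> qf \<phi>"
| "qf (Conj \<phi> \<psi>) \<longleftrightarrow> qf \<phi> \<and> qf \<psi>"
| "qf (Ex n \<phi>) \<longleftrightarrow> False"

lemma sat_derived [simp]:
  "sat M e (Or \<phi> \<psi>) \<longleftrightarrow> sat M e \<phi> \<or> sat M e \<psi>"
  "sat M e (Imp \<phi> \<psi>) \<longleftrightarrow> (sat M e \<phi> \<longrightarrow> sat M e \<psi>)"
  "sat M e (Iff \<phi> \<psi>) \<longleftrightarrow> (sat M e \<phi> \<longleftrightarrow> sat M e \<psi>)"
  "sat M e (All n \<phi>) \<longleftrightarrow> (\<forall>a\<in>univ M. sat M (e(n := a)) \<phi>)"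
  by (auto simp: Or_def Imp_def Iff_def All_def)

lemma sat_Conjs [simp]: "sat M e (Conjs \<phi>s) \<longleftrightarrow> (\<forall>\<phi>\<in>set \<phi>s. sat M e \<phi>)"
  by (induction \<phi>s) (auto simp: Conjs_def)

lemma sat_Disjs [simp]: "sat M e (Disjs \<phi>s) \<longleftrightarrow> (\<exists>\<phi>\<in>set \<phi>s. sat M e \<phi>)"
  by (auto simp: Disjs_def)

lemma qf_derived [simp]:
  "qf (Or \<phi> \<psi>) \<longleftrightarrow> qf \<phi> \<and> qf \<psi>"
  "qf (Imp \<phi> \<psi>) \<longleftrightarrow> qf \<phi> \<and> qf \<psi>"
  "qf (Iff \<phi> \<psi>) \<longleftrightarrow> qf \<phi> \<and> qf \<psi>"
  by (auto simp: Or_def Imp_def Iff_def)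

lemma qf_Conjs [simp]: "qf (Conjs \<phi>s) \<longleftrightarrow> (\<forall>\<phi>\<in>set \<phi>s. qf \<phi>)"
  by (induction \<phi>s) (auto simp: Conjs_def)

lemma qf_Disjs [simp]: "qf (Disjs \<phi>s) \<longleftrightarrow> (\<forall>\<phi>\<in>set \<phi>s. qf \<phi>)"
  by (auto simp: Disjs_def)

lemma fv_Conjs [simp]: "fv (Conjs \<phi>s) = (\<Union>\<phi>\<in>set \<phi>s. fv \<phi>)"
  by (induction \<phi>s) (auto simp: Conjs_def)

lemma fv_Alls [simp]: "fv (Alls ns \<phi>) = fv \<phi> - set ns"
  by (induction ns) (auto simp: Alls_def All_def)

lemma finite_fv_tm [simp]: "finite (fv_tm t)"
  by (induction t) auto

lemma finite_fv [simp]: "finite (fv \<phi>)"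
  by (induction \<phi>) auto

lemma eval_tm_cong: "(\<And>i. i \<in> fv_tm t \<Longrightarrow> e i = e' i) \<Longrightarrow> eval_tm M e t = eval_tm M e' t"
  by (induction t) auto

lemma sat_cong: "(\<And>i. i \<in> fv \<phi> \<Longrightarrow> e i = e' i) \<Longrightarrow> sat M e \<phi> \<longleftrightarrow> sat M e' \<phi>"
proof (induction \<phi> arbitrary: e e')
  case (Eq s t) then show ?case using eval_tm_cong[of s e e' M] eval_tm_cong[of t e e' M] by auto
next
  case (Less s t) then show ?case using eval_tm_cong[of s e e' M] eval_tm_cong[of t e e' M] by auto
next
  case (Holds p t) then show ?case using eval_tm_cong[of t e e' M] by auto
next
  case (Neg \<phi>)
  have "sat M e \<phi> = sat M e' \<phi>" by (rule Neg.IH) (simp add: Neg.prems)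
  then show ?case by simp
next
  case (Conj \<phi> \<psi>)
  have "sat M e \<phi> = sat M e' \<phi>" by (rule Conj.IH) (simp add: Conj.prems)
  moreover have "sat M e \<psi> = sat M e' \<psi>" by (rule Conj.IH) (simp add: Conj.prems)
  ultimately show ?case by simp
next
  case (Ex n \<phi>)
  have "sat M (e(n := a)) \<phi> = sat M (e'(n := a)) \<phi>" for a
    by (rule Ex.IH) (use Ex.prems in auto)
  then show ?case by simp
qed

lemma eval_tm_upd [simp]: "v \<notin> fv_tm t \<Longrightarrow> eval_tm M (e(v := a)) t = eval_tm M e t"
  by (rule eval_tm_cong) auto

lemma sat_upd: "v \<notin> fv \<phi> \<Longrightarrow> sat M (e(v := a)) \<phi> = sat M e \<phi>"
  by (rule sat_cong) auto

lemma wf_eval: "wf_struct M \<Longrightarrow> range e \<subseteq> univ M \<Longrightarrow> eval_tm M e t \<in> univ M"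
  by (induction t) (auto simp: wf_struct_def)

lemma range_upd: "range e \<subseteq> U \<Longrightarrow> a \<in> U \<Longrightarrow> range (e(v := a)) \<subseteq> U"
  by auto

text \<open>
  A tuple as an assignment of all variables. The default value keeps assignments inside the universe,
  which \<open>nth\<close> beyond the length of a list does not.
\<close>

definition pad :: "'a \<Rightarrow> 'a list \<Rightarrow> nat \<Rightarrow> 'a" where
  "pad d xs i = (if i < length xs then xs ! i else d)"

lemma pad_simps [simp]:
  "pad d (x # xs) 0 = x" "pad d (x # xs) (Suc i) = pad d xs i"
  "pad d (x # xs) 1 = pad d xs 0" "pad d (x # xs) (numeral n) = pad d xs (pred_numeral n)"
  by (auto simp: pad_def numeral_eq_Suc)

lemma sat_at_pad: "fv \<phi> \<subseteq> {..<length xs} \<Longrightarrow> sat_at M xs \<phi> \<longleftrightarrow> sat M (pad d xs) \<phi>"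
  unfolding sat_at_def by (rule sat_cong) (auto simp: pad_def)

lemma range_pad: "set xs \<subseteq> A \<Longrightarrow> d \<in> A \<Longrightarrow> range (pad d xs) \<subseteq> A"
  by (auto simp: pad_def)

text \<open>
  Simultaneous substitution. On formulas it is used without quantifiers only, so that capture is not
  an issue and the quantifier case can be arbitrary.
\<close>

primrec tsub :: "(nat \<Rightarrow> tm) \<Rightarrow> tm \<Rightarrow> tm" where
  "tsub \<sigma> (Var n) = \<sigma> n"
| "tsub \<sigma> Zero = Zero"
| "tsub \<sigma> One = One"
| "tsub \<sigma> (Add s t) = Add (tsub \<sigma> s) (tsub \<sigma> t)"
| "tsub \<sigma> (Floor t) = Floor (tsub \<sigma> t)"
| "tsub \<sigma> (Scale q t) = Scale q (tsub \<sigma> t)"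

primrec fsub :: "(nat \<Rightarrow> tm) \<Rightarrow> 'p fm \<Rightarrow> 'p fm" where
  "fsub \<sigma> (Eq s t) = Eq (tsub \<sigma> s) (tsub \<sigma> t)"
| "fsub \<sigma> (Less s t) = Less (tsub \<sigma> s) (tsub \<sigma> t)"
| "fsub \<sigma> (Holds p t) = Holds p (tsub \<sigma> t)"
| "fsub \<sigma> (Neg \<phi>) = Neg (fsub \<sigma> \<phi>)"
| "fsub \<sigma> (Conj \<phi> \<psi>) = Conj (fsub \<sigma> \<phi>) (fsub \<sigma> \<psi>)"
| "fsub \<sigma> (Ex n \<phi>) = Ex n \<phi>"

lemma eval_tsub: "eval_tm M e (tsub \<sigma> t) = eval_tm M (\<lambda>i. eval_tm M e (\<sigma> i)) t"
  by (induction t) auto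

lemma sat_fsub: "qf \<phi> \<Longrightarrow> sat M e (fsub \<sigma> \<phi>) = sat M (\<lambda>i. eval_tm M e (\<sigma> i)) \<phi>"
  by (induction \<phi>) (auto simp: eval_tsub)

lemma qf_fsub: "qf \<phi> \<Longrightarrow> qf (fsub \<sigma> \<phi>)"
  by (induction \<phi>) auto

lemma sat_fsub_single:
  "qf \<phi> \<Longrightarrow> sat M e (fsub (Var(v := t)) \<phi>) = sat M (e(v := eval_tm M e t)) \<phi>"
proof -
  have "(\<lambda>i. eval_tm M e ((Var(v := t)) i)) = e(v := eval_tm M e t)" by auto
  then show "qf \<phi> \<Longrightarrow> ?thesis" by (simp add: sat_fsub)
qed

lemma real_struct_simps [simp]:
  "univ real_struct = UNIV" "zeroI real_struct = 0" "oneI real_struct = 1"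
  "addI real_struct = (+)" "floorI real_struct = (\<lambda>x. of_int \<lfloor>x\<rfloor>)"
  "scaleI real_struct = (\<lambda>q x. of_rat q * x)" "lessI real_struct = (<)"
  "predI real_struct p = {0<..<1}"
  by (auto simp: real_struct_def)

lemma expand_simps [simp]:
  "univ (expand M P) = univ M" "zeroI (expand M P) = zeroI M" "oneI (expand M P) = oneI M"
  "addI (expand M P) = addI M" "floorI (expand M P) = floorI M"
  "scaleI (expand M P) = scaleI M" "lessI (expand M P) = lessI M"
  "predI (expand M P) S_LP = predI M S_L" "predI (expand M P) P_LP = P"
  by (auto simp: expand_def)

lemma eval_expand [simp]: "eval_tm (expand M P) e t = eval_tm M e t"
  by (induction t) auto

abbreviation liftP :: "L_pred fm \<Rightarrow> LP_pred fm" where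
  "liftP \<equiv> map_fm (\<lambda>_. S_LP)"

lemma sat_lift: "sat (expand M P) e (liftP \<phi>) \<longleftrightarrow> sat M e \<phi>"
proof (induction \<phi> arbitrary: e)
  case (Holds p t) then show ?case by (cases p) simp
qed auto

lemma qf_lift [simp]: "qf (liftP \<phi>) = qf \<phi>"
  by (induction \<phi>) auto

lemma wf_expand: "wf_struct M \<Longrightarrow> P \<subseteq> univ M \<Longrightarrow> wf_struct (expand M P)"
  by (auto simp: wf_struct_def split: LP_pred.splits simp: expand_def)

lemma wf_real: "wf_struct real_struct"
  by (auto simp: wf_struct_def)

text \<open>
  Iterated quantification over single variables amounts to quantification over assignments that
  change only these variables, even if a variable is repeated.
\<close>

lemma sat_Alls_iff:
  assumes "range e \<subseteq> univ M"
  shows "sat M e (Alls ns \<phi>) \<longleftrightarrow>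
    (\<forall>e'. range e' \<subseteq> univ M \<longrightarrow> (\<forall>i. i \<notin> set ns \<longrightarrow> e' i = e i) \<longrightarrow> sat M e' \<phi>)"
  using assms
proof (induction ns arbitrary: e)
  case Nil
  have "e' = e" if "\<forall>i. e' i = e i" for e' using that by blast
  with Nil show ?case by (auto simp: Alls_def)
next
  case (Cons n ns)
  have IH: "sat M (e(n := a)) (Alls ns \<phi>) \<longleftrightarrow>
      (\<forall>e'. range e' \<subseteq> univ M \<longrightarrow> (\<forall>i. i \<notin> set ns \<longrightarrow> e' i = (e(n := a)) i) \<longrightarrow> sat M e' \<phi>)"
    if "a \<in> univ M" for a
    by (rule Cons.IH) (rule range_upd[OF Cons.prems that])
  have "sat M e (Alls (n # ns) \<phi>) \<longleftrightarrow> (\<forall>a\<in>univ M. sat M (e(n := a)) (Alls ns \<phi>))"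
    by (simp add: Alls_def)
  also have "\<dots> \<longleftrightarrow> (\<forall>e'. range e' \<subseteq> univ M \<longrightarrow> (\<forall>i. i \<notin> set (n # ns) \<longrightarrow> e' i = e i) \<longrightarrow> sat M e' \<phi>)"
  proof (intro iffI allI impI ballI)
    fix e' assume all: "\<forall>a\<in>univ M. sat M (e(n := a)) (Alls ns \<phi>)" and e': "range e' \<subseteq> univ M"
      "\<forall>i. i \<notin> set (n # ns) \<longrightarrow> e' i = e i"
    have "e' n \<in> univ M" using e'(1) by blast
    then show "sat M e' \<phi>" using all IH[of "e' n"] e' by auto
  next
    fix a assume all: "\<forall>e'. range e' \<subseteq> univ M \<longrightarrow> (\<forall>i. i \<notin> set (n # ns) \<longrightarrow> e' i = e i) \<longrightarrow> sat M e' \<phi>"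
      and a: "a \<in> univ M"
    show "sat M (e(n := a)) (Alls ns \<phi>)"
      unfolding IH[OF a] using all by auto
  qed
  finally show ?case .
qed

definition closure :: "'p fm \<Rightarrow> 'p fm" where
  "closure \<phi> = Alls (sorted_list_of_set (fv \<phi>)) \<phi>"

lemma fv_closure [simp]: "fv (closure \<phi>) = {}"
  by (auto simp: closure_def)

lemma sat_closure:
  assumes "range e \<subseteq> univ M"
  shows "sat M e (closure \<phi>) \<longleftrightarrow> (\<forall>e'. range e' \<subseteq> univ M \<longrightarrow> sat M e' \<phi>)"
  unfolding closure_def sat_Alls_iff[OF assms]
proof (intro iffI allI impI)
  fix e' :: "nat \<Rightarrow> _"
  assume L: "\<forall>e'. range e' \<subseteq> univ M \<longrightarrow>
      (\<forall>i. i \<notin> set (sorted_list_of_set (fv \<phi>)) \<longrightarrow> e' i = e i) \<longrightarrow> sat M e' \<phi>"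
    and e': "range e' \<subseteq> univ M"
  let ?e = "\<lambda>i. if i \<in> fv \<phi> then e' i else e i"
  have "range ?e \<subseteq> univ M" using e' assms by auto
  then have "sat M ?e \<phi>" by (rule L[rule_format]) simp
  then show "sat M e' \<phi>" by (subst sat_cong[of \<phi> e' ?e]) auto
qed blast

lemma univ_nonempty: "wf_struct M \<Longrightarrow> \<exists>e :: nat \<Rightarrow> _. range e \<subseteq> univ M"
  by (rule exI[of _ "\<lambda>_. zeroI M"]) (auto simp: wf_struct_def)

text \<open>
  The theory consists of sentences; the universal closure makes every valid formula, with
  parameters from any model, available. All arithmetic in models of \<open>T\<close> is obtained in this way.
\<close>

lemma transfer:
  assumes "is_model M theory_T" "\<And>e. sat real_struct e \<phi>" "range e \<subseteq> univ M"
  shows "sat M e \<phi>"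
proof -
  have "closure \<phi> \<in> theory_T" using assms(2) by (auto simp: theory_T_def sat_closure)
  then have "sat M e (closure \<phi>)" using assms(1,3) unfolding is_model_def by blast
  then show ?thesis using assms(3) by (simp add: sat_closure)
qed

lemma elem_valid:
  assumes "elementary_embedding M N f" "wf_struct M"
    and "\<And>e. range e \<subseteq> univ M \<Longrightarrow> sat M e \<phi>" "range e \<subseteq> univ N"
  shows "sat N e \<phi>"
proof -
  obtain e0 :: "nat \<Rightarrow> _" where e0: "range e0 \<subseteq> univ M" using univ_nonempty[OF assms(2)] by blast
  have "sat M e0 (closure \<phi>)" using assms(3) e0 by (simp add: sat_closure)
  then have "sat N (f \<circ> e0) (closure \<phi>)" using assms(1) e0 by (auto simp: elementary_embedding_def)
  moreover have "range (f \<circ> e0) \<subseteq> univ N" using assms(1) e0 by (auto simp: elementary_embedding_def)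
  ultimately show ?thesis using assms(4) by (simp add: sat_closure)
qed

text \<open>
  The models of the universal part of \<open>T\<close>. They turn out to be the models of \<open>T\<close>, and membership is
  much easier to check: substructures of the reals belong to the class at once.
\<close>

definition univ_model :: "(L_pred, 'a) struct \<Rightarrow> bool" where
  "univ_model M \<longleftrightarrow> wf_struct M \<and>
     (\<forall>\<psi>. qf \<psi> \<longrightarrow> (\<forall>e. sat real_struct e \<psi>) \<longrightarrow> (\<forall>e. range e \<subseteq> univ M \<longrightarrow> sat M e \<psi>))"

lemma model_univ_model: "is_model M theory_T \<Longrightarrow> univ_model M"
  using transfer by (auto simp: univ_model_def is_model_def)

lemma univ_model_real: "univ_model real_struct"
  by (simp add: univ_model_def wf_real)

section \<open>Formulas in one variable over the real numbers\<close>

text \<open>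
  The quotient \<open>q\<close> and the remainder \<open>s\<close> of the variable \<open>v\<close> modulo \<open>N\<close>, as terms.
\<close>

definition qtm :: "nat \<Rightarrow> nat \<Rightarrow> tm" where
  "qtm v N = Floor (Scale (1 / of_nat N) (Var v))"

definition stm :: "nat \<Rightarrow> nat \<Rightarrow> tm" where
  "stm v N = Add (Var v) (Scale (- of_nat N) (qtm v N))"

text \<open>
  The conditions to which everything is reduced: \<open>q \<le> \<lfloor>w\<rfloor>\<close>, the position of \<open>s\<close> relative to \<open>u\<close>, the
  condition \<open>P(\<beta> s + u)\<close>, and formulas \<open>y\<close> that speak about parameters.
\<close>

definition basics ::
    "tm \<Rightarrow> tm \<Rightarrow> tm set \<Rightarrow> tm set \<Rightarrow> (rat \<times> tm) set \<Rightarrow> LP_pred fm set \<Rightarrow> LP_pred fm set" where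
  "basics q s W U B Y =
     (\<lambda>w. Neg (Less (Floor w) q)) ` W \<union> (\<lambda>u. Less s u) ` U \<union> (\<lambda>u. Eq s u) ` U \<union>
     (\<lambda>(\<beta>, u). Holds P_LP (Add (Scale \<beta> s) u)) ` B \<union> Y"

text \<open>
  The finiteness conditions, and the requirement that the variable \<open>v\<close> is confined to \<open>q\<close> and \<open>s\<close>.
\<close>

definition admissible ::
    "nat \<Rightarrow> tm set \<Rightarrow> tm set \<Rightarrow> (rat \<times> tm) set \<Rightarrow> LP_pred fm set \<Rightarrow> bool" where
  "admissible v W U B Y \<longleftrightarrow> finite W \<and> finite U \<and> finite B \<and> finite Y \<and>
     (\<forall>w\<in>W. v \<notin> fv_tm w) \<and> (\<forall>u\<in>U. v \<notin> fv_tm u) \<and>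
     (\<forall>(\<beta>, u)\<in>B. \<beta> \<noteq> 0 \<and> v \<notin> fv_tm u) \<and> (\<forall>y\<in>Y. qf y \<and> v \<notin> fv y)"

abbreviation Rp :: "real set \<Rightarrow> (LP_pred, real) struct" where
  "Rp P \<equiv> expand real_struct P"

abbreviation ev :: "(nat \<Rightarrow> real) \<Rightarrow> tm \<Rightarrow> real" where
  "ev \<equiv> eval_tm real_struct"

definition agree where
  "agree \<Delta> M e M' e' \<longleftrightarrow> (\<forall>\<delta>\<in>\<Delta>. sat M e \<delta> \<longleftrightarrow> sat M' e' \<delta>)"

text \<open>
  The value of \<open>f\<close> depends only on the truth values of finitely many basic conditions. The two
  assignments may differ in all variables, not only in \<open>v\<close>, and the predicate may differ as well:
  this uniformity in the parameters is what quantifier elimination needs. Working with functions of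
  arbitrary type lets case distinctions (which affine piece, which integer) be treated like truth values.
\<close>

definition determined :: "nat \<Rightarrow> nat \<Rightarrow> (real set \<Rightarrow> (nat \<Rightarrow> real) \<Rightarrow> 'b) \<Rightarrow> bool" where
  "determined v N f \<longleftrightarrow> (\<exists>W U B Y. admissible v W U B Y \<and>
     (\<forall>P e P' e'. P \<subseteq> {0<..<1} \<longrightarrow> P' \<subseteq> {0<..<1} \<longrightarrow>
        agree (basics (qtm v N) (stm v N) W U B Y) (Rp P) e (Rp P') e' \<longrightarrow> f P e = f P' e'))"

lemma admissible_Un:
  "admissible v W U B Y \<Longrightarrow> admissible v W' U' B' Y' \<Longrightarrow>
   admissible v (W \<union> W') (U \<union> U') (B \<union> B') (Y \<union> Y')"
  by (auto simp: admissible_def)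

lemma admissible_empty: "admissible v {} {} {} {}"
  by (simp add: admissible_def)

lemma agree_Un: "agree (\<Delta> \<union> \<Delta>') M e M' e' \<longleftrightarrow> agree \<Delta> M e M' e' \<and> agree \<Delta>' M e M' e'"
  by (auto simp: agree_def)

lemma basics_Un:
  "basics q s (W \<union> W') (U \<union> U') (B \<union> B') (Y \<union> Y') = basics q s W U B Y \<union> basics q s W' U' B' Y'"
  by (simp add: basics_def image_Un Un_ac)

lemma determinedI:
  assumes "admissible v W U B Y"
    "\<And>P e P' e'. P \<subseteq> {0<..<1} \<Longrightarrow> P' \<subseteq> {0<..<1} \<Longrightarrow>
       agree (basics (qtm v N) (stm v N) W U B Y) (Rp P) e (Rp P') e' \<Longrightarrow> f P e = f P' e'"
  shows "determined v N f"
  unfolding determined_def using assms by blast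

lemma determinedE:
  assumes "determined v N f"
  obtains W U B Y where "admissible v W U B Y"
    "\<And>P e P' e'. P \<subseteq> {0<..<1} \<Longrightarrow> P' \<subseteq> {0<..<1} \<Longrightarrow>
       agree (basics (qtm v N) (stm v N) W U B Y) (Rp P) e (Rp P') e' \<Longrightarrow> f P e = f P' e'"
  using assms unfolding determined_def by blast

lemma determined_const: "determined v N (\<lambda>P e. c)"
  by (rule determinedI[OF admissible_empty]) simp

lemma determined_app2:
  assumes "determined v N f" "determined v N g"
  shows "determined v N (\<lambda>P e. h (f P e) (g P e))"
proof -
  obtain W U B Y where 1: "admissible v W U B Y" and
    f: "\<And>P e P' e'. P \<subseteq> {0<..<1} \<Longrightarrow> P' \<subseteq> {0<..<1} \<Longrightarrow>
       agree (basics (qtm v N) (stm v N) W U B Y) (Rp P) e (Rp P') e' \<Longrightarrow> f P e = f P' e'"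
    by (rule determinedE[OF assms(1)]) blast
  obtain W' U' B' Y' where 2: "admissible v W' U' B' Y'" and
    g: "\<And>P e P' e'. P \<subseteq> {0<..<1} \<Longrightarrow> P' \<subseteq> {0<..<1} \<Longrightarrow>
       agree (basics (qtm v N) (stm v N) W' U' B' Y') (Rp P) e (Rp P') e' \<Longrightarrow> g P e = g P' e'"
    by (rule determinedE[OF assms(2)]) blast
  show ?thesis
  proof (rule determinedI[OF admissible_Un[OF 1 2]])
    fix P e P' e'
    assume P: "P \<subseteq> {0<..<1}" "P' \<subseteq> {0<..<1}"
      and "agree (basics (qtm v N) (stm v N) (W \<union> W') (U \<union> U') (B \<union> B') (Y \<union> Y')) (Rp P) e (Rp P') e'"
    then have "f P e = f P' e'" "g P e = g P' e'"
      using f[OF P] g[OF P] by (simp_all add: basics_Un agree_Un)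
    then show "h (f P e) (g P e) = h (f P' e') (g P' e')" by simp
  qed
qed

lemma determined_app1: "determined v N f \<Longrightarrow> determined v N (\<lambda>P e. h (f P e))"
  by (rule determined_app2[where g = "\<lambda>_ _. ()" and h = "\<lambda>x _. h x"]) (auto intro: determined_const)

lemma determined_family:
  assumes "finite L" "\<And>x. x \<in> L \<Longrightarrow> determined v N (g x)"
  shows "determined v N (\<lambda>P e. restrict (\<lambda>x. g x P e) L)"
  using assms
proof (induction L)
  case empty
  then show ?case by (simp add: restrict_def determined_const)
next
  case (insert a L)
  have "determined v N (\<lambda>P e. (\<lambda>y f. f(a := y)) (g a P e) (restrict (\<lambda>x. g x P e) L))"
    by (rule determined_app2[where f = "g a" and g = "\<lambda>P e. restrict (\<lambda>x. g x P e) L"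
          and h = "\<lambda>y f. f(a := y)", OF insert.prems insert.IH]) (use insert.prems in auto)
  moreover have "(restrict (\<lambda>x. g x P e) L)(a := g a P e) = restrict (\<lambda>x. g x P e) (insert a L)" for P e
    by (auto simp: restrict_def)
  ultimately show ?case by (simp only:)
qed

lemma determined_Collect:
  assumes "finite L" "\<And>x. x \<in> L \<Longrightarrow> determined v N (g x)"
  shows "determined v N (\<lambda>P e. {x \<in> L. g x P e})"
proof -
  have "determined v N (\<lambda>P e. (\<lambda>f. {x \<in> L. f x}) (restrict (\<lambda>x. g x P e) L))"
    by (rule determined_app1[OF determined_family]) (use assms in auto)
  then show ?thesis by (simp cong: conj_cong)
qed

text \<open>
  Definition by cases, where the case \<open>f P e\<close> is itself determined and ranges over a finite set.
\<close>

lemma determined_select: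
  assumes "finite L" "\<And>P e. f P e \<in> L" "determined v N f" "\<And>x. x \<in> L \<Longrightarrow> determined v N (g x)"
  shows "determined v N (\<lambda>P e. g (f P e) P e)"
proof -
  have "determined v N (\<lambda>P e. (\<lambda>k x. k x) (restrict (\<lambda>x. g x P e) L) (f P e))"
    by (rule determined_app2[OF determined_family]) (use assms in auto)
  then show ?thesis by (simp add: assms(2))
qed

lemma determined_cong:
  assumes "determined v N g" "\<And>P e. P \<subseteq> {0<..<1} \<Longrightarrow> f P e = g P e"
  shows "determined v N f"
proof -
  obtain W U B Y where 1: "admissible v W U B Y" and
    g: "\<And>P e P' e'. P \<subseteq> {0<..<1} \<Longrightarrow> P' \<subseteq> {0<..<1} \<Longrightarrow>
       agree (basics (qtm v N) (stm v N) W U B Y) (Rp P) e (Rp P') e' \<Longrightarrow> g P e = g P' e'"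
    by (rule determinedE[OF assms(1)]) blast
  show ?thesis
    by (rule determinedI[OF 1]) (simp add: assms(2) g)
qed

abbreviation "qv v N e \<equiv> ev e (qtm v N)"
abbreviation "sv v N e \<equiv> ev e (stm v N)"

lemma determined_Y: "qf y \<Longrightarrow> v \<notin> fv y \<Longrightarrow> determined v N (\<lambda>P e. sat (Rp P) e y)"
  by (rule determinedI[of _ "{}" "{}" "{}" "{y}"]) (auto simp: admissible_def agree_def basics_def)

lemma determined_W: "v \<notin> fv_tm w \<Longrightarrow> determined v N (\<lambda>P e. qv v N e \<le> ev e (Floor w))"
  by (rule determinedI[of _ "{w}" "{}" "{}" "{}"])
    (auto simp: admissible_def agree_def basics_def not_less)

lemma determined_U:
  assumes "v \<notin> fv_tm u"
  shows "determined v N (\<lambda>P e. sv v N e < ev e u)" "determined v N (\<lambda>P e. sv v N e = ev e u)"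
  using assms by (intro determinedI[of _ "{}" "{u}" "{}" "{}"];
    simp add: admissible_def agree_def basics_def)+

lemma determined_U_greater:
  assumes "v \<notin> fv_tm u"
  shows "determined v N (\<lambda>P e. sv v N e > ev e u)"
proof -
  have "determined v N (\<lambda>P e. (\<lambda>a b. \<not> a \<and> \<not> b) (sv v N e < ev e u) (sv v N e = ev e u))"
    by (rule determined_app2) (use assms in \<open>auto intro: determined_U\<close>)
  then show ?thesis by (rule determined_cong) auto
qed

lemma determined_B:
  assumes "v \<notin> fv_tm u" "\<beta> \<noteq> 0"
  shows "determined v N (\<lambda>P e. of_rat \<beta> * sv v N e + ev e u \<in> P)"
  using assms by (intro determinedI[of _ "{}" "{}" "{(\<beta>, u)}" "{}"])
    (auto simp: admissible_def agree_def basics_def)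

text \<open>
  The four kinds of atoms, each as the set in which a value is required to lie. Apart from the values in
  \<open>(-1,1)\<close> membership depends on the sign only, as long as \<open>P \<subseteq> (0,1)\<close>.
\<close>

definition atomic_set :: "(real set \<Rightarrow> real set) \<Rightarrow> bool" where
  "atomic_set A \<longleftrightarrow> A = (\<lambda>P. {0}) \<or> A = (\<lambda>P. {..<0}) \<or> A = (\<lambda>P. {0<..<1}) \<or> A = (\<lambda>P. P)"

lemma atomic_sets [simp]:
  "atomic_set (\<lambda>P. {0})" "atomic_set (\<lambda>P. {..<0})" "atomic_set (\<lambda>P. {0<..<1})" "atomic_set (\<lambda>P. P)"
  by (auto simp: atomic_set_def)

text \<open>
  Dividing by \<open>\<beta>\<close> turns the first three kinds of atoms into comparisons of \<open>s\<close> with a parameter; the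
  fourth kind is a basic condition itself.
\<close>

lemma determined_bounded_atom:
  assumes A: "atomic_set A" and u: "v \<notin> fv_tm u"
  shows "determined v N (\<lambda>P e. of_rat \<beta> * sv v N e + ev e u \<in> A P)"
proof (cases "\<beta> = 0")
  case True
  let ?y = "if A = (\<lambda>P. {0}) then Eq u Zero else if A = (\<lambda>P. {..<0}) then Less u Zero
    else if A = (\<lambda>P. {0<..<1}) then Holds S_LP u else Holds P_LP u"
  have "determined v N (\<lambda>P e. sat (Rp P) e ?y)"
    by (rule determined_Y) (use u in auto)
  moreover have "sat (Rp P) e ?y \<longleftrightarrow> of_rat \<beta> * sv v N e + ev e u \<in> A P" for P e
    using A True by (auto simp: atomic_set_def)
  ultimately show ?thesis by simp
next
  case False
  define c where "c = Scale (- 1 / \<beta>) u"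
  define d where "d = Scale (1 / \<beta>) (Add One (Scale (-1) u))"
  define b :: real where "b = of_rat \<beta>"
  have b: "b \<noteq> 0" using False by (simp add: b_def)
  have c: "v \<notin> fv_tm c" "ev e c = - ev e u / b" for e
    using u by (auto simp: c_def b_def of_rat_divide of_rat_minus)
  have d: "v \<notin> fv_tm d" "ev e d = (1 - ev e u) / b" for e
    using u by (auto simp: d_def b_def of_rat_divide of_rat_minus)
  have zero: "b * x + y = 0 \<longleftrightarrow> x = - y / b" for x y
    using b by (auto simp: field_simps eq_neg_iff_add_eq_0)
  have neg: "b * x + y < 0 \<longleftrightarrow> (if b > 0 then x < - y / b else x > - y / b)" for x y
    using b by (auto simp: field_simps)
  have less1: "b * x + y < 1 \<longleftrightarrow> (if b > 0 then x < (1 - y) / b else x > (1 - y) / b)" for x y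
    using b by (auto simp: field_simps)
  have pos: "b * x + y > 0 \<longleftrightarrow> (if b > 0 then x > - y / b else x < - y / b)" for x y
    using b by (auto simp: field_simps)
  consider "A = (\<lambda>P. {0})" | "A = (\<lambda>P. {..<0})" | "A = (\<lambda>P. {0<..<1})" | "A = (\<lambda>P. P)"
    using A by (auto simp: atomic_set_def)
  then show ?thesis
  proof cases
    case 1
    then show ?thesis using determined_U(2)[OF c(1), of N] by (simp add: c(2) zero flip: b_def)
  next
    case 2
    then show ?thesis
      using determined_U(1)[OF c(1), of N] determined_U_greater[OF c(1), of N]
      by (cases "b > 0") (simp_all add: c(2) neg flip: b_def)
  next
    case 3
    have "determined v N (\<lambda>P e. b * sv v N e + ev e u > 0)"
      using determined_U(1)[OF c(1), of N] determined_U_greater[OF c(1), of N]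
      by (cases "b > 0") (simp_all add: c(2) pos)
    moreover have "determined v N (\<lambda>P e. b * sv v N e + ev e u < 1)"
      using determined_U(1)[OF d(1), of N] determined_U_greater[OF d(1), of N]
      by (cases "b > 0") (simp_all add: d(2) less1)
    ultimately have "determined v N (\<lambda>P e. b * sv v N e + ev e u > 0 \<and> b * sv v N e + ev e u < 1)"
      by (rule determined_app2)
    then show ?thesis using 3 by (simp flip: b_def)
  next
    case 4
    then show ?thesis using determined_B[OF u False] by simp
  qed
qed


lemma qv_int: "qv v N e = of_int \<lfloor>e v / N\<rfloor>"
  by (simp add: qtm_def of_rat_divide)

lemma sv_eq: "sv v N e = e v - N * qv v N e"
  by (simp add: stm_def of_rat_minus)

lemma sv_bounds:
  assumes "N > 0"
  shows "0 \<le> sv v N e" "sv v N e < N"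
proof -
  have "of_int \<lfloor>e v / N\<rfloor> \<le> e v / N" "e v / N < of_int \<lfloor>e v / N\<rfloor> + 1" by linarith+
  then have "real_of_int \<lfloor>e v / N\<rfloor> * real N \<le> e v" "e v < (real_of_int \<lfloor>e v / N\<rfloor> + 1) * real N"
    using assms by (simp_all only: pos_le_divide_eq pos_divide_less_eq of_nat_0_less_iff)
  then show "0 \<le> sv v N e" "sv v N e < N"
    using assms unfolding sv_eq qv_int by (simp_all add: field_simps)
qed

text \<open>
  The two coordinates separate. As \<open>\<beta> s\<close> is bounded, the integer \<open>q\<close> alone decides the atom unless \<open>q\<close>
  is one of the finitely many integers \<open>\<lfloor>w\<rfloor> + k\<close> with \<open>\<bar>k\<bar> \<le> K\<close>, where \<open>w = - u / \<alpha>\<close>. For each of these, \<open>q\<close> can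
  be replaced by a term without \<open>v\<close>, and a condition on \<open>s\<close> remains.
\<close>

lemma determined_affine_atom:
  assumes A: "atomic_set A" and u: "v \<notin> fv_tm u" and N: "N > 0"
  shows "determined v N (\<lambda>P e. of_rat \<alpha> * qv v N e + of_rat \<beta> * sv v N e + ev e u \<in> A P)"
proof (cases "\<alpha> = 0")
  case True
  then show ?thesis using determined_bounded_atom[OF A u] by simp
next
  case False
  define a b :: real where "a = of_rat \<alpha>" and "b = of_rat \<beta>"
  have a: "a \<noteq> 0" using False by (simp add: a_def)
  obtain K :: int where K: "of_int K \<ge> (\<bar>b\<bar> * N + 1) / \<bar>a\<bar> + 1"
    by (meson ex_le_of_int)
  then have K0: "K \<ge> 0"
  proof -
    have "(0::real) \<le> (\<bar>b\<bar> * N + 1) / \<bar>a\<bar> + 1" by simp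
    then have "(0::real) \<le> of_int K" using K by linarith
    then show ?thesis by simp
  qed
  define w where "w = Scale (- 1 / \<alpha>) u"
  define wk where "wk k = Add w (Scale (of_int k) One)" for k :: int
  have w: "v \<notin> fv_tm w" "ev e w = - ev e u / a" for e
    using u by (auto simp: w_def a_def of_rat_divide of_rat_minus)
  have wk: "v \<notin> fv_tm (wk k)" "ev e (Floor (wk k)) = of_int (\<lfloor>ev e w\<rfloor> + k)" for e k
    using w(1) by (simp_all add: wk_def)
  \<comment> \<open>The offset of \<open>q\<close> from \<open>\<lfloor>w\<rfloor>\<close>, cut off at the two values that stand for all large offsets.\<close>
  define kk where "kk e = max (- K - 1) (min (K + 1) (\<lfloor>e v / N\<rfloor> - \<lfloor>ev e w\<rfloor>))" for e :: "nat \<Rightarrow> real"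
  define m where "m S = (if S = {} then K + 1 else Min S)" for S
  have kk_eq: "kk e = m {j \<in> {- K - 1..K}. qv v N e \<le> ev e (Floor (wk j))}" for e
  proof -
    let ?d = "\<lfloor>e v / N\<rfloor> - \<lfloor>ev e w\<rfloor>"
    have S: "{j \<in> {- K - 1..K}. qv v N e \<le> ev e (Floor (wk j))} = {max (- K - 1) ?d..K}" (is "?S = _")
      unfolding qv_int wk(2) of_int_le_iff by auto
    show ?thesis
    proof (cases "?d > K")
      case True
      then have "?S = {}" unfolding S using K0 by simp
      then show ?thesis using True K0 by (simp only: m_def kk_def) simp
    next
      case False
      then have "?S \<noteq> {}" "Min ?S = max (- K - 1) ?d" unfolding S using K0 by (auto intro!: Min_eqI)
      then show ?thesis using False by (simp only: m_def kk_def) simp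
    qed
  qed
  have kk: "determined v N (\<lambda>P e. kk e)"
    unfolding kk_eq by (rule determined_app1, rule determined_Collect, simp, rule determined_W, rule wk(1))
  \<comment> \<open>Far away from \<open>w\<close> only the sign matters; \<open>- 1 \<in> A {}\<close> says that \<open>A\<close> is the kind \<open>{..<0}\<close>.\<close>
  define g where "g k P e \<longleftrightarrow> (if k = K + 1 then a < 0 \<and> - 1 \<in> A {}
      else if k = - K - 1 then a > 0 \<and> - 1 \<in> A {}
      else b * sv v N e + ev e (Add u (Scale \<alpha> (Floor (wk k)))) \<in> A P)" for k :: int and P e
  have g: "determined v N (g k)" for k
  proof -
    consider "k = K + 1" | "k = - K - 1" "k \<noteq> K + 1" | "k \<noteq> - K - 1" "k \<noteq> K + 1" by blast
    then show ?thesis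
    proof cases
      case 3
      then have "g k = (\<lambda>P e. b * sv v N e + ev e (Add u (Scale \<alpha> (Floor (wk k)))) \<in> A P)"
        by (intro ext) (simp add: g_def)
      then show ?thesis
        using determined_bounded_atom[OF A, of v "Add u (Scale \<alpha> (Floor (wk k)))" N \<beta>] u wk(1)[of k]
        by (simp add: b_def)
    qed (use K0 in \<open>auto simp: g_def[abs_def] determined_const\<close>)
  qed
  have sel: "determined v N (\<lambda>P e. g (kk e) P e)"
    by (rule determined_select[where L = "{- K - 1..K + 1}" and f = "\<lambda>P e. kk e"])
      (use kk g K0 in \<open>auto simp: kk_def\<close>)
  have eq: "a * qv v N e + b * sv v N e + ev e u \<in> A P \<longleftrightarrow> g (kk e) P e" if P: "P \<subseteq> {0<..<1}" for P e
  proof -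
    let ?d = "\<lfloor>e v / N\<rfloor> - \<lfloor>ev e w\<rfloor>"
    let ?z = "a * qv v N e + b * sv v N e + ev e u"
    have uw: "ev e u = - a * ev e w" using w(2)[of e] a by simp
    have z: "?z = a * (of_int \<lfloor>e v / N\<rfloor> - ev e w) + b * sv v N e"
      by (simp add: uw qv_int algebra_simps)
    have bs: "\<bar>b * sv v N e\<bar> \<le> \<bar>b\<bar> * N"
      using sv_bounds[OF N, where v = v and e = e] by (simp add: abs_mult mult_left_mono)
    have K': "\<bar>a\<bar> * (of_int K - 1) \<ge> \<bar>b\<bar> * N + 1"
      using K a by (simp add: field_simps)
    then have K1: "a > 0 \<Longrightarrow> a * (of_int K - 1) \<ge> \<bar>b\<bar> * N + 1"
      and K2: "a < 0 \<Longrightarrow> - a * (of_int K - 1) \<ge> \<bar>b\<bar> * N + 1" by simp_all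
    have bs1: "b * sv v N e \<le> \<bar>b\<bar> * N" "- (\<bar>b\<bar> * N) \<le> b * sv v N e" using bs by linarith+
    have fl: "of_int \<lfloor>ev e w\<rfloor> \<le> ev e w" "ev e w < of_int \<lfloor>ev e w\<rfloor> + 1" by linarith+
    consider "?d > K" | "?d < - K" | "- K \<le> ?d" "?d \<le> K" by linarith
    then show ?thesis
    proof cases
      case 1
      then have kk: "kk e = K + 1" using K0 by (simp add: kk_def)
      have "real_of_int \<lfloor>e v / N\<rfloor> - of_int \<lfloor>ev e w\<rfloor> \<ge> of_int K + 1" using 1 by linarith
      then have d: "of_int \<lfloor>e v / N\<rfloor> - ev e w \<ge> of_int K - 1" using fl by linarith
      have "?z \<ge> 1" if p: "a > 0"
        using mult_left_mono[OF d, of a, OF less_imp_le[OF p]] K1[OF p] bs1 unfolding z by (simp only: mult_minus_right mult_minus_left minus_minus; linarith) 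
      moreover have "?z \<le> - 1" if p: "a < 0"
        using mult_left_mono[OF d, of "-a", OF neg_0_le_iff_le[THEN iffD2, OF less_imp_le[OF p]]] K2[OF p] bs1 unfolding z by (simp only: mult_minus_right mult_minus_left minus_minus; linarith)
      ultimately show ?thesis using a A P by (cases "a > 0") (auto simp: kk g_def atomic_set_def)
    next
      case 2
      then have kk: "kk e = - K - 1" using K0 by (simp add: kk_def)
      have "real_of_int \<lfloor>e v / N\<rfloor> - of_int \<lfloor>ev e w\<rfloor> \<le> - of_int K - 1" using 2 by linarith
      then have d: "of_int K - 1 \<le> - (of_int \<lfloor>e v / N\<rfloor> - ev e w)" using fl by linarith
      have "?z \<le> - 1" if p: "a > 0"
        using mult_left_mono[OF d, of a, OF less_imp_le[OF p]] K1[OF p] bs1 unfolding z by (simp only: mult_minus_right mult_minus_left minus_minus; linarith) 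
      moreover have "?z \<ge> 1" if p: "a < 0"
        using mult_left_mono[OF d, of "-a", OF neg_0_le_iff_le[THEN iffD2, OF less_imp_le[OF p]]] K2[OF p] bs1 unfolding z by (simp only: mult_minus_right mult_minus_left minus_minus; linarith)
      ultimately show ?thesis using a A P K0 by (cases "a > 0") (auto simp: kk g_def atomic_set_def)
    next
      case 3
      then have kk: "kk e = ?d" by (simp add: kk_def)
      have zeq: "?z = b * sv v N e + ev e (Add u (Scale \<alpha> (Floor (wk ?d))))"
        using wk(2)[of e ?d] by (simp add: qv_int flip: a_def)
      have "g (kk e) P e \<longleftrightarrow> b * sv v N e + ev e (Add u (Scale \<alpha> (Floor (wk ?d)))) \<in> A P"
        unfolding kk g_def using 3 by auto
      then show ?thesis unfolding zeq by (simp only:)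
    qed
  qed
  show ?thesis using determined_cong[OF sel eq] by (simp add: a_def b_def)
qed

text \<open>
  The average growth of a term in the variable \<open>v\<close>.
\<close>

primrec slope :: "nat \<Rightarrow> tm \<Rightarrow> rat" where
  "slope v (Var n) = (if n = v then 1 else 0)"
| "slope v Zero = 0"
| "slope v One = 0"
| "slope v (Add s t) = slope v s + slope v t"
| "slope v (Floor t) = slope v t"
| "slope v (Scale q t) = q * slope v t"

text \<open>
  The divisibility condition on \<open>N\<close> under which the term satisfies
  \<open>t(x + N q) = t(x) + N (slope t) q\<close> for all integers \<open>q\<close>.
\<close>

primrec period_tm :: "nat \<Rightarrow> nat \<Rightarrow> tm \<Rightarrow> bool" where
  "period_tm v N (Var n) = True"
| "period_tm v N Zero = True"
| "period_tm v N One = True"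
| "period_tm v N (Add s t) = (period_tm v N s \<and> period_tm v N t)"
| "period_tm v N (Floor t) = (period_tm v N t \<and> of_nat N * slope v t \<in> \<int>)"
| "period_tm v N (Scale q t) = period_tm v N t"

text \<open>
  The function \<open>pc\<close> selects, in a determined way, one of the finitely many affine pieces in \<open>L\<close>. The
  coefficient of \<open>q\<close> is the same for all of them.
\<close>

definition affine_pieces where
  "affine_pieces v N t L pc \<longleftrightarrow> finite L \<and> (\<forall>(\<beta>, u)\<in>L. v \<notin> fv_tm u) \<and> (\<forall>P e. pc P e \<in> L) \<and>
     determined v N pc \<and>
     (\<forall>P e. ev e t = of_rat (of_nat N * slope v t) * qv v N e + of_rat (fst (pc P e)) * sv v N e + ev e (snd (pc P e)))"

text \<open>
  Since \<open>s\<close> is bounded, the integral part of \<open>\<beta> s + u\<close> is within a fixed distance of that of \<open>u\<close>, and the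
  difference is decided by the position of \<open>s\<close>.
\<close>

lemma determined_floor:
  assumes u: "v \<notin> fv_tm u" and N: "N > 0"
  shows "determined v N (\<lambda>P e. \<lfloor>of_rat \<beta> * sv v N e + ev e u\<rfloor> - \<lfloor>ev e u\<rfloor>)"
    "\<exists>K. \<forall>e. \<lfloor>of_rat \<beta> * sv v N e + ev e u\<rfloor> - \<lfloor>ev e u\<rfloor> \<in> {-K..K}"
proof -
  define b :: real where "b = of_rat \<beta>"
  obtain K :: int where K: "of_int K \<ge> \<bar>b\<bar> * N + 1"
    by (meson ex_le_of_int)
  define k where "k e = \<lfloor>b * sv v N e + ev e u\<rfloor> - \<lfloor>ev e u\<rfloor>" for e
  have kK: "k e \<in> {-K..K}" for e
  proof -
    have bs: "\<bar>b * sv v N e\<bar> \<le> \<bar>b\<bar> * N"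
      using sv_bounds[OF N, where v = v and e = e] by (simp add: abs_mult mult_left_mono)
    have "\<lfloor>b * sv v N e + ev e u\<rfloor> < \<lfloor>ev e u\<rfloor> + K + 1" "\<lfloor>b * sv v N e + ev e u\<rfloor> > \<lfloor>ev e u\<rfloor> - K - 1"
      using bs K by linarith+
    then show ?thesis by (simp add: k_def)
  qed
  have D: "determined v N (\<lambda>P e. \<not> (b * sv v N e + ev e (Add u (Scale (-1) (Add (Floor u) (Scale (of_int j) One)))) \<in> {..<0}))" for j
    unfolding b_def
    by (rule determined_app1[OF determined_bounded_atom[where A = "\<lambda>P. {..<0}"]]) (use u in auto)
  have D2: "determined v N (\<lambda>P e. of_int (\<lfloor>ev e u\<rfloor> + j) \<le> b * sv v N e + ev e u)" for j
    by (rule determined_cong[OF D[of j]]) (auto simp: of_rat_minus)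
  have "determined v N (\<lambda>P e. Max {j \<in> {-K..K}. of_int (\<lfloor>ev e u\<rfloor> + j) \<le> b * sv v N e + ev e u})"
    by (rule determined_app1, rule determined_Collect, simp, rule D2)
  moreover have "Max {j \<in> {-K..K}. of_int (\<lfloor>ev e u\<rfloor> + j) \<le> b * sv v N e + ev e u} = k e" for e
  proof (rule Max_eqI)
    show "finite {j \<in> {-K..K}. of_int (\<lfloor>ev e u\<rfloor> + j) \<le> b * sv v N e + ev e u}"
      by (rule finite_subset[of _ "{-K..K}"]) auto
    show "k e \<in> {j \<in> {-K..K}. of_int (\<lfloor>ev e u\<rfloor> + j) \<le> b * sv v N e + ev e u}"
      using kK[of e] by (simp add: k_def; linarith)
    fix j assume "j \<in> {j \<in> {-K..K}. of_int (\<lfloor>ev e u\<rfloor> + j) \<le> b * sv v N e + ev e u}"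
    then have "\<lfloor>ev e u\<rfloor> + j \<le> \<lfloor>b * sv v N e + ev e u\<rfloor>" by (auto simp: le_floor_iff)
    then show "j \<le> k e" by (simp add: k_def)
  qed
  ultimately show "determined v N (\<lambda>P e. \<lfloor>of_rat \<beta> * sv v N e + ev e u\<rfloor> - \<lfloor>ev e u\<rfloor>)"
    by (simp add: k_def b_def)
  show "\<exists>K. \<forall>e. \<lfloor>of_rat \<beta> * sv v N e + ev e u\<rfloor> - \<lfloor>ev e u\<rfloor> \<in> {-K..K}"
    using kK by (intro exI[of _ K]) (simp add: k_def b_def)
qed

text \<open>
  In the case of \<open>Floor t\<close> the coefficient of \<open>q\<close> is an integer by the choice of \<open>N\<close>, hence it can be
  taken out of the integral part, and \<open>determined_floor\<close> applies to what is left.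
\<close>

lemma ex_affine_pieces:
  assumes N: "N > 0"
  shows "period_tm v N t \<Longrightarrow> \<exists>L pc. affine_pieces v N t L pc"
proof (induction t)
  case (Var n)
  show ?case
  proof (cases "n = v")
    case True
    have "affine_pieces v N (Var n) {(1, Zero)} (\<lambda>P e. (1, Zero))"
      using True by (simp add: affine_pieces_def determined_const sv_eq)
    then show ?thesis by blast
  next
    case False
    have "affine_pieces v N (Var n) {(0, Var n)} (\<lambda>P e. (0, Var n))"
      using False by (simp add: affine_pieces_def determined_const)
    then show ?thesis by blast
  qed
next
  case Zero
  have "affine_pieces v N Zero {(0, Zero)} (\<lambda>P e. (0, Zero))"
    by (simp add: affine_pieces_def determined_const)
  then show ?case by blast
next
  case One
  have "affine_pieces v N One {(0, One)} (\<lambda>P e. (0, One))"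
    by (simp add: affine_pieces_def determined_const)
  then show ?case by blast
next
  case (Add s t)
  then obtain L pc L' pc' where s: "affine_pieces v N s L pc" and t: "affine_pieces v N t L' pc'" by auto
  let ?h = "\<lambda>(\<beta>, u) (\<beta>', u'). (\<beta> + \<beta>', tm.Add u u')"
  have "determined v N (\<lambda>P e. ?h (pc P e) (pc' P e))"
    by (rule determined_app2) (use s t in \<open>auto simp: affine_pieces_def\<close>)
  moreover have "finite ((\<lambda>(x, y). ?h x y) ` (L \<times> L'))"
    using s t by (auto simp: affine_pieces_def)
  moreover have "?h (pc P e) (pc' P e) \<in> (\<lambda>(x, y). ?h x y) ` (L \<times> L')" for P e
    using s t by (auto simp: affine_pieces_def)
  moreover have "\<forall>(\<beta>, u)\<in>(\<lambda>(x, y). ?h x y) ` (L \<times> L'). v \<notin> fv_tm u"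
    using s t by (auto simp: affine_pieces_def)
  moreover have "ev e (tm.Add s t) = of_rat (of_nat N * slope v (tm.Add s t)) * qv v N e +
      of_rat (fst (?h (pc P e) (pc' P e))) * sv v N e + ev e (snd (?h (pc P e) (pc' P e)))" for P e
  proof -
    have "ev e s = of_rat (of_nat N * slope v s) * qv v N e + of_rat (fst (pc P e)) * sv v N e + ev e (snd (pc P e))"
      "ev e t = of_rat (of_nat N * slope v t) * qv v N e + of_rat (fst (pc' P e)) * sv v N e + ev e (snd (pc' P e))"
      using s t by (auto simp: affine_pieces_def)
    then show ?thesis by (simp add: split_beta of_rat_add of_rat_mult algebra_simps)
  qed
  ultimately have "affine_pieces v N (tm.Add s t) ((\<lambda>(x, y). ?h x y) ` (L \<times> L')) (\<lambda>P e. ?h (pc P e) (pc' P e))"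
    unfolding affine_pieces_def by blast
  then show ?case by blast
next
  case (Floor t)
  then obtain L pc where t: "affine_pieces v N t L pc" and int: "of_nat N * slope v t \<in> \<int>" by auto
  define k where "k x e = \<lfloor>of_rat (fst x) * sv v N e + ev e (snd x)\<rfloor> - \<lfloor>ev e (snd x)\<rfloor>"
    for x :: "rat \<times> tm" and e
  define h where "h x j = (0 :: rat, tm.Add (tm.Floor (snd x)) (tm.Scale (of_int j) tm.One))"
    for x :: "rat \<times> tm" and j :: int
  have kdet: "determined v N (\<lambda>P e. k x e)" if "x \<in> L" for x
    using that t unfolding k_def by (intro determined_floor N) (auto simp: affine_pieces_def)
  have "\<exists>K. \<forall>e. k x e \<in> {-K..K}" if "x \<in> L" for x
    using that t unfolding k_def by (intro determined_floor N) (auto simp: affine_pieces_def)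
  then obtain K where K: "\<And>x e. x \<in> L \<Longrightarrow> k x e \<in> {-K x..K x}" by metis
  define L' where "L' = (\<Union>x\<in>L. h x ` {-K x..K x})"
  define pc' where "pc' P e = h (pc P e) (k (pc P e) e)" for P e
  have "determined v N (\<lambda>P e. h (pc P e) (k (pc P e) e))"
    by (rule determined_select[where f = pc and g = "\<lambda>x P e. h x (k x e)" and L = L])
      (use t in \<open>auto simp: affine_pieces_def intro: determined_app1[OF kdet]\<close>)
  then have "determined v N pc'" by (simp add: pc'_def[abs_def])
  moreover have "finite L'" "\<forall>(\<beta>, u)\<in>L'. v \<notin> fv_tm u"
    using t by (auto simp: L'_def affine_pieces_def h_def)
  moreover have "pc' P e \<in> L'" for P e
  proof -
    have "pc P e \<in> L" using t by (auto simp: affine_pieces_def)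
    then show ?thesis unfolding L'_def pc'_def by (rule UN_I) (rule imageI, rule K, fact)
  qed
  moreover have "ev e (tm.Floor t) = of_rat (of_nat N * slope v (tm.Floor t)) * qv v N e +
      of_rat (fst (pc' P e)) * sv v N e + ev e (snd (pc' P e))" for P e
  proof -
    obtain m where m: "of_nat N * slope v t = of_int m" using int by (auto elim: Ints_cases)
    have "ev e t = of_rat (of_nat N * slope v t) * qv v N e + of_rat (fst (pc P e)) * sv v N e + ev e (snd (pc P e))"
      using t by (auto simp: affine_pieces_def)
    also have "\<dots> = of_int (m * \<lfloor>e v / N\<rfloor>) + (of_rat (fst (pc P e)) * sv v N e + ev e (snd (pc P e)))"
      by (simp add: m qv_int)
    finally have "\<lfloor>ev e t\<rfloor> = m * \<lfloor>e v / N\<rfloor> + \<lfloor>of_rat (fst (pc P e)) * sv v N e + ev e (snd (pc P e))\<rfloor>"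
      by (simp only: int_add_floor)
    then show ?thesis by (simp add: pc'_def h_def k_def m qv_int of_rat_diff)
  qed
  ultimately have "affine_pieces v N (tm.Floor t) L' pc'"
    unfolding affine_pieces_def by blast
  then show ?case by blast
next
  case (Scale c t)
  then obtain L pc where t: "affine_pieces v N t L pc" by auto
  let ?h = "\<lambda>(\<beta>, u). (c * \<beta>, tm.Scale c u)"
  have "determined v N (\<lambda>P e. ?h (pc P e))"
    by (rule determined_app1) (use t in \<open>auto simp: affine_pieces_def\<close>)
  moreover have "finite (?h ` L)" "?h (pc P e) \<in> ?h ` L" "\<forall>(\<beta>, u)\<in>?h ` L. v \<notin> fv_tm u" for P e
    using t by (auto simp: affine_pieces_def)
  moreover have "ev e (tm.Scale c t) = of_rat (of_nat N * slope v (tm.Scale c t)) * qv v N e +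
      of_rat (fst (?h (pc P e))) * sv v N e + ev e (snd (?h (pc P e)))" for P e
  proof -
    have "ev e t = of_rat (of_nat N * slope v t) * qv v N e + of_rat (fst (pc P e)) * sv v N e + ev e (snd (pc P e))"
      using t by (auto simp: affine_pieces_def)
    then show ?thesis by (simp add: split_beta of_rat_mult algebra_simps)
  qed
  ultimately have "affine_pieces v N (tm.Scale c t) (?h ` L) (\<lambda>P e. ?h (pc P e))"
    unfolding affine_pieces_def by blast
  then show ?case by blast
qed

primrec period :: "nat \<Rightarrow> nat \<Rightarrow> 'p fm \<Rightarrow> bool" where
  "period v N (Eq s t) = (period_tm v N s \<and> period_tm v N t)"
| "period v N (Less s t) = (period_tm v N s \<and> period_tm v N t)"
| "period v N (Holds p t) = period_tm v N t"
| "period v N (Neg \<phi>) = period v N \<phi>"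
| "period v N (Conj \<phi> \<psi>) = (period v N \<phi> \<and> period v N \<psi>)"
| "period v N (Ex n \<phi>) = False"

lemma determined_term_atom:
  assumes N: "N > 0" and t: "period_tm v N t" and A: "atomic_set A"
  shows "determined v N (\<lambda>P e. ev e t \<in> A P)"
proof -
  obtain L pc where pc: "affine_pieces v N t L pc" using ex_affine_pieces[OF N t] by blast
  let ?g = "\<lambda>x P e. of_rat (of_nat N * slope v t) * qv v N e + of_rat (fst x) * sv v N e + ev e (snd x) \<in> A P"
  have "determined v N (\<lambda>P e. ?g (pc P e) P e)"
    by (rule determined_select[where f = pc and g = ?g and L = L])
      (use pc in \<open>auto simp: affine_pieces_def intro!: determined_affine_atom A N\<close>)
  moreover have "ev e t \<in> A P \<longleftrightarrow> ?g (pc P e) P e" for P e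
    using pc by (auto simp: affine_pieces_def)
  ultimately show ?thesis by simp
qed

text \<open>
  The normal form over the real numbers; atoms are brought into the form in which a single term lies in
  an \<open>atomic_set\<close>.
\<close>

theorem determined_qf:
  assumes N: "N > 0"
  shows "qf \<phi> \<Longrightarrow> period v N \<phi> \<Longrightarrow> determined v N (\<lambda>P e. sat (Rp P) e \<phi>)"
proof (induction \<phi>)
  case (Eq s t)
  have "determined v N (\<lambda>P e. ev e (Add s (Scale (-1) t)) \<in> {0})"
    by (rule determined_term_atom[OF N, where A = "\<lambda>P. {0}"]) (use Eq in auto)
  then show ?case by (simp add: of_rat_minus)
next
  case (Less s t)
  have "determined v N (\<lambda>P e. ev e (Add s (Scale (-1) t)) \<in> {..<0})"
    by (rule determined_term_atom[OF N, where A = "\<lambda>P. {..<0}"]) (use Less in auto)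
  then show ?case by (simp add: of_rat_minus)
next
  case (Holds p t)
  have "determined v N (\<lambda>P e. ev e t \<in> {0<..<1})"
    by (rule determined_term_atom[OF N, where A = "\<lambda>P. {0<..<1}"]) (use Holds in auto)
  moreover have "determined v N (\<lambda>P e. ev e t \<in> P)"
    by (rule determined_term_atom[OF N, where A = "\<lambda>P. P"]) (use Holds in auto)
  ultimately show ?case by (cases p) simp_all
next
  case (Neg \<phi>)
  then show ?case using determined_app1[where h = Not] by simp
next
  case (Conj \<phi> \<psi>)
  then show ?case using determined_app2[where h = "(\<and>)"] by simp
qed simp

lemma period_tm_dvd: "period_tm v N t \<Longrightarrow> N dvd N' \<Longrightarrow> period_tm v N' t"
proof (induction t)
  case (Floor t)
  obtain k where k: "N' = N * k" using Floor.prems(2) by (auto simp: dvd_def)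
  have "of_nat N' * slope v t = of_nat k * (of_nat N * slope v t)" by (simp add: k ac_simps)
  also have "\<dots> \<in> \<int>" by (rule Ints_mult) (use Floor.prems in auto)
  finally have "of_nat N' * slope v t \<in> \<int>" .
  then show ?case using Floor by (simp only: period_tm.simps)
qed auto

lemma period_dvd: "period v N \<phi> \<Longrightarrow> N dvd N' \<Longrightarrow> period v N' \<phi>"
  by (induction \<phi>) (auto intro: period_tm_dvd)

lemma ex_period_tm: "\<exists>N>0. period_tm v N t"
proof (induction t)
  case (Add s t)
  then obtain N N' where "N > 0" "N' > 0" "period_tm v N s" "period_tm v N' t" by blast
  then have "N * N' > 0 \<and> period_tm v (N * N') (Add s t)" by (auto intro: period_tm_dvd)
  then show ?case by blast
next
  case (Floor t)
  then obtain N where N: "N > 0" "period_tm v N t" by blast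
  obtain a b where ab: "quotient_of (slope v t) = (a, b)" by force
  have b: "b > 0" using quotient_of_denom_pos[OF ab] .
  have "of_nat (nat b) * slope v t = of_int a"
    using quotient_of_div[OF ab] b by simp
  then have "of_nat (N * nat b) * slope v t = of_int (int N * a)" by (simp add: mult.assoc)
  then have "of_nat (N * nat b) * slope v t \<in> \<int>" by (metis Ints_of_int)
  then have "N * nat b > 0 \<and> period_tm v (N * nat b) (Floor t)"
    using N b by (auto intro: period_tm_dvd)
  then show ?case by blast
qed auto

lemma ex_period: "qf \<phi> \<Longrightarrow> \<exists>N>0. period v N \<phi>"
proof (induction \<phi>)
  case (Eq s t)
  show ?case using ex_period_tm[of v "Add s t"] by auto
next
  case (Less s t)
  show ?case using ex_period_tm[of v "Add s t"] by auto
next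
  case (Holds p t)
  show ?case using ex_period_tm[of v t] by auto
next
  case (Conj \<phi> \<psi>)
  then obtain N N' where "N > 0" "N' > 0" "period v N \<phi>" "period v N' \<psi>" by auto
  then have "N * N' > 0 \<and> period v (N * N') (Conj \<phi> \<psi>)" by (auto intro: period_dvd)
  then show ?case by blast
qed auto

section \<open>Quantifier elimination for \<open>T\<close>\<close>

text \<open>
  Boolean combinations are introduced as a property of formulas, and not just by their truth values,
  because the same combination has to be evaluated in structures over different types.
\<close>

inductive bool_comb :: "'p fm set \<Rightarrow> 'p fm \<Rightarrow> bool" for \<Delta> where
  atom: "\<delta> \<in> \<Delta> \<Longrightarrow> bool_comb \<Delta> \<delta>"
| neg: "bool_comb \<Delta> \<phi> \<Longrightarrow> bool_comb \<Delta> (Neg \<phi>)"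
| conj: "bool_comb \<Delta> \<phi> \<Longrightarrow> bool_comb \<Delta> \<psi> \<Longrightarrow> bool_comb \<Delta> (Conj \<phi> \<psi>)"
| true: "bool_comb \<Delta> (Eq Zero Zero)"

lemma bool_comb_agree:
  "bool_comb \<Delta> \<psi> \<Longrightarrow> agree \<Delta> M e M' e' \<Longrightarrow> sat M e \<psi> \<longleftrightarrow> sat M' e' \<psi>"
  by (induction rule: bool_comb.induct) (auto simp: agree_def)

lemma bool_comb_qf: "bool_comb \<Delta> \<psi> \<Longrightarrow> (\<And>\<delta>. \<delta> \<in> \<Delta> \<Longrightarrow> qf \<delta>) \<Longrightarrow> qf \<psi>"
  by (induction rule: bool_comb.induct) auto

lemma bool_comb_Conjs: "(\<And>\<phi>. \<phi> \<in> set \<phi>s \<Longrightarrow> bool_comb \<Delta> \<phi>) \<Longrightarrow> bool_comb \<Delta> (Conjs \<phi>s)"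
  by (induction \<phi>s) (auto simp: Conjs_def intro: bool_comb.intros)

lemma bool_comb_Disjs: "(\<And>\<phi>. \<phi> \<in> set \<phi>s \<Longrightarrow> bool_comb \<Delta> \<phi>) \<Longrightarrow> bool_comb \<Delta> (Disjs \<phi>s)"
  unfolding Disjs_def by (intro bool_comb.neg bool_comb_Conjs) (auto intro: bool_comb.neg)

text \<open>
  A property that depends only on the truth values of finitely many formulas is the disjunction of the
  truth patterns at which it holds.
\<close>

lemma ex_bool_comb:
  fixes C :: "('p, 'a) struct \<Rightarrow> (nat \<Rightarrow> 'a) \<Rightarrow> bool" and \<Delta> :: "'p fm set"
  assumes fin: "finite \<Delta>"
    and det: "\<And>M e M' e'. C M e \<Longrightarrow> C M' e' \<Longrightarrow> agree \<Delta> M e M' e' \<Longrightarrow> f M e \<Longrightarrow> f M' e'"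
  shows "\<exists>\<psi>. bool_comb \<Delta> \<psi> \<and> (\<forall>M e. C M e \<longrightarrow> (f M e \<longleftrightarrow> sat M e \<psi>))"
proof -
  obtain ds where ds: "set ds = \<Delta>" using finite_list[OF fin] by blast
  define T where "T M e = {\<delta> \<in> \<Delta>. sat M e \<delta>}"
    for M :: "('p, 'a) struct" and e
  define cell where "cell \<tau> = Conjs (map (\<lambda>\<delta>. if \<delta> \<in> \<tau> then \<delta> else Neg \<delta>) ds)" for \<tau>
  have "finite {\<tau> \<in> Pow \<Delta>. \<exists>M e. C M e \<and> f M e \<and> \<tau> = T M e}" using fin by simp
  then obtain ts where ts: "set ts = {\<tau> \<in> Pow \<Delta>. \<exists>M e. C M e \<and> f M e \<and> \<tau> = T M e}"
    by (rule finite_list[THEN exE])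
  have cell: "sat M e (cell \<tau>) \<longleftrightarrow> T M e = \<tau>" if "\<tau> \<subseteq> \<Delta>" for M e \<tau>
  proof -
    have "sat M e (cell \<tau>) \<longleftrightarrow> (\<forall>\<delta>\<in>\<Delta>. \<delta> \<in> \<tau> \<longleftrightarrow> sat M e \<delta>)"
      unfolding cell_def sat_Conjs set_map ds ball_simps(9) by (rule ball_cong) (auto split: if_splits)
    then show ?thesis using that by (auto simp: T_def)
  qed
  let ?\<psi> = "Disjs (map cell ts)"
  have "bool_comb \<Delta> ?\<psi>"
  proof (rule bool_comb_Disjs)
    fix \<phi> assume "\<phi> \<in> set (map cell ts)"
    then obtain \<tau> where "\<phi> = cell \<tau>" by auto
    moreover have "bool_comb \<Delta> \<psi>" if mem: "\<psi> \<in> set (map (\<lambda>\<delta>. if \<delta> \<in> \<tau> then \<delta> else Neg \<delta>) ds)" for \<psi>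
    proof -
      obtain \<delta> where "\<delta> \<in> \<Delta>" "\<psi> = (if \<delta> \<in> \<tau> then \<delta> else Neg \<delta>)"
        using mem unfolding set_map ds by blast
      then show ?thesis by (cases "\<delta> \<in> \<tau>") (simp_all add: bool_comb.atom bool_comb.neg)
    qed
    ultimately show "bool_comb \<Delta> \<phi>" by (simp only: cell_def bool_comb_Conjs)
  qed
  moreover have "f M e \<longleftrightarrow> sat M e ?\<psi>" if C: "C M e" for M e
  proof
    assume "f M e"
    then have "T M e \<in> set ts" using C unfolding ts by (auto simp: T_def)
    moreover have "sat M e (cell (T M e))" by (subst cell) (auto simp: T_def)
    ultimately show "sat M e ?\<psi>" by auto
  next
    assume "sat M e ?\<psi>"
    then obtain \<tau> where \<tau>: "\<tau> \<in> set ts" "sat M e (cell \<tau>)" by auto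
    then obtain M' e' where "C M' e'" "f M' e'" "\<tau> = T M' e'" "\<tau> \<subseteq> \<Delta>" unfolding ts by auto
    moreover from this have "T M e = T M' e'" using \<tau>(2) cell by blast
    then have "agree \<Delta> M' e' M e" by (auto simp: agree_def T_def)
    ultimately show "f M e" using det C by blast
  qed
  ultimately show ?thesis by blast
qed

primrec prescribe_P :: "(tm \<Rightarrow> bool) \<Rightarrow> LP_pred fm \<Rightarrow> L_pred fm" where
  "prescribe_P \<sigma> (Eq s t) = Eq s t"
| "prescribe_P \<sigma> (Less s t) = Less s t"
| "prescribe_P \<sigma> (Holds p t) = (case p of S_LP \<Rightarrow> Holds S_L t
     | P_LP \<Rightarrow> if \<sigma> t then Eq Zero Zero else Neg (Eq Zero Zero))"
| "prescribe_P \<sigma> (Neg \<phi>) = Neg (prescribe_P \<sigma> \<phi>)"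
| "prescribe_P \<sigma> (Conj \<phi> \<psi>) = Conj (prescribe_P \<sigma> \<phi>) (prescribe_P \<sigma> \<psi>)"
| "prescribe_P \<sigma> (Ex n \<phi>) = Ex n (prescribe_P \<sigma> \<phi>)"

primrec P_tms :: "LP_pred fm \<Rightarrow> tm set" where
  "P_tms (Eq s t) = {}"
| "P_tms (Less s t) = {}"
| "P_tms (Holds p t) = {t}"
| "P_tms (Neg \<phi>) = P_tms \<phi>"
| "P_tms (Conj \<phi> \<psi>) = P_tms \<phi> \<union> P_tms \<psi>"
| "P_tms (Ex n \<phi>) = P_tms \<phi>"

lemma finite_P_tms: "finite (P_tms \<phi>)"
  by (induction \<phi>) auto

lemma sat_prescribe_P:
  "qf \<psi> \<Longrightarrow> (\<And>t. t \<in> P_tms \<psi> \<Longrightarrow> \<sigma> t \<longleftrightarrow> eval_tm M e t \<in> P) \<Longrightarrow>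
   sat M e (prescribe_P \<sigma> \<psi>) \<longleftrightarrow> sat (expand M P) e \<psi>"
  by (induction \<psi>) (auto split: LP_pred.splits)

text \<open>
  A counterexample in the model prescribes truth values for the finitely many terms of which
  membership in \<open>P\<close> is asked. That these values are attained (by terms in \<open>(0,1)\<close> where \<open>P\<close> is required, and
  by distinct elements where the values differ) is a property of the structure without \<open>P\<close>, so it is
  satisfied by some real numbers as well, and there they define a suitable predicate.
\<close>

theorem transfer_P:
  assumes M: "is_model M theory_T" and P: "P \<subseteq> predI M S_L" and qf: "qf \<psi>"
    and valid: "\<And>P' e'. P' \<subseteq> {0<..<1} \<Longrightarrow> sat (Rp P') e' \<psi>" and e: "range e \<subseteq> univ M"
  shows "sat (expand M P) e \<psi>"
proof (rule ccontr)
  assume neg: "\<not> sat (expand M P) e \<psi>"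
  define \<sigma> where "\<sigma> t \<longleftrightarrow> eval_tm M e t \<in> P" for t
  obtain ts where ts: "set ts = P_tms \<psi>" using finite_list[OF finite_P_tms] by blast
  let ?\<chi> = "Conj (Neg (prescribe_P \<sigma> \<psi>)) (Conj
      (Conjs [Neg (Eq s t). s \<leftarrow> ts, t \<leftarrow> ts, \<sigma> s \<noteq> \<sigma> t])
      (Conjs [Holds S_L t. t \<leftarrow> ts, \<sigma> t]))"
  have "sat M e ?\<chi>"
    using neg sat_prescribe_P[OF qf, of \<sigma> M e P] P by (auto simp: \<sigma>_def)
  then have "\<not> (\<forall>e. sat real_struct e (Neg ?\<chi>))"
    using transfer[OF M _ e, of "Neg ?\<chi>"] unfolding sat.simps(4) by blast
  then obtain e' where e': "sat real_struct e' ?\<chi>" unfolding sat.simps(4) by blast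
  let ?P' = "{ev e' t |t. t \<in> set ts \<and> \<sigma> t}"
  have "\<sigma> t \<longleftrightarrow> ev e' t \<in> ?P'" if "t \<in> P_tms \<psi>" for t
    using that e' ts by (auto; metis)
  then have "\<not> sat (Rp ?P') e' \<psi>"
    using e' sat_prescribe_P[OF qf, of \<sigma> real_struct e' ?P'] by auto
  moreover have "?P' \<subseteq> {0<..<1}" using e' by auto
  ultimately show False using valid by blast
qed

lemma agree_basics:
  "agree (basics q s W U B Y) (expand M P) e (expand M' P') e' \<longleftrightarrow>
    (\<forall>w\<in>W. lessI M (floorI M (eval_tm M e w)) (eval_tm M e q) \<longleftrightarrow>
          lessI M' (floorI M' (eval_tm M' e' w)) (eval_tm M' e' q)) \<and>
    (\<forall>u\<in>U. (lessI M (eval_tm M e s) (eval_tm M e u) \<longleftrightarrow> lessI M' (eval_tm M' e' s) (eval_tm M' e' u)) \<and>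
         (eval_tm M e s = eval_tm M e u \<longleftrightarrow> eval_tm M' e' s = eval_tm M' e' u)) \<and>
    (\<forall>(\<beta>, u)\<in>B. addI M (scaleI M \<beta> (eval_tm M e s)) (eval_tm M e u) \<in> P \<longleftrightarrow>
         addI M' (scaleI M' \<beta> (eval_tm M' e' s)) (eval_tm M' e' u) \<in> P') \<and>
    (\<forall>y\<in>Y. sat (expand M P) e y \<longleftrightarrow> sat (expand M' P') e' y)"
  unfolding agree_def basics_def ball_Un ball_simps(9) by (simp add: split_beta) blast

text \<open>
  An implication suffices because the relation \<open>agree\<close> is symmetric.
\<close>

definition determines where
  "determines \<Delta> M P \<phi> \<longleftrightarrow> (\<forall>e e'. range e \<subseteq> univ M \<longrightarrow> range e' \<subseteq> univ M \<longrightarrow>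
     agree \<Delta> (expand M P) e (expand M P) e' \<longrightarrow> sat (expand M P) e \<phi> \<longrightarrow> sat (expand M P) e' \<phi>)"

lemma finite_basics: "admissible v W U B Y \<Longrightarrow> finite (basics q s W U B Y)"
  by (auto simp: admissible_def basics_def)

lemma qf_basics: "admissible v W U B Y \<Longrightarrow> \<delta> \<in> basics q s W U B Y \<Longrightarrow> qf \<delta>"
  by (auto simp: admissible_def basics_def)

text \<open>
  The normal form in models of \<open>T\<close> with a predicate: over the reals the formula is equivalent to a
  Boolean combination of basic conditions, and this equivalence is transferred.
\<close>

theorem ex_basics:
  assumes "N > 0" "qf \<phi>" "period v N \<phi>"
  shows "\<exists>W U B Y. admissible v W U B Y \<and>
    (\<forall>(M :: (L_pred, 'a) struct) P. is_model M theory_T \<longrightarrow> P \<subseteq> predI M S_L \<longrightarrow>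
       determines (basics (qtm v N) (stm v N) W U B Y) M P \<phi>)"
proof -
  obtain W U B Y where adm: "admissible v W U B Y" and
    f: "\<And>P e P' e'. P \<subseteq> {0<..<1} \<Longrightarrow> P' \<subseteq> {0<..<1} \<Longrightarrow>
       agree (basics (qtm v N) (stm v N) W U B Y) (Rp P) e (Rp P') e' \<Longrightarrow> sat (Rp P) e \<phi> = sat (Rp P') e' \<phi>"
    by (rule determinedE[OF determined_qf[OF assms]]) blast
  let ?\<Delta> = "basics (qtm v N) (stm v N) W U B Y"
  let ?C = "\<lambda>M (e :: nat \<Rightarrow> real). \<exists>P \<subseteq> {0<..<1}. M = Rp P"
  obtain \<psi> where \<psi>: "bool_comb ?\<Delta> \<psi>" "\<And>M e. ?C M e \<Longrightarrow> sat M e \<phi> \<longleftrightarrow> sat M e \<psi>"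
    using ex_bool_comb[OF finite_basics[OF adm], where C = ?C and f = "\<lambda>M e. sat M e \<phi>"] f by blast
  have "determines ?\<Delta> M P \<phi>" if M: "is_model M theory_T" and P: "P \<subseteq> predI M S_L"
    for M :: "(L_pred, 'a) struct" and P
  proof -
    have "qf (Iff \<phi> \<psi>)" using assms(2) bool_comb_qf[OF \<psi>(1) qf_basics[OF adm]] by auto
    then have "sat (expand M P) e (Iff \<phi> \<psi>)" if "range e \<subseteq> univ M" for e
      by (rule transfer_P[OF M P _ _ that]) (use \<psi>(2) in auto)
    then have "sat (expand M P) e \<phi> \<longleftrightarrow> sat (expand M P) e \<psi>" if "range e \<subseteq> univ M" for e
      using that by simp
    then show ?thesis
      unfolding determines_def by (metis bool_comb_agree[OF \<psi>(1)])
  qed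
  then show ?thesis using adm by blast
qed

text \<open>
  If some element of \<open>A\<close> is below \<open>q\<close>, the successor of the largest such element serves; otherwise the
  least element of \<open>A\<close> does.
\<close>

lemma int_test_point:
  fixes A :: "int set"
  assumes "finite A"
  shows "\<exists>q'\<in>{0} \<union> A \<union> (\<lambda>a. a + 1) ` A. \<forall>a\<in>A. q \<le> a \<longleftrightarrow> q' \<le> a"
proof (cases "{a \<in> A. a < q} = {}")
  case True
  then have all: "\<forall>a\<in>A. q \<le> a" by auto
  show ?thesis
  proof (cases "A = {}")
    case False
    then have "Min A \<in> A" "\<forall>a\<in>A. Min A \<le> a" using assms by auto
    then show ?thesis using all by blast
  qed auto
next
  case False
  let ?m = "Max {a \<in> A. a < q}"
  have m: "?m \<in> {a \<in> A. a < q}" by (rule Max_in) (use False assms in auto)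
  have "q \<le> a \<longleftrightarrow> ?m + 1 \<le> a" if "a \<in> A" for a
  proof -
    have "a \<le> ?m" if "a < q" using that \<open>a \<in> A\<close> assms by (intro Max_ge) auto
    then show ?thesis using m by force
  qed
  then show ?thesis using m by blast
qed

text \<open>
  Terms whose values realise every possible position of an integer relative to the \<open>\<lfloor>w\<rfloor>\<close>.
\<close>

definition q_tests :: "tm set \<Rightarrow> tm set" where
  "q_tests W = {Zero} \<union> Floor ` W \<union> (\<lambda>w. Add (Floor w) One) ` W"

lemma ex_q_test:
  assumes "finite W"
  shows "\<exists>q\<in>q_tests W. \<exists>k. ev e q = of_int k \<and> (\<forall>w\<in>W. z \<le> \<lfloor>ev e w\<rfloor> \<longleftrightarrow> k \<le> \<lfloor>ev e w\<rfloor>)"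
proof -
  let ?A = "(\<lambda>w. \<lfloor>ev e w\<rfloor>) ` W"
  obtain k where k: "k \<in> {0} \<union> ?A \<union> (\<lambda>a. a + 1) ` ?A" "\<forall>a\<in>?A. z \<le> a \<longleftrightarrow> k \<le> a"
    using int_test_point[of ?A z] assms by blast
  have "\<exists>q\<in>q_tests W. ev e q = of_int k"
    using k(1)
  proof (elim UnE)
    assume "k \<in> {0}" then show ?thesis by (intro bexI[of _ Zero]) (auto simp: q_tests_def)
  next
    assume "k \<in> ?A" then obtain w where "w \<in> W" "k = \<lfloor>ev e w\<rfloor>" by blast
    then show ?thesis by (intro bexI[of _ "Floor w"]) (auto simp: q_tests_def)
  next
    assume "k \<in> (\<lambda>a. a + 1) ` ?A" then obtain w where "w \<in> W" "k = \<lfloor>ev e w\<rfloor> + 1" by blast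
    then show ?thesis by (intro bexI[of _ "Add (Floor w) One"]) (auto simp: q_tests_def)
  qed
  then show ?thesis using k(2) by blast
qed

text \<open>
  A number outside \<open>A\<close> has the same position as the midpoint of its two neighbours in \<open>A\<close>.
\<close>

lemma real_test_point:
  fixes A :: "real set"
  assumes fin: "finite A" and a: "a0 \<in> A" "a0 \<le> s" and b: "b0 \<in> A" "s < b0"
  shows "\<exists>s'\<in>A \<union> {(a + b) / 2 |a b. a \<in> A \<and> b \<in> A}. \<forall>a\<in>A. (s < a \<longleftrightarrow> s' < a) \<and> (s = a \<longleftrightarrow> s' = a)"
proof (cases "s \<in> A")
  case True
  then show ?thesis by blast
next
  case False
  let ?L = "{a \<in> A. a < s}" and ?R = "{a \<in> A. s < a}"
  have L: "?L \<noteq> {}" "finite ?L" and R: "?R \<noteq> {}" "finite ?R"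
    using a b fin False by (auto simp: le_less)
  have m: "Max ?L \<in> ?L" "Min ?R \<in> ?R" using L R Max_in Min_in by blast+
  have le: "a \<le> Max ?L" if "a \<in> A" "a < s" for a using that L by (intro Max_ge) auto
  have ge: "Min ?R \<le> a" if "a \<in> A" "a > s" for a using that R by (intro Min_le) auto
  have "(s < a \<longleftrightarrow> (Max ?L + Min ?R) / 2 < a) \<and> (s = a \<longleftrightarrow> (Max ?L + Min ?R) / 2 = a)" if "a \<in> A" for a
  proof (cases "a < s")
    case True
    then have "a \<le> Max ?L" "Max ?L < s" "s < Min ?R" using le that m by auto
    then show ?thesis using True by auto
  next
    case f: False
    then have "s < a" using False that by (cases "s = a") auto
    then have "Min ?R \<le> a" "Max ?L < s" "s < Min ?R" using ge that m by auto
    then show ?thesis using \<open>s < a\<close> by auto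
  qed
  then show ?thesis using m by blast
qed

lemma qv_sv_upd:
  assumes "N > 0" "e' v = N * of_int k + s" "0 \<le> s" "s < N"
  shows "qv v N e' = of_int k" "sv v N e' = s"
proof -
  have "\<lfloor>e' v / N\<rfloor> = k"
    by (rule floor_unique) (use assms in \<open>auto simp: field_simps\<close>)
  then show "qv v N e' = of_int k" by (simp add: qv_int)
  then show "sv v N e' = s" by (simp add: sv_eq assms(2))
qed

text \<open>
  Definable Skolem functions with finitely many candidates. The predicate is taken to be empty, so that
  only the positions of \<open>q\<close> and \<open>s\<close> matter, and these are realised by test points. Adding \<open>0\<close> and \<open>N\<close> to
  the parameters of \<open>s\<close> keeps the test point in \<open>[0,N)\<close>.
\<close>

lemma ex_test_terms:
  fixes \<psi> :: "L_pred fm"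
  assumes "qf \<psi>"
  shows "\<exists>ts. \<forall>e. sat real_struct e \<psi> \<longrightarrow> (\<exists>t\<in>set ts. v \<notin> fv_tm t \<and> sat real_struct (e(v := ev e t)) \<psi>)"
proof -
  obtain N where N: "N > 0" "period v N (liftP \<psi>)" using ex_period[of "liftP \<psi>" v] assms by auto
  obtain W U B Y where adm: "admissible v W U B Y" and
    f: "\<And>P e P' e'. P \<subseteq> {0<..<1} \<Longrightarrow> P' \<subseteq> {0<..<1} \<Longrightarrow>
       agree (basics (qtm v N) (stm v N) W U B Y) (Rp P) e (Rp P') e' \<Longrightarrow>
       sat (Rp P) e (liftP \<psi>) = sat (Rp P') e' (liftP \<psi>)"
    by (rule determinedE[OF determined_qf[OF N(1) _ N(2)]]) (use assms in auto)
  define Q where "Q = q_tests W"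
  define U' where "U' = {Zero, Scale (of_nat N) One} \<union> U"
  define S where "S = U' \<union> (\<lambda>(u, u'). Scale (1/2) (Add u u')) ` (U' \<times> U')"
  have fin: "finite W" "finite U'" "finite U" using adm by (auto simp: admissible_def U'_def)
  then have "finite ((\<lambda>(q, s). Add (Scale (of_nat N) q) s) ` (Q \<times> S))"
    by (simp add: Q_def q_tests_def S_def)
  then obtain ts where ts: "set ts = (\<lambda>(q, s). Add (Scale (of_nat N) q) s) ` (Q \<times> S)"
    by (rule finite_list[THEN exE])
  have fvU: "v \<notin> fv_tm u" if "u \<in> U'" for u using that adm by (auto simp: admissible_def U'_def)
  have fvS: "v \<notin> fv_tm u" if "u \<in> S" for u using that fvU by (auto simp: S_def)
  have fvW: "v \<notin> fv_tm w" if "w \<in> W" for w using that adm by (auto simp: admissible_def)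
  have fvQ: "v \<notin> fv_tm w" if "w \<in> Q" for w using that fvW by (auto simp: Q_def q_tests_def)
  have "\<exists>t\<in>set ts. v \<notin> fv_tm t \<and> sat real_struct (e(v := ev e t)) \<psi>" if sat: "sat real_struct e \<psi>" for e
  proof -
    obtain q k where q: "q \<in> Q" "ev e q = of_int k"
      and k: "\<forall>w\<in>W. \<lfloor>e v / N\<rfloor> \<le> \<lfloor>ev e w\<rfloor> \<longleftrightarrow> k \<le> \<lfloor>ev e w\<rfloor>"
      using ex_q_test[OF fin(1), of e "\<lfloor>e v / N\<rfloor>"] unfolding Q_def by blast
    let ?B = "ev e ` U'"
    have "ev e Zero \<in> ?B" "ev e (Scale (of_nat N) One) \<in> ?B"
      by (rule imageI, simp add: U'_def)+
    then have B: "(0::real) \<in> ?B" "real N \<in> ?B" by simp_all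
    obtain s' where s': "s' \<in> ?B \<union> {(a + b) / 2 |a b. a \<in> ?B \<and> b \<in> ?B}"
      "\<forall>a\<in>?B. (sv v N e < a \<longleftrightarrow> s' < a) \<and> (sv v N e = a \<longleftrightarrow> s' = a)"
      using real_test_point[OF _ B(1) _ B(2), of "sv v N e"] fin sv_bounds[OF N(1), where e = e and v = v]
      by (metis (no_types, lifting) finite_imageI)
    have "\<exists>s\<in>S. ev e s = s'"
      using s'(1)
    proof
      assume "s' \<in> ?B" then show ?thesis by (auto simp: S_def)
    next
      assume "s' \<in> {(a + b) / 2 |a b. a \<in> ?B \<and> b \<in> ?B}"
      then obtain u u' where "u \<in> U'" "u' \<in> U'" "s' = (ev e u + ev e u') / 2" by auto
      then have "Scale (1/2) (Add u u') \<in> S" "ev e (Scale (1/2) (Add u u')) = s'"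
        by (auto simp: S_def of_rat_divide)
      then show ?thesis by blast
    qed
    then obtain s where s: "s \<in> S" "ev e s = s'" by blast
    have "\<not> sv v N e < 0 \<longleftrightarrow> \<not> s' < 0" "sv v N e < N \<longleftrightarrow> s' < N"
      using s'(2)[rule_format, OF B(1)] s'(2)[rule_format, OF B(2)] by auto
    then have sb: "0 \<le> s'" "s' < N" using sv_bounds[OF N(1), where e = e and v = v] by auto
    let ?t = "Add (Scale (of_nat N) q) s"
    let ?e = "e(v := ev e ?t)"
    have qs: "qv v N ?e = of_int k" "sv v N ?e = s'"
      by (rule qv_sv_upd[OF N(1) _ sb, where k = k]; simp add: q s)+
    have fresh: "ev ?e u = ev e u" if "u \<in> U \<or> u \<in> W" for u
      using that fvU fvW by (auto simp: U'_def)
    have "sat (Rp {}) ?e y = sat (Rp {}) e y" if "y \<in> Y" for y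
      using that adm by (intro sat_upd) (auto simp: admissible_def)
    moreover have "qv v N e \<le> of_int \<lfloor>ev e w\<rfloor> \<longleftrightarrow> qv v N ?e \<le> of_int \<lfloor>ev ?e w\<rfloor>" if "w \<in> W" for w
      unfolding qs qv_int[of e] of_int_le_iff using k that fresh[of w] by auto
    moreover have "(sv v N e < ev e u \<longleftrightarrow> sv v N ?e < ev ?e u) \<and> (sv v N e = ev e u \<longleftrightarrow> sv v N ?e = ev ?e u)"
      if "u \<in> U" for u
      unfolding qs using s'(2) that fresh[of u] by (auto simp: U'_def)
    ultimately have "agree (basics (qtm v N) (stm v N) W U B Y) (Rp {}) e (Rp {}) ?e"
      unfolding agree_basics by (auto simp: not_le[symmetric])
    then have "sat (Rp {}) ?e (liftP \<psi>)" using f[of "{}" "{}" e ?e] sat by (simp add: sat_lift)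
    moreover have "?t \<in> set ts" "v \<notin> fv_tm ?t" using q s fvQ fvS by (auto simp: ts)
    ultimately show ?thesis unfolding sat_lift by blast
  qed
  then show ?thesis by blast
qed

definition test_terms :: "nat \<Rightarrow> L_pred fm \<Rightarrow> tm list" where
  "test_terms v \<psi> = (SOME ts. \<forall>e. sat real_struct e \<psi> \<longrightarrow>
     (\<exists>t\<in>set ts. v \<notin> fv_tm t \<and> sat real_struct (e(v := ev e t)) \<psi>))"

lemma test_terms:
  assumes "qf \<psi>" "sat real_struct e \<psi>"
  shows "\<exists>t\<in>set (test_terms v \<psi>). v \<notin> fv_tm t \<and> sat real_struct (e(v := ev e t)) \<psi>"
  using someI_ex[OF ex_test_terms[OF assms(1), of v]] assms(2) unfolding test_terms_def by blast

text \<open>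
  Given as a function, so that the same formula serves structures over all types.
\<close>

primrec qelim :: "L_pred fm \<Rightarrow> L_pred fm" where
  "qelim (Eq s t) = Eq s t"
| "qelim (Less s t) = Less s t"
| "qelim (Holds p t) = Holds p t"
| "qelim (Neg \<phi>) = Neg (qelim \<phi>)"
| "qelim (Conj \<phi> \<psi>) = Conj (qelim \<phi>) (qelim \<psi>)"
| "qelim (Ex v \<phi>) = Disjs (map (\<lambda>t. fsub (Var(v := t)) (qelim \<phi>)) (test_terms v (qelim \<phi>)))"

lemma qf_qelim: "qf (qelim \<phi>)"
  by (induction \<phi>) (auto intro: qf_fsub)

text \<open>
  One direction of each step is trivial, the other one is a universal formula that holds in the reals.
\<close>

theorem sat_qelim:
  assumes M: "univ_model M"
  shows "range e \<subseteq> univ M \<Longrightarrow> sat M e (qelim \<phi>) \<longleftrightarrow> sat M e \<phi>"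
proof (induction \<phi> arbitrary: e)
  case (Ex v \<phi>)
  have wf: "wf_struct M" using M by (simp add: univ_model_def)
  let ?\<psi> = "qelim \<phi>"
  have "sat M e (qelim (Ex v \<phi>)) \<longleftrightarrow>
      (\<exists>t\<in>set (test_terms v ?\<psi>). sat M (e(v := eval_tm M e t)) ?\<psi>)"
    by (simp add: sat_fsub_single qf_qelim)
  also have "\<dots> \<longleftrightarrow> (\<exists>a\<in>univ M. sat M (e(v := a)) ?\<psi>)"
  proof
    assume "\<exists>t\<in>set (test_terms v ?\<psi>). sat M (e(v := eval_tm M e t)) ?\<psi>"
    then show "\<exists>a\<in>univ M. sat M (e(v := a)) ?\<psi>" using wf_eval[OF wf Ex.prems] by blast
  next
    assume "\<exists>a\<in>univ M. sat M (e(v := a)) ?\<psi>"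
    then obtain a where a: "a \<in> univ M" "sat M (e(v := a)) ?\<psi>" by blast
    let ?ts = "filter (\<lambda>t. v \<notin> fv_tm t) (test_terms v ?\<psi>)"
    let ?\<chi> = "Imp ?\<psi> (Disjs (map (\<lambda>t. fsub (Var(v := t)) ?\<psi>) ?ts))"
    have "sat real_struct e' ?\<chi>" for e'
      using test_terms[OF qf_qelim[of \<phi>], of e' v] by (auto simp: sat_fsub_single qf_qelim)
    moreover have "qf ?\<chi>" by (auto simp: qf_qelim intro: qf_fsub)
    ultimately have "sat M (e(v := a)) ?\<chi>"
      using M range_upd[OF Ex.prems a(1)] unfolding univ_model_def by blast
    then show "\<exists>t\<in>set (test_terms v ?\<psi>). sat M (e(v := eval_tm M e t)) ?\<psi>"
      using a(2) by (auto simp: sat_fsub_single qf_qelim)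
  qed
  also have "\<dots> \<longleftrightarrow> sat M e (Ex v \<phi>)"
    unfolding sat.simps by (rule bex_cong) (auto simp only: Ex.IH[OF range_upd[OF Ex.prems]])
  finally show ?case .
qed auto

text \<open>
  Eliminating the quantifiers of a sentence of \<open>T\<close> leaves a formula that is valid in the reals.
\<close>

theorem univ_model_is_model: "univ_model M \<Longrightarrow> is_model M theory_T"
  unfolding is_model_def
proof (intro conjI ballI allI impI)
  assume M: "univ_model M"
  then show "wf_struct M" by (simp add: univ_model_def)
  fix \<sigma> and e :: "nat \<Rightarrow> _" assume \<sigma>: "\<sigma> \<in> theory_T" and e: "range e \<subseteq> univ M"
  have "sat real_struct e' (qelim \<sigma>)" for e'
    using \<sigma> sat_qelim[OF univ_model_real, of e' \<sigma>] by (auto simp: theory_T_def)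
  then have "sat M e (qelim \<sigma>)" using M e qf_qelim[of \<sigma>] by (auto simp: univ_model_def)
  then show "sat M e \<sigma>" using sat_qelim[OF M e] by simp
qed

theorem elementary_embeddingI:
  fixes M N :: "(L_pred, 'a) struct"
  assumes M: "univ_model M" and N: "univ_model N" and f: "f ` univ M \<subseteq> univ N"
    and qf: "\<And>\<phi> e. qf \<phi> \<Longrightarrow> range e \<subseteq> univ M \<Longrightarrow> sat N (f \<circ> e) \<phi> \<longleftrightarrow> sat M e \<phi>"
  shows "elementary_embedding M N f"
  unfolding elementary_embedding_def
proof (intro conjI allI impI)
  show "wf_struct N" using N by (simp add: univ_model_def)
  show "f ` univ M \<subseteq> univ N" by fact
  fix \<phi> and e :: "nat \<Rightarrow> 'a" assume e: "range e \<subseteq> univ M"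
  then have e': "range (f \<circ> e) \<subseteq> univ N" using f by auto
  show "sat N (f \<circ> e) \<phi> \<longleftrightarrow> sat M e \<phi>"
    using sat_qelim[OF N e', of \<phi>] sat_qelim[OF M e, of \<phi>] qf[OF qf_qelim[of \<phi>] e] by simp
qed

section \<open>Infinitesimal extensions of models of \<open>T\<close>\<close>

text \<open>
  The isomorphic copy along a map that is injective on the universe, possibly over another type.
\<close>

definition transport :: "('b \<Rightarrow> 'a) \<Rightarrow> ('p, 'b) struct \<Rightarrow> ('p, 'a) struct" where
  "transport \<iota> M = (let \<kappa> = inv_into (univ M) \<iota> in
     \<lparr>univ = \<iota> ` univ M, zeroI = \<iota> (zeroI M), oneI = \<iota> (oneI M),
      addI = (\<lambda>x y. \<iota> (addI M (\<kappa> x) (\<kappa> y))), floorI = (\<lambda>x. \<iota> (floorI M (\<kappa> x))),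
      scaleI = (\<lambda>q x. \<iota> (scaleI M q (\<kappa> x))), lessI = (\<lambda>x y. lessI M (\<kappa> x) (\<kappa> y)),
      predI = (\<lambda>p. \<iota> ` predI M p)\<rparr>)"

locale transported =
  fixes \<iota> :: "'b \<Rightarrow> 'a" and M :: "('p, 'b) struct"
  assumes inj: "inj_on \<iota> (univ M)" and wf: "wf_struct M"
begin

lemma transport_simps [simp]:
  "univ (transport \<iota> M) = \<iota> ` univ M"
  "zeroI (transport \<iota> M) = \<iota> (zeroI M)" "oneI (transport \<iota> M) = \<iota> (oneI M)"
  "x \<in> univ M \<Longrightarrow> y \<in> univ M \<Longrightarrow> addI (transport \<iota> M) (\<iota> x) (\<iota> y) = \<iota> (addI M x y)"
  "x \<in> univ M \<Longrightarrow> floorI (transport \<iota> M) (\<iota> x) = \<iota> (floorI M x)"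
  "x \<in> univ M \<Longrightarrow> scaleI (transport \<iota> M) q (\<iota> x) = \<iota> (scaleI M q x)"
  "x \<in> univ M \<Longrightarrow> y \<in> univ M \<Longrightarrow> lessI (transport \<iota> M) (\<iota> x) (\<iota> y) \<longleftrightarrow> lessI M x y"
  "predI (transport \<iota> M) p = \<iota> ` predI M p"
  by (simp_all add: transport_def Let_def inv_into_f_f[OF inj])

lemma wf_transport: "wf_struct (transport \<iota> M)"
  using wf by (fastforce simp: wf_struct_def)

lemma eval_transport:
  "range e \<subseteq> univ M \<Longrightarrow> eval_tm (transport \<iota> M) (\<iota> \<circ> e) t = \<iota> (eval_tm M e t)"
  by (induction t) (auto simp: wf_eval[OF wf])

lemma sat_transport:
  "range e \<subseteq> univ M \<Longrightarrow> sat (transport \<iota> M) (\<iota> \<circ> e) \<phi> \<longleftrightarrow> sat M e \<phi>"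
proof (induction \<phi> arbitrary: e)
  case (Eq s t)
  then show ?case unfolding sat.simps eval_transport[OF Eq]
    by (intro inj_on_eq_iff[OF inj] wf_eval[OF wf])
next
  case (Less s t)
  then show ?case unfolding sat.simps eval_transport[OF Less]
    by (intro transport_simps wf_eval[OF wf])
next
  case (Holds p t)
  have "predI M p \<subseteq> univ M" using wf by (auto simp: wf_struct_def)
  then show ?case unfolding sat.simps eval_transport[OF Holds] transport_simps
    by (intro inj_on_image_mem_iff[OF inj] wf_eval[OF wf] Holds)
next
  case (Ex n \<phi>)
  have "(\<iota> \<circ> e)(n := \<iota> a) = \<iota> \<circ> e(n := a)" for a by auto
  moreover have "sat (transport \<iota> M) (\<iota> \<circ> e(n := a)) \<phi> \<longleftrightarrow> sat M (e(n := a)) \<phi>" if "a \<in> univ M" for a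
    by (rule Ex.IH) (rule range_upd[OF Ex.prems that])
  ultimately show ?case by (simp del: o_apply)
qed auto

lemma range_transport:
  assumes "range e \<subseteq> univ (transport \<iota> M)"
  obtains e0 where "range e0 \<subseteq> univ M" "e = \<iota> \<circ> e0"
proof
  let ?e0 = "inv_into (univ M) \<iota> \<circ> e"
  have e: "e i \<in> \<iota> ` univ M" for i using assms by auto
  show "range ?e0 \<subseteq> univ M" using inv_into_into[OF e] by auto
  show "e = \<iota> \<circ> ?e0" using f_inv_into_f[OF e] by (simp add: fun_eq_iff)
qed

end

lemma univ_model_transport:
  fixes M :: "(L_pred, 'b) struct"
  assumes "inj_on \<iota> (univ M)" "univ_model M"
  shows "univ_model (transport \<iota> M)"
proof -
  interpret transported \<iota> M using assms by unfold_locales (auto simp: univ_model_def)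
  show ?thesis
    unfolding univ_model_def
  proof (intro conjI allI impI wf_transport)
    fix \<psi> and e :: "nat \<Rightarrow> 'a"
    assume \<psi>: "qf \<psi>" "\<forall>e. sat real_struct e \<psi>" and e: "range e \<subseteq> univ (transport \<iota> M)"
    obtain e0 where e0: "range e0 \<subseteq> univ M" "e = \<iota> \<circ> e0" by (rule range_transport[OF e])
    have "sat M e0 \<psi>" using assms(2) \<psi> e0(1) unfolding univ_model_def by blast
    then show "sat (transport \<iota> M) e \<psi>" unfolding e0(2) sat_transport[OF e0(1)] .
  qed
qed

locale tmodel =
  fixes M :: "(L_pred, 'a) struct"
  assumes model: "is_model M theory_T"
begin

abbreviation add (infixl "\<oplus>" 65) where "x \<oplus> y \<equiv> addI M x y"
abbreviation scale (infixr "\<odot>" 70) where "q \<odot> x \<equiv> scaleI M q x"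
abbreviation less (infix "\<sqsubset>" 50) where "x \<sqsubset> y \<equiv> lessI M x y"
abbreviation "U \<equiv> univ M"
abbreviation "fl \<equiv> floorI M"
abbreviation "zero \<equiv> zeroI M"
abbreviation "one \<equiv> oneI M"

lemma wf: "wf_struct M"
  using model by (simp add: is_model_def)

lemma closed [simp, intro]:
  "zero \<in> U" "one \<in> U" "x \<in> U \<Longrightarrow> y \<in> U \<Longrightarrow> x \<oplus> y \<in> U" "x \<in> U \<Longrightarrow> fl x \<in> U"
  "x \<in> U \<Longrightarrow> q \<odot> x \<in> U"
  using wf by (auto simp: wf_struct_def)

text \<open>
  The form in which facts are transferred: the elements named in the list are the values of the
  variables \<open>0, 1, \<dots>\<close>.
\<close>

lemma tr:
  assumes "\<And>e. sat real_struct e \<phi>" "set xs \<subseteq> U"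
  shows "sat M (pad zero xs) \<phi>"
  using transfer[OF model assms(1) range_pad[OF assms(2) closed(1)]] .

lemma less_trans: "\<lbrakk>x \<sqsubset> y; y \<sqsubset> z; x \<in> U; y \<in> U; z \<in> U\<rbrakk> \<Longrightarrow> x \<sqsubset> z"
  using tr[of "Imp (Less (Var 0) (Var 1)) (Imp (Less (Var 1) (Var 2)) (Less (Var 0) (Var 2)))" "[x, y, z]"]
  by simp

lemma less_irrefl: "x \<in> U \<Longrightarrow> \<not> x \<sqsubset> x"
  using tr[of "Neg (Less (Var 0) (Var 0))" "[x]"] by simp

lemma less_total: "\<lbrakk>x \<in> U; y \<in> U\<rbrakk> \<Longrightarrow> x \<sqsubset> y \<or> x = y \<or> y \<sqsubset> x"
  using tr[of "Or (Less (Var 0) (Var 1)) (Or (Eq (Var 0) (Var 1)) (Less (Var 1) (Var 0)))" "[x, y]"]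
  by (simp add: less_linear)

lemma less_asym: "\<lbrakk>x \<sqsubset> y; x \<in> U; y \<in> U\<rbrakk> \<Longrightarrow> \<not> y \<sqsubset> x"
  using less_trans less_irrefl by blast

lemma pred_S: "x \<in> predI M S_L \<longleftrightarrow> x \<in> U \<and> zero \<sqsubset> x \<and> x \<sqsubset> one"
proof -
  have "predI M S_L \<subseteq> U" using wf by (auto simp: wf_struct_def)
  moreover have "x \<in> U \<Longrightarrow> x \<in> predI M S_L \<longleftrightarrow> zero \<sqsubset> x \<and> x \<sqsubset> one"
    using tr[of "Iff (Holds S_L (Var 0)) (Conj (Less Zero (Var 0)) (Less (Var 0) One))" "[x]"] by simp
  ultimately show ?thesis by blast
qed

lemma zero_prec_one: "zero \<sqsubset> one"
  using tr[of "Less Zero One" "[]"] by simp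

definition "mid a b = (1/2) \<odot> (a \<oplus> b)"

lemma mid_U [simp]: "\<lbrakk>a \<in> U; b \<in> U\<rbrakk> \<Longrightarrow> mid a b \<in> U"
  by (simp add: mid_def)

lemma mid: "\<lbrakk>a \<sqsubset> b; a \<in> U; b \<in> U\<rbrakk> \<Longrightarrow> a \<sqsubset> mid a b \<and> mid a b \<sqsubset> b"
  using tr[of "Imp (Less (Var 0) (Var 1)) (Conj (Less (Var 0) (Scale (1/2) (Add (Var 0) (Var 1))))
     (Less (Scale (1/2) (Add (Var 0) (Var 1))) (Var 1)))" "[a, b]"]
  by (simp add: mid_def of_rat_divide)

definition eventually_small :: "('a \<Rightarrow> bool) \<Rightarrow> bool" where
  "eventually_small Q \<longleftrightarrow> (\<exists>d0\<in>U. zero \<sqsubset> d0 \<and> (\<forall>d\<in>U. zero \<sqsubset> d \<longrightarrow> d \<sqsubset> d0 \<longrightarrow> Q d))"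

lemma eventually_small_mono: "eventually_small Q \<Longrightarrow> (\<And>d. d \<in> U \<Longrightarrow> zero \<sqsubset> d \<Longrightarrow> Q d \<Longrightarrow> Q' d) \<Longrightarrow> eventually_small Q'"
  unfolding eventually_small_def by blast

lemma eventually_small_all: "(\<And>d. d \<in> U \<Longrightarrow> zero \<sqsubset> d \<Longrightarrow> Q d) \<Longrightarrow> eventually_small Q"
  unfolding eventually_small_def using zero_prec_one by blast

lemma eventually_small_conj: "eventually_small Q \<Longrightarrow> eventually_small Q' \<Longrightarrow> eventually_small (\<lambda>d. Q d \<and> Q' d)"
  unfolding eventually_small_def
proof (elim bexE conjE)
  fix d d' assume d: "d \<in> U" "zero \<sqsubset> d" "\<forall>x\<in>U. zero \<sqsubset> x \<longrightarrow> x \<sqsubset> d \<longrightarrow> Q x"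
    "d' \<in> U" "zero \<sqsubset> d'" "\<forall>x\<in>U. zero \<sqsubset> x \<longrightarrow> x \<sqsubset> d' \<longrightarrow> Q' x"
  show "\<exists>d0\<in>U. zero \<sqsubset> d0 \<and> (\<forall>d\<in>U. zero \<sqsubset> d \<longrightarrow> d \<sqsubset> d0 \<longrightarrow> Q d \<and> Q' d)"
  proof (cases "d \<sqsubset> d'")
    case True
    then show ?thesis using d less_trans[of _ d d'] by (intro bexI[of _ d]) auto
  next
    case False
    then have "d' = d \<or> d' \<sqsubset> d" using less_total d by blast
    then show ?thesis using d less_trans[of _ d' d] by (intro bexI[of _ d']) auto
  qed
qed

lemma eventually_small_ex: "eventually_small Q \<Longrightarrow> \<exists>d\<in>U. zero \<sqsubset> d \<and> Q d"
  unfolding eventually_small_def using mid[of zero] mid_U[of zero] closed(1) by metis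

text \<open>
  A pair \<open>(m, r)\<close> stands for \<open>m + r \<epsilon>\<close> with an infinitesimal \<open>\<epsilon> > 0\<close>, and \<open>germ\<close> replaces \<open>\<epsilon>\<close> by an
  actual element \<open>d\<close>.
\<close>

definition germ :: "'a \<times> rat \<Rightarrow> 'a \<Rightarrow> 'a" where
  "germ x d = fst x \<oplus> snd x \<odot> d"

lemma germ_U [simp]: "fst x \<in> U \<Longrightarrow> d \<in> U \<Longrightarrow> germ x d \<in> U"
  by (simp add: germ_def)

text \<open>
  The extension of the model by an infinitesimal, with the lexicographic order. The integral part of
  \<open>m + r \<epsilon>\<close> is \<open>m - 1\<close> if \<open>m\<close> is an integer and \<open>r < 0\<close>, and that of \<open>m\<close> otherwise.
\<close>

definition lex :: "(L_pred, 'a \<times> rat) struct" where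
  "lex = \<lparr>univ = U \<times> UNIV, zeroI = (zero, 0), oneI = (one, 0),
     addI = (\<lambda>x y. (fst x \<oplus> fst y, snd x + snd y)),
     floorI = (\<lambda>x. if fl (fst x) = fst x \<and> snd x < 0 then (fst x \<oplus> (-1) \<odot> one, 0) else (fl (fst x), 0)),
     scaleI = (\<lambda>q x. (q \<odot> fst x, q * snd x)),
     lessI = (\<lambda>x y. fst x \<sqsubset> fst y \<or> fst x = fst y \<and> snd x < snd y),
     predI = (\<lambda>_. {x \<in> U \<times> UNIV. (zero \<sqsubset> fst x \<or> zero = fst x \<and> 0 < snd x) \<and>
                                (fst x \<sqsubset> one \<or> fst x = one \<and> snd x < 0)})\<rparr>"

lemma lex_simps [simp]:
  "univ lex = U \<times> UNIV" "zeroI lex = (zero, 0)" "oneI lex = (one, 0)"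
  "addI lex x y = (fst x \<oplus> fst y, snd x + snd y)"
  "floorI lex x = (if fl (fst x) = fst x \<and> snd x < 0 then (fst x \<oplus> (-1) \<odot> one, 0) else (fl (fst x), 0))"
  "scaleI lex q x = (q \<odot> fst x, q * snd x)"
  "lessI lex x y \<longleftrightarrow> fst x \<sqsubset> fst y \<or> fst x = fst y \<and> snd x < snd y"
  "x \<in> predI lex p \<longleftrightarrow> x \<in> U \<times> UNIV \<and> lessI lex (zero, 0) x \<and> lessI lex x (one, 0)"
  by (auto simp: lex_def)

lemma wf_lex: "wf_struct lex"
  by (auto simp: wf_struct_def)

lemma germ_add: "\<lbrakk>x \<in> U; y \<in> U; d \<in> U\<rbrakk> \<Longrightarrow> germ (x, r) d \<oplus> germ (y, r') d = germ (x \<oplus> y, r + r') d"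
  using tr[of "Eq (Add (Add (Var 0) (Scale r (Var 2))) (Add (Var 1) (Scale r' (Var 2))))
     (Add (Add (Var 0) (Var 1)) (Scale (r + r') (Var 2)))" "[x, y, d]"]
  by (simp add: germ_def of_rat_add algebra_simps)

lemma germ_scale: "\<lbrakk>x \<in> U; d \<in> U\<rbrakk> \<Longrightarrow> q \<odot> germ (x, r) d = germ (q \<odot> x, q * r) d"
  using tr[of "Eq (Scale q (Add (Var 0) (Scale r (Var 1)))) (Add (Scale q (Var 0)) (Scale (q * r) (Var 1)))" "[x, d]"]
  by (simp add: germ_def of_rat_mult algebra_simps)

lemma germ_add_pair:
  "\<lbrakk>fst x \<in> U; fst y \<in> U; d \<in> U\<rbrakk> \<Longrightarrow> germ x d \<oplus> germ y d = germ (fst x \<oplus> fst y, snd x + snd y) d"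
  by (metis germ_add prod.collapse)

lemma germ_scale_pair:
  "\<lbrakk>fst x \<in> U; d \<in> U\<rbrakk> \<Longrightarrow> q \<odot> germ x d = germ (q \<odot> fst x, q * snd x) d"
  by (metis germ_scale prod.collapse)

lemma germ_0: "\<lbrakk>x \<in> U; d \<in> U\<rbrakk> \<Longrightarrow> germ (x, 0) d = x"
  using tr[of "Eq (Add (Var 0) (Scale 0 (Var 1))) (Var 0)" "[x, d]"] by (simp add: germ_def)

lemma germ_less_snd: "\<lbrakk>x \<in> U; d \<in> U; zero \<sqsubset> d; r < r'\<rbrakk> \<Longrightarrow> germ (x, r) d \<sqsubset> germ (x, r') d"
  using tr[of "Imp (Less Zero (Var 1)) (Less (Add (Var 0) (Scale r (Var 1))) (Add (Var 0) (Scale r' (Var 1))))" "[x, d]"]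
  by (simp add: germ_def of_rat_less)

lemma germ_less_fst:
  assumes "x \<in> U" "y \<in> U" "x \<sqsubset> y"
  shows "eventually_small (\<lambda>d. germ (x, r) d \<sqsubset> germ (y, r') d)"
proof -
  let ?\<phi> = "Imp (Less (Var 0) (Var 1)) (Ex 3 (Conj (Less Zero (Var 3)) (All 2 (Imp (Less Zero (Var 2))
     (Imp (Less (Var 2) (Var 3)) (Less (Add (Var 0) (Scale r (Var 2))) (Add (Var 1) (Scale r' (Var 2)))))))))"
  have "sat real_struct e ?\<phi>" for e
  proof -
    have "\<exists>c>0. \<forall>a>0. a < c \<longrightarrow> x + of_rat r * a < y + of_rat r' * a" if "x < y" for x y :: real
    proof -
      let ?k = "\<bar>of_rat r - of_rat r'\<bar> + 1 :: real"
      have k: "?k > 0" by simp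
      have "x + of_rat r * a < y + of_rat r' * a" if a: "a > 0" "a < (y - x) / ?k" for a
      proof -
        have "(of_rat r - of_rat r') * a \<le> \<bar>of_rat r - of_rat r'\<bar> * a" using a by (intro mult_right_mono) auto
        also have "\<dots> < ?k * a" using a by (intro mult_strict_right_mono) auto
        also have "\<dots> < y - x" using a(2) k by (simp add: pos_less_divide_eq mult.commute)
        finally show ?thesis by (simp add: algebra_simps)
      qed
      then show ?thesis using that k by (intro exI[of _ "(y - x) / ?k"]) auto
    qed
    then show ?thesis by simp
  qed
  from tr[OF this, of "[x, y]"] show ?thesis
    using assms by (simp add: eventually_small_def germ_def)
qed

lemma germ_floor:
  assumes "x \<in> U"
  shows "eventually_small (\<lambda>d. fl (germ (x, r) d) = germ (floorI lex (x, r)) d)"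
proof -
  let ?fin = "\<lambda>\<psi>. Ex 3 (Conj (Less Zero (Var 3)) (All 2 (Imp (Less Zero (Var 2))
     (Imp (Less (Var 2) (Var 3)) \<psi>))))"
  let ?\<phi> = "Imp (Eq (Floor (Var 0)) (Var 0)) (?fin
      (Eq (Floor (Add (Var 0) (Scale r (Var 2)))) (Add (Add (Var 0) (Scale (-1) One)) (Scale 0 (Var 2)))))"
  let ?\<psi> = "?fin (Eq (Floor (Add (Var 0) (Scale r (Var 2)))) (Add (Floor (Var 0)) (Scale 0 (Var 2))))"
  let ?k = "\<bar>of_rat r\<bar> + 1 :: real"
  have k: "?k > 0" by (rule add_nonneg_pos[OF abs_ge_zero zero_less_one])
  have small: "- c < of_rat r * a \<and> of_rat r * a < c" if a: "a > 0" "a < c / ?k" for a c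
  proof -
    have "\<bar>of_rat r * a\<bar> < ?k * a" using a by (simp add: abs_mult)
    also have "\<dots> < c" using a(2) k by (simp add: pos_less_divide_eq mult.commute)
    finally show ?thesis by (simp add: abs_less_iff)
  qed
  have *: "eventually_small (\<lambda>d. fl (germ (x, r) d) = germ (fl x, 0) d)" if "r \<ge> 0"
  proof -
    have "\<exists>c>0. \<forall>a>0. a < c \<longrightarrow> \<lfloor>x + of_rat r * a\<rfloor> = \<lfloor>x\<rfloor>" for x :: real
    proof (intro exI[of _ "(\<lfloor>x\<rfloor> + 1 - x) / ?k"] conjI allI impI)
      show "(\<lfloor>x\<rfloor> + 1 - x) / ?k > 0" using k by (intro divide_pos_pos) linarith+
      fix a assume a: "a > 0" "a < (\<lfloor>x\<rfloor> + 1 - x) / ?k"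
      have "of_rat r * a \<ge> 0" using a that by simp
      then show "\<lfloor>x + of_rat r * a\<rfloor> = \<lfloor>x\<rfloor>" using small[OF a] by (intro floor_unique) linarith+
    qed
    then have "sat real_struct e ?\<psi>" for e by simp
    from tr[OF this, of "[x]"] show ?thesis using assms by (simp add: eventually_small_def germ_def)
  qed
  have **: "eventually_small (\<lambda>d. fl (germ (x, r) d) = germ (fl x, 0) d)" if "fl x \<noteq> x"
  proof -
    have "\<exists>c>0. \<forall>a>0. a < c \<longrightarrow> \<lfloor>x + of_rat r * a\<rfloor> = \<lfloor>x\<rfloor>" if "of_int \<lfloor>x\<rfloor> \<noteq> x" for x :: real
    proof (intro exI[of _ "min (\<lfloor>x\<rfloor> + 1 - x) (x - \<lfloor>x\<rfloor>) / ?k"] conjI allI impI)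
      show "min (\<lfloor>x\<rfloor> + 1 - x) (x - \<lfloor>x\<rfloor>) / ?k > 0" using k that by (intro divide_pos_pos) linarith+
      fix a assume a: "a > 0" "a < min (\<lfloor>x\<rfloor> + 1 - x) (x - \<lfloor>x\<rfloor>) / ?k"
      show "\<lfloor>x + of_rat r * a\<rfloor> = \<lfloor>x\<rfloor>" using small[OF a] by (intro floor_unique) linarith+
    qed
    then have "sat real_struct e (Imp (Neg (Eq (Floor (Var 0)) (Var 0))) ?\<psi>)" for e by simp
    from tr[OF this, of "[x]"] show ?thesis using assms that by (simp add: eventually_small_def germ_def)
  qed
  have ***: "eventually_small (\<lambda>d. fl (germ (x, r) d) = germ (x \<oplus> (-1) \<odot> one, 0) d)" if "fl x = x" "r < 0"
  proof -
    have "\<exists>c>0. \<forall>a>0. a < c \<longrightarrow> of_int \<lfloor>x + of_rat r * a\<rfloor> = x - 1" if "of_int \<lfloor>x\<rfloor> = x" for x :: real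
    proof (intro exI[of _ "1 / ?k"] conjI allI impI)
      show "1 / ?k > 0" using k by (intro divide_pos_pos) linarith+
      fix a assume a: "a > 0" "a < 1 / ?k"
      have "of_rat r * a < 0" using a \<open>r < 0\<close> by (intro mult_neg_pos) auto
      then have "\<lfloor>x + of_rat r * a\<rfloor> = \<lfloor>x\<rfloor> - 1" using small[OF a] that by (intro floor_unique) auto
      then show "of_int \<lfloor>x + of_rat r * a\<rfloor> = x - 1" using that by simp
    qed
    then have "sat real_struct e ?\<phi>" for e by (simp add: of_rat_minus)
    from tr[OF this, of "[x]"] show ?thesis using assms that by (simp add: eventually_small_def germ_def)
  qed
  show ?thesis using * ** *** by (cases "fl x = x \<and> r < 0") (auto simp: not_less)
qed

lemma fst_eval_lex: "range e \<subseteq> univ lex \<Longrightarrow> fst (eval_tm lex e t) \<in> U"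
  using wf_eval[OF wf_lex, of e t] by (auto simp: mem_Times_iff)

lemma germ_eval:
  assumes e: "range e \<subseteq> univ lex"
  shows "eventually_small (\<lambda>d. eval_tm M (\<lambda>i. germ (e i) d) t = germ (eval_tm lex e t) d)"
proof (induction t)
  case (Add s t)
  from eventually_small_conj[OF this] show ?case
    by (rule eventually_small_mono)
      (use fst_eval_lex[OF e] in \<open>simp add: germ_add_pair\<close>)
next
  case (Floor t)
  have "eventually_small (\<lambda>d. fl (germ (eval_tm lex e t) d) = germ (floorI lex (eval_tm lex e t)) d)"
    using germ_floor[OF fst_eval_lex[OF e, of t], of "snd (eval_tm lex e t)"] by (simp only: prod.collapse)
  from eventually_small_conj[OF Floor this] show ?case by (rule eventually_small_mono) (simp del: lex_simps)
next
  case (Scale q t)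
  then show ?case
    by (rule eventually_small_mono) (use fst_eval_lex[OF e] in \<open>simp add: germ_scale_pair\<close>)
qed (auto intro: eventually_small_all simp: germ_0)

lemma germ_less:
  assumes "fst x \<in> U" "fst y \<in> U" "lessI lex x y"
  shows "eventually_small (\<lambda>d. germ x d \<sqsubset> germ y d)"
proof (cases "fst x \<sqsubset> fst y")
  case True
  then show ?thesis using germ_less_fst[OF assms(1,2), of "snd x" "snd y"] by simp
next
  case False
  then have "fst x = fst y" "snd x < snd y" using assms by auto
  then have "germ x d \<sqsubset> germ y d" if "d \<in> U" "zero \<sqsubset> d" for d
    using germ_less_snd[OF assms(1) that, of "snd x" "snd y"] by (cases x; cases y) simp
  then show ?thesis by (rule eventually_small_all)
qed

lemma lex_total: "fst x \<in> U \<Longrightarrow> fst y \<in> U \<Longrightarrow> lessI lex x y \<or> x = y \<or> lessI lex y x"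
  using less_total[of "fst x" "fst y"] by (auto simp: prod_eq_iff)

lemma lex_irrefl: "fst x \<in> U \<Longrightarrow> \<not> lessI lex x x"
  using less_irrefl by auto

lemma lex_asym: "fst x \<in> U \<Longrightarrow> fst y \<in> U \<Longrightarrow> lessI lex x y \<Longrightarrow> \<not> lessI lex y x"
  unfolding lex_simps(7) by (metis less_irrefl less_asym order_less_asym)

lemma germ_less_iff:
  assumes "fst x \<in> U" "fst y \<in> U"
  shows "eventually_small (\<lambda>d. germ x d \<sqsubset> germ y d \<longleftrightarrow> lessI lex x y)"
  using lex_total[OF assms]
proof (elim disjE)
  assume "lessI lex x y"
  then show ?thesis using germ_less[OF assms] by (auto elim: eventually_small_mono simp del: lex_simps)
next
  assume "x = y"
  then show ?thesis using assms less_irrefl lex_irrefl by (intro eventually_small_all) (simp del: lex_simps)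
next
  assume l: "lessI lex y x"
  have "eventually_small (\<lambda>d. germ y d \<sqsubset> germ x d)" using germ_less[OF assms(2,1) l] .
  then show ?thesis
    by (rule eventually_small_mono) (use assms less_asym[of "germ y _" "germ x _"] lex_asym[OF assms(2,1) l] in \<open>simp del: lex_simps\<close>)
qed

lemma germ_eq_iff:
  assumes "fst x \<in> U" "fst y \<in> U"
  shows "eventually_small (\<lambda>d. germ x d = germ y d \<longleftrightarrow> x = y)"
proof (cases "x = y")
  case False
  then have "lessI lex x y \<or> lessI lex y x" using lex_total[OF assms] by blast
  then have "eventually_small (\<lambda>d. germ x d \<sqsubset> germ y d) \<or> eventually_small (\<lambda>d. germ y d \<sqsubset> germ x d)"
    using germ_less assms by blast
  then show ?thesis using assms less_irrefl False by (auto elim!: eventually_small_mono)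
qed (auto intro: eventually_small_all)

text \<open>
  The structure \<open>lex\<close> behaves like an ultrapower of the model: what holds at \<open>\<epsilon>\<close> is what holds at all
  small \<open>d > 0\<close>. For terms the integral part is the only interesting case (\<open>germ_floor\<close>).
\<close>

lemma germ_sat:
  assumes e: "range e \<subseteq> univ lex" and "qf \<phi>"
  shows "eventually_small (\<lambda>d. sat M (\<lambda>i. germ (e i) d) \<phi> \<longleftrightarrow> sat lex e \<phi>)"
  using assms(2)
proof (induction \<phi>)
  case (Eq s t)
  have "eventually_small (\<lambda>d. (eval_tm M (\<lambda>i. germ (e i) d) s = germ (eval_tm lex e s) d \<and>
     eval_tm M (\<lambda>i. germ (e i) d) t = germ (eval_tm lex e t) d) \<and>
     (germ (eval_tm lex e s) d = germ (eval_tm lex e t) d \<longleftrightarrow> eval_tm lex e s = eval_tm lex e t))"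
    by (intro eventually_small_conj germ_eval[OF e] germ_eq_iff fst_eval_lex[OF e])
  then show ?case by (rule eventually_small_mono) auto
next
  case (Less s t)
  have "eventually_small (\<lambda>d. (eval_tm M (\<lambda>i. germ (e i) d) s = germ (eval_tm lex e s) d \<and>
     eval_tm M (\<lambda>i. germ (e i) d) t = germ (eval_tm lex e t) d) \<and>
     (germ (eval_tm lex e s) d \<sqsubset> germ (eval_tm lex e t) d \<longleftrightarrow> lessI lex (eval_tm lex e s) (eval_tm lex e t)))"
    by (intro eventually_small_conj germ_eval[OF e] germ_less_iff fst_eval_lex[OF e])
  then show ?case by (rule eventually_small_mono) (auto simp del: lex_simps)
next
  case (Holds p t)
  have "eventually_small (\<lambda>d. (eval_tm M (\<lambda>i. germ (e i) d) t = germ (eval_tm lex e t) d \<and>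
     (germ (zero, 0) d \<sqsubset> germ (eval_tm lex e t) d \<longleftrightarrow> lessI lex (zero, 0) (eval_tm lex e t))) \<and>
     (germ (eval_tm lex e t) d \<sqsubset> germ (one, 0) d \<longleftrightarrow> lessI lex (eval_tm lex e t) (one, 0)))"
    by (intro eventually_small_conj germ_eval[OF e] germ_less_iff fst_eval_lex[OF e]) auto
  then show ?case
    by (rule eventually_small_mono)
      (use fst_eval_lex[OF e] in \<open>cases p; auto simp: germ_0 pred_S mem_Times_iff lex_simps(8) simp del: lex_simps(7)\<close>)
next
  case (Neg \<phi>)
  then show ?case by simp
next
  case (Conj \<phi> \<psi>)
  then have "eventually_small (\<lambda>d. (sat M (\<lambda>i. germ (e i) d) \<phi> \<longleftrightarrow> sat lex e \<phi>) \<and> (sat M (\<lambda>i. germ (e i) d) \<psi> \<longleftrightarrow> sat lex e \<psi>))"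
    by (intro eventually_small_conj) auto
  then show ?case by (rule eventually_small_mono) auto
qed simp

text \<open>
  A valid formula cannot fail at \<open>\<epsilon>\<close>, since it would then fail at some small element of the model.
\<close>

lemma univ_model_lex: "univ_model lex"
  unfolding univ_model_def
proof (intro conjI allI impI wf_lex)
  fix \<psi> and e :: "nat \<Rightarrow> 'a \<times> rat"
  assume \<psi>: "qf \<psi>" "\<forall>e. sat real_struct e \<psi>" and e: "range e \<subseteq> univ lex"
  obtain d where d: "d \<in> U" "sat M (\<lambda>i. germ (e i) d) \<psi> \<longleftrightarrow> sat lex e \<psi>"
    using eventually_small_ex[OF germ_sat[OF e \<psi>(1)]] by blast
  have "range (\<lambda>i. germ (e i) d) \<subseteq> U" using e d by (auto simp: mem_Times_iff image_subset_iff)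
  then have "sat M (\<lambda>i. germ (e i) d) \<psi>" using transfer[OF model] \<psi>(2) by blast
  then show "sat lex e \<psi>" using d by blast
qed

lemma eval_lex_incl: "range e \<subseteq> U \<Longrightarrow> eval_tm lex (\<lambda>i. (e i, 0)) t = (eval_tm M e t, 0)"
  by (induction t) auto

lemma sat_lex_incl: "range e \<subseteq> U \<Longrightarrow> qf \<phi> \<Longrightarrow> sat lex (\<lambda>i. (e i, 0)) \<phi> \<longleftrightarrow> sat M e \<phi>"
proof (induction \<phi>)
  case (Holds p t)
  then show ?case using wf_eval[OF wf, of e t] by (cases p) (simp add: eval_lex_incl pred_S)
qed (auto simp: eval_lex_incl)

text \<open>
  Let \<open>E\<close> be a rational subspace closed under integral parts, and \<open>g\<close> a linear function on \<open>E\<close> that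
  vanishes on integral parts. Then \<open>x \<mapsto> x + g(x) \<epsilon>\<close> embeds \<open>E\<close> into the infinitesimal extension: the
  order is preserved since it is lexicographic, and an element of \<open>E\<close> that is an integer is not moved.
  So formulas survive the step to \<open>\<epsilon>\<close>, and hence the step to all small \<open>d\<close>.
\<close>

lemma perturb:
  assumes E: "E \<subseteq> U" "zero \<in> E" "one \<in> E" "\<And>x y. x \<in> E \<Longrightarrow> y \<in> E \<Longrightarrow> x \<oplus> y \<in> E"
      "\<And>q x. x \<in> E \<Longrightarrow> q \<odot> x \<in> E" "\<And>x. x \<in> E \<Longrightarrow> fl x \<in> E"
    and g: "\<And>x y. x \<in> E \<Longrightarrow> y \<in> E \<Longrightarrow> g (x \<oplus> y) = g x + g y"
      "\<And>q x. x \<in> E \<Longrightarrow> g (q \<odot> x) = q * g x" "\<And>x. x \<in> E \<Longrightarrow> g (fl x) = (0 :: rat)"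
    and e: "range e \<subseteq> E" and sat: "sat M e \<phi>"
  shows "eventually_small (\<lambda>d. sat M (\<lambda>i. e i \<oplus> g (e i) \<odot> d) \<phi>)"
proof -
  have fl01: "fl zero = zero" "fl one = one"
    using tr[of "Eq (Floor Zero) Zero" "[]"] tr[of "Eq (Floor One) One" "[]"] by simp_all
  have g01: "g zero = 0" "g one = 0" using g(3)[OF E(2)] g(3)[OF E(3)] by (simp_all add: fl01)
  have eval: "eval_tm M e t \<in> E \<and> eval_tm lex (\<lambda>i. (e i, g (e i))) t = (eval_tm M e t, g (eval_tm M e t))" for t
  proof (induction t)
    case (Floor t)
    have "g (eval_tm M e t) = 0" if "fl (eval_tm M e t) = eval_tm M e t"
      using g(3)[of "eval_tm M e t"] Floor that by simp
    then show ?case using Floor E(6) g(3) by auto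
  qed (use e in \<open>auto simp: E g g01\<close>)
  have eE: "range e \<subseteq> U" using e E by blast
  have sat_iff: "sat lex (\<lambda>i. (e i, g (e i))) \<psi> \<longleftrightarrow> sat M e \<psi>" if "qf \<psi>" for \<psi>
    using that
  proof (induction \<psi>)
    case (Eq s t)
    then show ?case using eval by auto
  next
    case (Less s t)
    then show ?case using eval less_irrefl E(1) by auto
  next
    case (Holds p t)
    have "eval_tm M e t \<in> U" using eval E(1) by blast
    moreover have "g (eval_tm M e t) = 0" if "eval_tm M e t = zero \<or> eval_tm M e t = one"
      using that g01 by auto
    ultimately show ?case using eval[of t] less_irrefl E(1)
      by (cases p) (auto simp: pred_S)
  qed auto
  have "sat M e (qelim \<phi>)" using sat_qelim[OF model_univ_model[OF model] eE] sat by simp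
  then have "sat lex (\<lambda>i. (e i, g (e i))) (qelim \<phi>)" using sat_iff[OF qf_qelim] by simp
  moreover have "range (\<lambda>i. (e i, g (e i))) \<subseteq> univ lex" using eE by auto
  ultimately have "eventually_small (\<lambda>d. sat M (\<lambda>i. germ (e i, g (e i)) d) (qelim \<phi>))"
    using germ_sat[of "\<lambda>i. (e i, g (e i))", OF _ qf_qelim[of \<phi>]] by simp
  then show ?thesis
  proof (rule eventually_small_mono)
    fix d assume d: "d \<in> U" and s: "sat M (\<lambda>i. germ (e i, g (e i)) d) (qelim \<phi>)"
    have "range (\<lambda>i. germ (e i, g (e i)) d) \<subseteq> U" using eE d by auto
    from sat_qelim[OF model_univ_model[OF model] this] s
    show "sat M (\<lambda>i. e i \<oplus> g (e i) \<odot> d) \<phi>" by (simp add: germ_def)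
  qed
qed

end

section \<open>The axioms of \<open>T\<^sub>G\<close> in one variable\<close>

text \<open>
  On a line \<open>t \<mapsto> (\<beta> t + u)\<close>, the membership in \<open>P\<close> of finitely many coordinates can be prescribed. That
  \<open>F\<close> is a set of pairs says that the coordinates are pairwise different functions.
\<close>

definition generic :: "(L_pred, 'a) struct \<Rightarrow> 'a set \<Rightarrow> bool" where
  "generic M P \<longleftrightarrow> (\<forall>a\<in>univ M. \<forall>b\<in>univ M. \<forall>F G. lessI M a b \<longrightarrow> finite F \<longrightarrow>
     F \<subseteq> (UNIV - {0}) \<times> univ M \<longrightarrow> G \<subseteq> F \<longrightarrow>
     (\<forall>(\<beta>, u)\<in>F. \<forall>t\<in>univ M. lessI M a t \<longrightarrow> lessI M t b \<longrightarrow> addI M (scaleI M \<beta> t) u \<in> predI M S_L) \<longrightarrow>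
     (\<exists>t\<in>univ M. lessI M a t \<and> lessI M t b \<and>
        (\<forall>(\<beta>, u)\<in>F. addI M (scaleI M \<beta> t) u \<in> P \<longleftrightarrow> (\<beta>, u) \<in> G)))"

lemma genericD:
  assumes "generic M P" "a \<in> univ M" "b \<in> univ M" "lessI M a b" "finite F"
    "F \<subseteq> (UNIV - {0}) \<times> univ M" "G \<subseteq> F"
    "\<And>\<beta> u t. (\<beta>, u) \<in> F \<Longrightarrow> t \<in> univ M \<Longrightarrow> lessI M a t \<Longrightarrow> lessI M t b \<Longrightarrow>
       addI M (scaleI M \<beta> t) u \<in> predI M S_L"
  shows "\<exists>t\<in>univ M. lessI M a t \<and> lessI M t b \<and>
    (\<forall>(\<beta>, u)\<in>F. addI M (scaleI M \<beta> t) u \<in> P \<longleftrightarrow> (\<beta>, u) \<in> G)"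
proof -
  have "\<forall>(\<beta>, u)\<in>F. \<forall>t\<in>univ M. lessI M a t \<longrightarrow> lessI M t b \<longrightarrow> addI M (scaleI M \<beta> t) u \<in> predI M S_L"
    using assms(8) by blast
  from assms(1)[unfolded generic_def, THEN bspec, OF assms(2), THEN bspec, OF assms(3), THEN spec, THEN spec,
      THEN mp, OF assms(4), THEN mp, OF assms(5), THEN mp, OF assms(6), THEN mp, OF assms(7), THEN mp, OF this]
  show ?thesis .
qed

lemma ex_inj_Times_rat: "\<exists>\<iota> :: 'a::infinite \<times> rat \<Rightarrow> 'a. inj \<iota>"
proof -
  have inf: "infinite (UNIV :: 'a set)" by (rule infinite_UNIV)
  obtain f :: "nat \<Rightarrow> 'a" where f: "inj f" using infinite_countable_subset[OF inf] by metis
  have "inj (to_nat :: rat \<Rightarrow> nat)" by (rule inj_to_nat)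
  then have "inj (f \<circ> (to_nat :: rat \<Rightarrow> nat))" using f by (simp add: inj_compose)
  then have rat: "(card_of (UNIV :: rat set), card_of (UNIV :: 'a set)) \<in> ordLeq"
    by (intro card_of_ordLeq[THEN iffD1] exI[of _ "f \<circ> to_nat"]) auto
  have "(card_of ((UNIV :: 'a set) \<times> (UNIV :: rat set)), card_of (UNIV :: 'a set)) \<in> ordLeq"
    using card_of_Times_infinite[OF inf _ rat] ordIso_imp_ordLeq by auto
  from card_of_ordLeq[THEN iffD2, OF this] show ?thesis by auto
qed

lemma elementary_sat:
  "elementary_embedding M N f \<Longrightarrow> range e \<subseteq> univ M \<Longrightarrow> sat N (f \<circ> e) \<phi> \<longleftrightarrow> sat M e \<phi>"
  by (simp add: elementary_embedding_def)

lemma elementary_inj: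
  assumes f: "elementary_embedding M N f"
  shows "inj_on f (univ M)"
proof (rule inj_onI)
  fix x y assume xy: "x \<in> univ M" "y \<in> univ M" "f x = f y"
  let ?e = "\<lambda>i :: nat. if i = 0 then x else y"
  have "range ?e \<subseteq> univ M" using xy by auto
  from elementary_sat[OF f this, of "Eq (Var 0) (Var 1)"] show "x = y" using xy by simp
qed

text \<open>
  If a formula with parameters from \<open>M\<close> has finitely many solutions in \<open>N\<close>, then its solutions in \<open>M\<close> can be
  listed, and \<open>M\<close> satisfies the statement that there are no others.
\<close>

lemma acl_elementary:
  assumes f: "elementary_embedding M N f" and wf: "wf_struct M" and A: "A \<subseteq> univ M"
  shows "acl N (f ` A) \<subseteq> f ` univ M"
proof
  fix a assume "a \<in> acl N (f ` A)"
  then obtain \<psi> cs where a: "a \<in> univ N" and cs: "set cs \<subseteq> f ` A" and fv: "fv \<psi> \<subseteq> {..length cs}"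
    and sat: "sat_at N (a # cs) \<psi>" and fin: "finite {x \<in> univ N. sat_at N (x # cs) \<psi>}"
    by (auto simp: acl_def)
  define cs0 where "cs0 = map (inv_into A f) cs"
  have cs0: "set cs0 \<subseteq> univ M" using cs A by (auto simp: cs0_def intro!: subsetD[OF A] inv_into_into)
  have fcs: "map f cs0 = cs" using cs by (auto simp: cs0_def f_inv_into_f intro!: map_idI)
  have z: "zeroI M \<in> univ M" using wf by (simp add: wf_struct_def)
  have len: "length cs0 = length cs" by (simp add: cs0_def)
  define Y where "Y = {y \<in> univ M. sat_at M (y # cs0) \<psi>}"
  have fv': "fv \<psi> \<subseteq> {..<length (x # cs)}" for x using fv by auto
  have tr: "sat_at N (f x # cs) \<psi> \<longleftrightarrow> sat_at M (x # cs0) \<psi>" if "x \<in> univ M" for x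
  proof -
    have "f \<circ> pad (zeroI M) (x # cs0) = pad (f (zeroI M)) (f x # cs)"
    proof
      fix i
      show "(f \<circ> pad (zeroI M) (x # cs0)) i = pad (f (zeroI M)) (f x # cs) i"
        unfolding fcs[symmetric] by (cases i) (simp_all add: pad_def)
    qed
    moreover have "range (pad (zeroI M) (x # cs0)) \<subseteq> univ M" by (rule range_pad) (use that cs0 z in auto)
    moreover have "fv \<psi> \<subseteq> {..<length (x # cs0)}" using fv'[of x] len by simp
    ultimately show ?thesis
      using elementary_sat[OF f, of "pad (zeroI M) (x # cs0)" \<psi>]
        sat_at_pad[OF fv'[of "f x"], where d = "f (zeroI M)" and M = N]
        sat_at_pad[of \<psi> "x # cs0" M "zeroI M"] by simp
  qed
  have "f ` Y \<subseteq> {x \<in> univ N. sat_at N (x # cs) \<psi>}"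
    using f tr by (auto simp: Y_def elementary_embedding_def)
  then have "finite (f ` Y)" using fin finite_subset by blast
  moreover have "inj_on f Y" using elementary_inj[OF f] by (rule inj_on_subset) (auto simp: Y_def)
  ultimately have "finite Y" by (simp add: finite_image_iff)
  then obtain ys where ys: "set ys = Y" by (rule finite_list[THEN exE])
  show "a \<in> f ` univ M"
  proof (rule ccontr)
    assume neg: "a \<notin> f ` univ M"
    let ?\<chi> = "Conj \<psi> (Conjs (map (\<lambda>j. Neg (Eq (Var 0) (Var (Suc (length cs) + j)))) [0..<length ys]))"
    define L where "L = zeroI M # cs0 @ ys"
    have L: "set L \<subseteq> univ M" using z cs0 ys by (auto simp: L_def Y_def)
    let ?e = "pad (zeroI M) L"
    have eU: "range ?e \<subseteq> univ M" using range_pad[OF L z] .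
    have ey: "?e (Suc (length cs) + j) = ys ! j" if "j < length ys" for j
      using that by (simp add: pad_def L_def nth_append len)
    have s1: "sat N ((f \<circ> ?e)(0 := a)) \<psi> \<longleftrightarrow> sat_at N (a # cs) \<psi>"
      unfolding sat_at_def
    proof (rule sat_cong)
      fix i assume "i \<in> fv \<psi>"
      then have "i \<le> length cs" using fv by auto
      then show "((f \<circ> ?e)(0 := a)) i = (a # cs) ! i"
        unfolding fcs[symmetric] by (cases i) (auto simp: pad_def L_def nth_append)
    qed
    have s2: "sat N ((f \<circ> ?e)(0 := a)) (Neg (Eq (Var 0) (Var (Suc (length cs) + j))))" for j
    proof -
      have "?e (Suc (length cs) + j) \<in> univ M" using eU by blast
      then have "f (?e (Suc (length cs) + j)) \<noteq> a" using neg by blast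
      then show ?thesis by simp
    qed
    have "sat N ((f \<circ> ?e)(0 := a)) ?\<chi>"
      unfolding sat.simps(5) sat_Conjs set_map ball_simps(9) using s1 sat s2 by blast
    then have "sat N (f \<circ> ?e) (Ex 0 ?\<chi>)" unfolding sat.simps(6) using a by blast
    then have "sat M ?e (Ex 0 ?\<chi>)" using elementary_sat[OF f eU] by blast
    then obtain y where y: "y \<in> univ M" "sat M (?e(0 := y)) ?\<chi>" unfolding sat.simps(6) by blast
    have y2: "\<forall>j\<in>set [0..<length ys]. sat M (?e(0 := y)) (Neg (Eq (Var 0) (Var (Suc (length cs) + j))))"
      using y(2) unfolding sat.simps(5) sat_Conjs set_map ball_simps(9) by blast
    have "sat M (?e(0 := y)) \<psi> \<longleftrightarrow> sat_at M (y # cs0) \<psi>"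
      unfolding sat_at_def
    proof (rule sat_cong)
      fix i assume "i \<in> fv \<psi>"
      then have "i \<le> length cs0" using fv len by auto
      then show "(?e(0 := y)) i = (y # cs0) ! i"
        by (cases i) (auto simp: pad_def L_def nth_append)
    qed
    then have "y \<in> Y" using y by (simp add: Y_def)
    then obtain j where j: "j < length ys" "ys ! j = y" using ys by (metis in_set_conv_nth)
    then show False using y2 ey[OF j(1)] by (auto dest!: bspec[of _ _ j])
  qed
qed

lemma TG_modelD:
  fixes M :: "(L_pred, 'a) struct"
  assumes "TG_model M P" "fv \<phi> \<subseteq> {..<n + m}" "entails_S TYPE('a) n m \<phi>" "I \<subseteq> {..<n}"
    "length cs = m" "set cs \<subseteq> univ M"
    "\<exists>N f as. elementary_embedding M N f \<and> length as = n \<and> set as \<subseteq> univ N \<and> distinct as \<and>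
           sat_at N (as @ map f cs) \<phi> \<and> set as \<inter> acl N (f ` set cs) = {}"
  shows "\<exists>as. length as = n \<and> set as \<subseteq> univ M \<and> sat_at M (as @ cs) \<phi> \<and> (\<forall>i<n. as ! i \<in> P \<longleftrightarrow> i \<in> I)"
proof -
  note * = assms(1)[unfolded TG_model_def, THEN conjunct2, THEN conjunct2, THEN spec, THEN spec, THEN spec, THEN spec, THEN spec]
  show ?thesis by (rule *[THEN mp, THEN mp, THEN mp, THEN mp, THEN mp, THEN mp, OF assms(2-7)])
qed

text \<open>
  The axiom is applied to the formula saying that the \<open>x\<^sub>k\<close> are the values \<open>\<beta>\<^sub>k t + u\<^sub>k\<close> at some \<open>t\<close> between \<open>a\<close> and \<open>b\<close>.
  A realisation outside the algebraic closure exists in the infinitesimal extension, at the point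
  \<open>t = (a + b) / 2 + \<epsilon>\<close>, because the \<open>\<beta>\<^sub>k\<close> are nonzero. The extension is moved into the type \<open>'a\<close>
  by an injection of \<open>'a \<times> \<rat>\<close>.
\<close>

theorem TG_model_generic:
  fixes M :: "(L_pred, 'a::infinite) struct"
  assumes TG: "TG_model M P"
  shows "generic M P"
  unfolding generic_def
proof (intro ballI allI impI)
  interpret tmodel M using TG by unfold_locales (simp add: TG_model_def)
  fix a b F G
  assume ab: "a \<in> U" "b \<in> U" "a \<sqsubset> b" and fin: "finite F" and F: "F \<subseteq> (UNIV - {0}) \<times> U" and G: "G \<subseteq> F"
    and range: "\<forall>(\<beta>, u)\<in>F. \<forall>t\<in>U. a \<sqsubset> t \<longrightarrow> t \<sqsubset> b \<longrightarrow> \<beta> \<odot> t \<oplus> u \<in> predI M S_L"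
  obtain fs where fs: "set fs = F" "distinct fs" using finite_distinct_list[OF fin] by blast
  define n where "n = length fs"
  define m where "m = n + 2"
  define \<beta> where "\<beta> k = fst (fs ! k)" for k
  define u where "u k = snd (fs ! k)" for k
  have fsk: "fs ! k = (\<beta> k, u k)" "(\<beta> k, u k) \<in> F" "\<beta> k \<noteq> 0" "u k \<in> U" if "k < n" for k
  proof -
    show 1: "fs ! k = (\<beta> k, u k)" by (simp add: \<beta>_def u_def)
    show 2: "(\<beta> k, u k) \<in> F" using that fs(1) unfolding 1[symmetric] n_def by (metis nth_mem)
    then show "\<beta> k \<noteq> 0" "u k \<in> U" using F by auto
  qed
  define cs where "cs = a # b # map snd fs"
  have cs: "length cs = m" "set cs \<subseteq> U" using ab fs F by (auto simp: cs_def m_def n_def)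
  have csk: "cs ! 0 = a" "cs ! Suc 0 = b" "k < n \<Longrightarrow> cs ! Suc (Suc k) = u k" for k
    by (auto simp: cs_def u_def n_def)
  let ?T = "n + m"
  let ?\<theta> = "\<lambda>k. Conj (Eq (Var k) (Add (Scale (\<beta> k) (Var ?T)) (Var (n + Suc (Suc k))))) (Holds S_L (Var k))"
  let ?\<phi> = "Ex ?T (Conj (Less (Var n) (Var ?T)) (Conj (Less (Var ?T) (Var (n + Suc 0)))
     (Conjs (map ?\<theta> [0..<n]))))"
  let ?I = "{k. k < n \<and> fs ! k \<in> G}"
  have fv: "fv ?\<phi> \<subseteq> {..<n + m}" by (auto simp: m_def)
  have ent: "entails_S TYPE('a) n m ?\<phi>"
    unfolding entails_S_def sat_at_def
  proof (intro allI impI subsetI)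
    fix N :: "(L_pred, 'a) struct" and as cs :: "'a list" and x
    assume len: "length as = n" and sat: "sat N (\<lambda>i. (as @ cs) ! i) ?\<phi>" and "x \<in> set as"
    then obtain k where k: "k < n" "x = as ! k" by (metis in_set_conv_nth)
    from sat have "\<forall>k<n. (as @ cs) ! k \<in> predI N S_L" by auto
    then show "x \<in> predI N S_L" using k len by (auto simp: nth_append)
  qed
  have "\<exists>N f as. elementary_embedding M N f \<and> length as = n \<and> set as \<subseteq> univ N \<and> distinct as \<and>
      sat_at N (as @ map f cs) ?\<phi> \<and> set as \<inter> acl N (f ` set cs) = {}"
  proof -
    obtain \<iota> :: "'a \<times> rat \<Rightarrow> 'a" where \<iota>: "inj \<iota>" using ex_inj_Times_rat by blast
    have \<iota>': "inj_on \<iota> (univ lex)" using \<iota> by (rule inj_on_subset) simp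
    interpret tp: transported \<iota> lex by unfold_locales (use \<iota>' wf_lex in auto)
    let ?N = "transport \<iota> lex" and ?f = "\<lambda>x. \<iota> (x, 0)"
    have emb: "elementary_embedding M ?N ?f"
    proof (rule elementary_embeddingI)
      show "univ_model M" using model by (rule model_univ_model)
      show "univ_model ?N" by (rule univ_model_transport[OF \<iota>' univ_model_lex])
      show "?f ` U \<subseteq> univ ?N" by auto
      fix \<phi> :: "L_pred fm" and e :: "nat \<Rightarrow> 'a" assume \<phi>: "qf \<phi>" and e: "range e \<subseteq> U"
      have "range (\<lambda>i. (e i, 0)) \<subseteq> univ lex" using e by auto
      from tp.sat_transport[OF this, of \<phi>] show "sat ?N (?f \<circ> e) \<phi> \<longleftrightarrow> sat M e \<phi>"
        using sat_lex_incl[OF e \<phi>] by (simp add: comp_def)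
    qed
    define as0 where "as0 k = (\<beta> k \<odot> mid a b \<oplus> u k, \<beta> k)" for k
    let ?as = "map (\<lambda>k. \<iota> (as0 k)) [0..<n]"
    have as0U: "as0 k \<in> univ lex" if "k < n" for k using ab fsk[OF that] by (simp add: as0_def)
    have "distinct ?as"
    proof -
      have "inj_on (\<lambda>k. \<iota> (as0 k)) {0..<n}"
      proof (rule inj_onI)
        fix j k assume jk: "j \<in> {0..<n}" "k \<in> {0..<n}" "\<iota> (as0 j) = \<iota> (as0 k)"
        then have "as0 j = as0 k" using injD[OF \<iota>] by blast
        then have eq: "\<beta> j = \<beta> k" "\<beta> k \<odot> mid a b \<oplus> u j = \<beta> k \<odot> mid a b \<oplus> u k"
          by (auto simp: as0_def)
        have "u j = u k"
          using eq(2) tr[of "Imp (Eq (Add (Var 0) (Var 1)) (Add (Var 0) (Var 2))) (Eq (Var 1) (Var 2))"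
              "[\<beta> k \<odot> mid a b, u j, u k]"] jk fsk ab by simp
        then have "fs ! j = fs ! k" using eq(1) fsk(1) jk by auto
        then show "j = k" using fs(2) jk by (simp add: nth_eq_iff_index_eq n_def)
      qed
      then show ?thesis by (simp add: distinct_map)
    qed
    moreover have "sat_at ?N (?as @ map ?f cs) ?\<phi>"
    proof -
      define e0 where "e0 i = (if i < n then as0 i else if i < n + m then (cs ! (i - n), 0) else (zero, 0))" for i
      have "cs ! j \<in> U" if "j < m" for j using that cs nth_mem by blast
      then have "e0 i \<in> univ lex" for i using as0U by (cases "i < n") (simp_all add: e0_def)
      then have e0U: "range e0 \<subseteq> univ lex" by blast
      have "sat_at ?N (?as @ map ?f cs) ?\<phi> \<longleftrightarrow> sat ?N (\<iota> \<circ> e0) ?\<phi>"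
        unfolding sat_at_def
      proof (rule sat_cong)
        fix i assume "i \<in> fv ?\<phi>"
        then have "i < n + m" using fv by blast
        then show "(?as @ map ?f cs) ! i = (\<iota> \<circ> e0) i" using cs(1) by (auto simp: e0_def nth_append)
      qed
      also have "\<dots> \<longleftrightarrow> sat lex e0 ?\<phi>" by (rule tp.sat_transport[OF e0U])
      also have "\<dots>"
      proof -
        let ?t = "(mid a b, 1 :: rat)"
        have mb: "a \<sqsubset> mid a b" "mid a b \<sqsubset> b" using mid[OF ab(3) ab(1,2)] by auto
        have e0n: "(e0(?T := ?t)) n = (a, 0)" "(e0(?T := ?t)) (n + Suc 0) = (b, 0)"
          "k < n \<Longrightarrow> (e0(?T := ?t)) (n + Suc (Suc k)) = (u k, 0)" "k < n \<Longrightarrow> (e0(?T := ?t)) k = as0 k" for k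
          by (auto simp: e0_def m_def csk)
        have s1: "sat lex (e0(?T := ?t)) (?\<theta> k)" if "k \<in> set [0..<n]" for k
        proof -
          have k: "k < n" using that by simp
          have "\<beta> k \<odot> mid a b \<oplus> u k \<in> predI M S_L" using range fsk[OF k] mb ab by auto
          then show ?thesis
            using fsk[OF k] by (simp only: sat.simps eval_tm.simps e0n(3)[OF k] e0n(4)[OF k] fun_upd_same)
              (simp add: as0_def pred_S)
        qed
        have s2: "sat lex (e0(?T := ?t)) (Less (Var n) (Var ?T))"
          "sat lex (e0(?T := ?t)) (Less (Var ?T) (Var (n + Suc 0)))"
          unfolding sat.simps eval_tm.simps e0n using mb by simp_all
        have "sat lex (e0(?T := ?t)) (Conj (Less (Var n) (Var ?T)) (Conj (Less (Var ?T) (Var (n + Suc 0)))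
            (Conjs (map ?\<theta> [0..<n]))))"
          using s1 s2 by (simp only: sat.simps(5) sat_Conjs set_map ball_simps(9)) blast
        moreover have "?t \<in> univ lex" using ab by simp
        ultimately show ?thesis unfolding sat.simps(6) by blast
      qed
      finally show ?thesis .
    qed
    moreover have "set ?as \<inter> acl ?N (?f ` set cs) = {}"
    proof -
      have nf: "\<iota> (as0 k) \<notin> ?f ` U" if "k < n" for k
        using fsk(3)[OF that] injD[OF \<iota>] by (auto simp: as0_def)
      have "y \<notin> ?f ` U" if y: "y \<in> set ?as" for y
      proof -
        obtain k where k: "k < n" "y = \<iota> (as0 k)" using y by auto
        show ?thesis unfolding k(2) by (rule nf[OF k(1)])
      qed
      then have "set ?as \<inter> ?f ` U = {}" by blast
      then show ?thesis using acl_elementary[OF emb wf cs(2)] by blast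
    qed
    moreover have "set ?as \<subseteq> univ ?N" using as0U by auto
    ultimately show ?thesis using emb by (intro exI[of _ ?N] exI[of _ ?f] exI[of _ ?as]) simp
  qed
  from TG_modelD[OF TG fv ent _ cs this, of ?I] obtain as where as: "length as = n" "set as \<subseteq> U" "sat_at M (as @ cs) ?\<phi>"
    "\<forall>i<n. as ! i \<in> P \<longleftrightarrow> i \<in> ?I"
    by auto
  then obtain t where t: "t \<in> U" "a \<sqsubset> t" "t \<sqsubset> b" "\<forall>k<n. as ! k = \<beta> k \<odot> t \<oplus> u k"
    unfolding sat_at_def by (auto simp: nth_append csk m_def)
  have "\<beta>' \<odot> t \<oplus> u' \<in> P \<longleftrightarrow> (\<beta>', u') \<in> G" if F': "(\<beta>', u') \<in> F" for \<beta>' u'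
  proof -
    obtain k where "k < n" "fs ! k = (\<beta>', u')" using F' fs(1) by (metis in_set_conv_nth n_def)
    then show ?thesis using as(4) t(4) by (auto simp: \<beta>_def u_def)
  qed
  then show "\<exists>t\<in>U. a \<sqsubset> t \<and> t \<sqsubset> b \<and> (\<forall>(\<beta>, u)\<in>F. \<beta> \<odot> t \<oplus> u \<in> P \<longleftrightarrow> (\<beta>, u) \<in> G)"
    using t by blast
qed


context tmodel
begin

definition subspace :: "'a set \<Rightarrow> bool" where
  "subspace E \<longleftrightarrow> E \<subseteq> U \<and> zero \<in> E \<and> (\<forall>x\<in>E. \<forall>y\<in>E. x \<oplus> y \<in> E) \<and> (\<forall>q. \<forall>x\<in>E. q \<odot> x \<in> E)"

definition linear_on :: "'a set \<Rightarrow> ('a \<Rightarrow> rat) \<Rightarrow> bool" where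
  "linear_on E g \<longleftrightarrow> (\<forall>x\<in>E. \<forall>y\<in>E. g (x \<oplus> y) = g x + g y) \<and> (\<forall>q. \<forall>x\<in>E. g (q \<odot> x) = q * g x)"

text \<open>
  Bounded distance from \<open>D\<close>. It ensures that integral parts stay in \<open>D\<close> (\<open>near_floor\<close>).
\<close>

definition near :: "'a set \<Rightarrow> 'a \<Rightarrow> bool" where
  "near D x \<longleftrightarrow> (\<exists>d\<in>D. \<exists>K :: nat. d \<oplus> (- of_nat K) \<odot> one \<sqsubset> x \<and> x \<sqsubset> d \<oplus> of_nat K \<odot> one)"

lemma near_add:
  assumes D: "D \<subseteq> U" and x: "near D x" "x \<in> U" and a: "a \<in> predI M S_L"
  shows "near D (x \<oplus> q \<odot> a)"
proof -
  obtain d and K :: nat where d: "d \<in> D" "d \<oplus> (- of_nat K) \<odot> one \<sqsubset> x" "x \<sqsubset> d \<oplus> of_nat K \<odot> one"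
    using x by (auto simp: near_def)
  obtain L :: nat where L: "\<bar>of_rat q\<bar> \<le> real L" using real_arch_simple by blast
  let ?\<phi> = "Imp (Less (Add (Var 0) (Scale (- of_nat K) One)) (Var 1)) (Imp (Less (Var 1) (Add (Var 0) (Scale (of_nat K) One)))
     (Imp (Less Zero (Var 2)) (Imp (Less (Var 2) One) (Conj
       (Less (Add (Var 0) (Scale (- of_nat (K + L)) One)) (Add (Var 1) (Scale q (Var 2))))
       (Less (Add (Var 1) (Scale q (Var 2))) (Add (Var 0) (Scale (of_nat (K + L)) One)))))))"
  have "sat real_struct e ?\<phi>" for e
  proof -
    have "- real L \<le> of_rat q * y \<and> of_rat q * y \<le> L" if "0 < y" "y < 1" for y
    proof -
      have "\<bar>of_rat q * y\<bar> \<le> \<bar>of_rat q\<bar> * 1" unfolding abs_mult using that by (intro mult_left_mono) auto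
      then show ?thesis using L by linarith
    qed
    from this[of "e 2"] show ?thesis by (auto simp: of_rat_minus of_rat_add of_rat_diff)
  qed
  from tr[OF this, of "[d, x, a]"] d D x a show ?thesis
    unfolding near_def by (intro bexI[of _ d] exI[of _ "K + L"]) (auto simp: pred_S)
qed

lemma near_floor:
  assumes D: "subspace D" "one \<in> D" "\<And>x. x \<in> D \<Longrightarrow> fl x \<in> D" and x: "near D x" "x \<in> U"
  shows "fl x \<in> D"
proof -
  obtain d and K :: nat where d: "d \<in> D" "d \<oplus> (- of_nat K) \<odot> one \<sqsubset> x" "x \<sqsubset> d \<oplus> of_nat K \<odot> one"
    using x by (auto simp: near_def)
  let ?k = "\<lambda>k. Eq (Floor (Var 1)) (Add (Floor (Var 0)) (Scale (of_int k) One))"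
  let ?\<phi> = "Imp (Less (Add (Var 0) (Scale (- of_nat K) One)) (Var 1)) (Imp (Less (Var 1) (Add (Var 0) (Scale (of_nat K) One)))
     (Disjs (map ?k [- int K - 1..int K + 1])))"
  have "sat real_struct e ?\<phi>" for e
  proof -
    have "\<lfloor>e 1\<rfloor> - \<lfloor>e 0\<rfloor> \<in> {- int K - 1..int K + 1}" if "e 0 - K < e 1" "e 1 < e 0 + K"
      using that by (auto; linarith)
    moreover have "sat real_struct e (?k (\<lfloor>e 1\<rfloor> - \<lfloor>e 0\<rfloor>))" by (simp add: of_rat_diff)
    ultimately show ?thesis by (auto simp: of_rat_minus simp del: sat.simps(1) intro!: bexI[of _ "\<lfloor>e 1\<rfloor> - \<lfloor>e 0\<rfloor>"])
  qed
  from tr[OF this, of "[d, x]"] d D x obtain k where "fl x = fl d \<oplus> of_int k \<odot> one"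
    by (auto simp: subspace_def)
  then show ?thesis using D d by (auto simp: subspace_def)
qed

text \<open>
  Linear functions on the span \<open>E\<close> of \<open>D\<close> and the listed elements that vanish on \<open>D\<close> and on no element of a
  given finite set outside \<open>D\<close>. The induction adds one element \<open>a\<close> at a time; if \<open>a\<close> is not yet in the
  span, its value \<open>r\<close> is free, and finitely many values are excluded. The finite set has to be arbitrary,
  and not just the list, because later elements may be combinations of earlier ones.
\<close>

lemma ex_functional:
  assumes D: "subspace D" and xs: "set xs \<subseteq> predI M S_L"
  shows "\<exists>E. subspace E \<and> D \<subseteq> E \<and> set xs \<subseteq> E \<and> (\<forall>x\<in>E. near D x) \<and>
    (\<forall>\<Gamma>. finite \<Gamma> \<longrightarrow> \<Gamma> \<subseteq> E - D \<longrightarrow> (\<exists>g. linear_on E g \<and> (\<forall>x\<in>D. g x = 0) \<and> (\<forall>x\<in>\<Gamma>. g x \<noteq> 0)))"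
  using xs
proof (induction xs)
  case Nil
  have "near D x" if "x \<in> D" for x
  proof -
    have "x \<in> U" using that D by (auto simp: subspace_def)
    then have "x \<oplus> (- of_nat 1) \<odot> one \<sqsubset> x" "x \<sqsubset> x \<oplus> of_nat 1 \<odot> one"
      using tr[of "Conj (Less (Add (Var 0) (Scale (- of_nat 1) One)) (Var 0)) (Less (Var 0) (Add (Var 0) (Scale (of_nat 1) One)))" "[x]"]
      by (simp_all add: of_rat_minus)
    then show ?thesis using that unfolding near_def by blast
  qed
  moreover have "linear_on D (\<lambda>_. 0)" by (simp add: linear_on_def)
  ultimately show ?case using D by (intro exI[of _ D]) auto
next
  case (Cons a xs)
  then obtain E where E: "subspace E" "D \<subseteq> E" "set xs \<subseteq> E" "\<forall>x\<in>E. near D x"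
    and gE: "\<And>\<Gamma>. finite \<Gamma> \<Longrightarrow> \<Gamma> \<subseteq> E - D \<Longrightarrow> \<exists>g. linear_on E g \<and> (\<forall>x\<in>D. g x = 0) \<and> (\<forall>x\<in>\<Gamma>. g x \<noteq> 0)"
    by auto
  have a: "a \<in> predI M S_L" "a \<in> U" using Cons.prems by (auto simp: pred_S)
  have EU: "E \<subseteq> U" using E by (simp add: subspace_def)
  have Ecl: "zero \<in> E" "x \<in> E \<Longrightarrow> y \<in> E \<Longrightarrow> x \<oplus> y \<in> E" "x \<in> E \<Longrightarrow> q \<odot> x \<in> E" for x y q
    using E by (auto simp: subspace_def)
  show ?case
  proof (cases "a \<in> E")
    case True
    then show ?thesis using E gE by (intro exI[of _ E]) auto
  next
    case aE: False
    define p where "p x q = x \<oplus> q \<odot> a" for x q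
    define E' where "E' = {p x q |x q. x \<in> E}"
    have padd: "p x q \<oplus> p y r = p (x \<oplus> y) (q + r)" if "x \<in> U" "y \<in> U" for x y q r
      using tr[of "Eq (Add (Add (Var 0) (Scale q (Var 2))) (Add (Var 1) (Scale r (Var 2))))
        (Add (Add (Var 0) (Var 1)) (Scale (q + r) (Var 2)))" "[x, y, a]"] that a
      by (simp add: p_def of_rat_add algebra_simps)
    have pscale: "r \<odot> p x q = p (r \<odot> x) (r * q)" if "x \<in> U" for x q r
      using tr[of "Eq (Scale r (Add (Var 0) (Scale q (Var 1)))) (Add (Scale r (Var 0)) (Scale (r * q) (Var 1)))" "[x, a]"] that a
      by (simp add: p_def of_rat_mult algebra_simps)
    have p0: "p x 0 = x" if "x \<in> U" for x
      using tr[of "Eq (Add (Var 0) (Scale 0 (Var 1))) (Var 0)" "[x, a]"] that a by (simp add: p_def)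
    have p1: "p zero 1 = a"
      using tr[of "Eq (Add Zero (Scale 1 (Var 0))) (Var 0)" "[a]"] a by (simp add: p_def)
    have uniq: "x = y \<and> q = r" if xy: "x \<in> E" "y \<in> E" "p x q = p y r" for x y q r
    proof -
      have xyU: "x \<in> U" "y \<in> U" using xy EU by auto
      have "q = r"
      proof (rule ccontr)
        assume qr: "q \<noteq> r"
        have "a = (1 / (r - q)) \<odot> (x \<oplus> (-1) \<odot> y)"
          using tr[of "Imp (Eq (Add (Var 0) (Scale q (Var 2))) (Add (Var 1) (Scale r (Var 2))))
            (Eq (Var 2) (Scale (1 / (r - q)) (Add (Var 0) (Scale (-1) (Var 1)))))" "[x, y, a]"] xy xyU a qr
          by (simp add: p_def of_rat_divide of_rat_diff of_rat_minus field_simps)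
        then have "a \<in> E" using Ecl xy by metis
        then show False using aE by simp
      qed
      moreover have "x = y"
        using tr[of "Imp (Eq (Add (Var 0) (Scale q (Var 2))) (Add (Var 1) (Scale q (Var 2)))) (Eq (Var 0) (Var 1))" "[x, y, a]"]
          xy xyU a \<open>q = r\<close> by (simp add: p_def)
      ultimately show ?thesis by blast
    qed
    have pU: "p x q \<in> U" if "x \<in> E" for x q using that EU a by (auto simp: p_def)
    have EE': "E \<subseteq> E'"
    proof
      fix x assume "x \<in> E"
      then have "x = p x 0" using p0 EU by auto
      then show "x \<in> E'" using \<open>x \<in> E\<close> unfolding E'_def by blast
    qed
    have "subspace E'"
      unfolding subspace_def
    proof (intro conjI ballI allI)
      show "E' \<subseteq> U" using pU by (auto simp: E'_def)
      show "zero \<in> E'" using EE' Ecl by blast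
      fix x assume "x \<in> E'"
      then obtain x0 q where x: "x = p x0 q" "x0 \<in> E" by (auto simp: E'_def)
      have "r \<odot> x = p (r \<odot> x0) (r * q)" for r unfolding x by (rule pscale) (use x EU in auto)
      then show "r \<odot> x \<in> E'" for r using Ecl(3)[OF x(2)] unfolding E'_def by blast
      fix y assume "y \<in> E'"
      then obtain y0 r where y: "y = p y0 r" "y0 \<in> E" by (auto simp: E'_def)
      have "x \<oplus> y = p (x0 \<oplus> y0) (q + r)" unfolding x y by (rule padd) (use x y EU in auto)
      moreover have "x0 \<oplus> y0 \<in> E" using Ecl(2) x y by blast
      ultimately show "x \<oplus> y \<in> E'" unfolding E'_def by blast
    qed
    moreover have "set (a # xs) \<subseteq> E'" using E(3) EE' p1 Ecl(1) by (auto simp: E'_def)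
    moreover have "\<forall>x\<in>E'. near D x"
      using near_add[OF subset_trans[OF E(2) EU] _ _ a(1)] E(4) EU by (auto simp: E'_def p_def)
    moreover have "\<exists>g. linear_on E' g \<and> (\<forall>x\<in>D. g x = 0) \<and> (\<forall>x\<in>\<Gamma>. g x \<noteq> 0)"
      if \<Gamma>: "finite \<Gamma>" "\<Gamma> \<subseteq> E' - D" for \<Gamma>
    proof -
      obtain g where g: "linear_on E g" "\<forall>x\<in>D. g x = 0" "\<forall>x\<in>\<Gamma> \<inter> E. g x \<noteq> 0"
        using gE[of "\<Gamma> \<inter> E"] \<Gamma> by auto
      define fx where "fx z = (SOME x. x \<in> E \<and> (\<exists>q. z = p x q))" for z
      define fq where "fq z = (SOME q. \<exists>x\<in>E. z = p x q)" for z
      have f: "fx (p x q) = x" "fq (p x q) = q" if "x \<in> E" for x q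
        using that uniq by (auto simp: fx_def fq_def intro!: some_equality)
      obtain r where r: "r \<notin> (\<lambda>z. - g (fx z) / fq z) ` \<Gamma>"
        using ex_new_if_finite[OF infinite_UNIV_char_0 finite_imageI[OF \<Gamma>(1)]] by blast
      define g' where "g' z = g (fx z) + fq z * r" for z
      have g'p: "g' (p x q) = g x + q * r" if "x \<in> E" for x q using f[OF that] by (simp add: g'_def)
      have g'E: "g' x = g x" if "x \<in> E" for x using g'p[OF that, of 0] p0 that EU by auto
      have "linear_on E' g'"
        unfolding linear_on_def
      proof (intro conjI ballI allI)
        fix x assume "x \<in> E'"
        then obtain x0 q where x: "x = p x0 q" "x0 \<in> E" by (auto simp: E'_def)
        have x0U: "x0 \<in> U" using x EU by blast
        show "g' (c \<odot> x) = c * g' x" for c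
          unfolding x(1) pscale[OF x0U] g'p[OF x(2)] g'p[OF Ecl(3)[OF x(2)]]
          using g(1) x(2) by (simp add: linear_on_def algebra_simps)
        fix y assume "y \<in> E'"
        then obtain y0 q' where y: "y = p y0 q'" "y0 \<in> E" by (auto simp: E'_def)
        have y0U: "y0 \<in> U" using y EU by blast
        show "g' (x \<oplus> y) = g' x + g' y"
          unfolding x(1) y(1) padd[OF x0U y0U] g'p[OF x(2)] g'p[OF y(2)] g'p[OF Ecl(2)[OF x(2) y(2)]]
          using g(1) x(2) y(2) by (simp add: linear_on_def algebra_simps)
      qed
      moreover have "\<forall>x\<in>D. g' x = 0" using g(2) g'E E(2) by auto
      moreover have "g' z \<noteq> 0" if z\<Gamma>: "z \<in> \<Gamma>" for z
      proof -
        obtain x q where z: "z = p x q" "x \<in> E" using z\<Gamma> \<Gamma> by (auto simp: E'_def)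
        show ?thesis
        proof (cases "q = 0")
          case True
          then have "z = x" using z p0 EU by auto
          then show ?thesis using g(3) z\<Gamma> z g'E by auto
        next
          case False
          have "- g (fx z) / fq z \<in> (\<lambda>z. - g (fx z) / fq z) ` \<Gamma>" using z\<Gamma> by (rule imageI)
          then have "r \<noteq> - g (fx z) / fq z" using r by blast
          then have "r \<noteq> - g x / q" using f[OF z(2), of q] unfolding z(1) by simp
          then show ?thesis unfolding z(1) g'p[OF z(2)] using False by (auto simp: field_simps)
        qed
      qed
      ultimately show ?thesis by blast
    qed
    ultimately show ?thesis using E(2) EE' by (intro exI[of _ E']) blast
  qed
qed

lemma add_commute: "\<lbrakk>x \<in> U; y \<in> U\<rbrakk> \<Longrightarrow> x \<oplus> y = y \<oplus> x"
  using tr[of "Eq (Add (Var 0) (Var 1)) (Add (Var 1) (Var 0))" "[x, y]"] by simp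

lemma add_scale_0: "\<lbrakk>x \<in> U; y \<in> U\<rbrakk> \<Longrightarrow> x \<oplus> 0 \<odot> y = x"
  using tr[of "Eq (Add (Var 0) (Scale 0 (Var 1))) (Var 0)" "[x, y]"] by simp

end


text \<open>
  Given a realisation \<open>a\<close> in an elementary extension, let \<open>D\<close> be the set of values of terms at the
  parameters. No \<open>a\<^sub>i\<close> lies in \<open>D\<close>, so a linear function \<open>g\<close> that vanishes on \<open>D\<close> can be chosen nonzero at every \<open>a\<^sub>i\<close>.
  By \<open>perturb\<close> the formula holds along the segment of the \<open>a\<^sub>i + g(a\<^sub>i) t\<close> for small \<open>t > 0\<close>. That there is such a
  segment with these rational directions and with distinct starting points is a first-order statement
  about the parameters, so there is one in \<open>M\<close>, and genericity on this line gives the tuple.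
\<close>

theorem generic_TG_model:
  fixes M :: "(L_pred, 'a) struct"
  assumes T: "is_model M theory_T" and P: "P \<subseteq> predI M S_L" and generic: "generic M P"
  shows "TG_model M P"
  unfolding TG_model_def
proof (intro conjI T P allI impI)
  interpret tmodel M using T by unfold_locales
  fix n m and \<phi> :: "L_pred fm" and I :: "nat set" and cs :: "'a list"
  assume fv: "fv \<phi> \<subseteq> {..<n + m}" and ent: "entails_S TYPE('a) n m \<phi>" and I: "I \<subseteq> {..<n}"
    and cs: "length cs = m" "set cs \<subseteq> U"
    and "\<exists>N f as. elementary_embedding M N f \<and> length as = n \<and> set as \<subseteq> univ N \<and> distinct as \<and>
           sat_at N (as @ map f cs) \<phi> \<and> set as \<inter> acl N (f ` set cs) = {}"
  then obtain N f as where emb: "elementary_embedding M N f" and as: "length as = n" "set as \<subseteq> univ N"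
    "distinct as" and sat: "sat_at N (as @ map f cs) \<phi>" and disj: "set as \<inter> acl N (f ` set cs) = {}" by blast
  have modelN: "is_model N theory_T"
    unfolding is_model_def
  proof (intro conjI ballI allI impI)
    show "wf_struct N" using emb by (simp add: elementary_embedding_def)
    fix \<sigma> and e :: "nat \<Rightarrow> 'a" assume "\<sigma> \<in> theory_T" "range e \<subseteq> univ N"
    then show "sat N e \<sigma>"
      using T by (intro elem_valid[OF emb wf]) (auto simp: is_model_def)
  qed
  interpret N: tmodel N using modelN by unfold_locales
  have fU: "f x \<in> univ N" if "x \<in> U" for x using emb that by (auto simp: elementary_embedding_def)
  have csj: "cs ! j \<in> U" if "j < m" for j using that cs nth_mem by blast
  have asi: "as ! i \<in> univ N" if "i < n" for i using that as nth_mem by blast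
  define e where "e i = (if i < n then as ! i else if i < n + m then f (cs ! (i - n)) else zeroI N)" for i
  define e' where "e' i = (if i < n then zeroI N else e i)" for i
  have eU: "range e \<subseteq> univ N" using fU csj asi by (auto simp: e_def)
  have e'U: "range e' \<subseteq> univ N" using eU by (auto simp: e'_def)
  have sat_e: "sat N e \<phi>"
  proof -
    have "sat N (\<lambda>i. (as @ map f cs) ! i) \<phi> \<longleftrightarrow> sat N e \<phi>"
      by (rule sat_cong) (use fv as(1) cs(1) in \<open>auto simp: e_def nth_append\<close>)
    then show ?thesis using sat by (simp add: sat_at_def)
  qed
  define D where "D = range (eval_tm N e')"
  have DU: "D \<subseteq> univ N" using wf_eval[OF N.wf e'U] by (auto simp: D_def)
  have D: "N.subspace D" "oneI N \<in> D" "\<And>x. x \<in> D \<Longrightarrow> floorI N x \<in> D"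
  proof -
    have "eval_tm N e' Zero \<in> D" "eval_tm N e' One \<in> D" unfolding D_def by blast+
    moreover have "addI N x y \<in> D" if xy: "x \<in> D" "y \<in> D" for x y
    proof -
      obtain s t where "x = eval_tm N e' s" "y = eval_tm N e' t" using xy by (auto simp: D_def)
      then have "addI N x y = eval_tm N e' (Add s t)" by simp
      then show ?thesis unfolding D_def by blast
    qed
    moreover have "scaleI N q x \<in> D" "floorI N x \<in> D" if x: "x \<in> D" for x q
    proof -
      obtain s where "x = eval_tm N e' s" using x by (auto simp: D_def)
      then have "scaleI N q x = eval_tm N e' (Scale q s)" "floorI N x = eval_tm N e' (Floor s)" by simp_all
      then show "scaleI N q x \<in> D" "floorI N x \<in> D" unfolding D_def by blast+
    qed
    ultimately show "N.subspace D" "oneI N \<in> D" "\<And>x. x \<in> D \<Longrightarrow> floorI N x \<in> D"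
      using DU by (auto simp: N.subspace_def)
  qed
  have D_acl: "D \<subseteq> acl N (f ` set cs)"
  proof
    fix x assume "x \<in> D"
    then obtain t where t: "x = eval_tm N e' t" by (auto simp: D_def)
    define \<sigma> where "\<sigma> i = (if n \<le> i \<and> i < n + m then Var (Suc (i - n)) else Zero)" for i
    have fvs: "fv_tm (tsub \<sigma> s) \<subseteq> {1..m}" for s by (induction s) (auto simp: \<sigma>_def)
    have ev: "eval_tm N (\<lambda>i. (y # map f cs) ! i) (tsub \<sigma> t) = x" for y
      unfolding eval_tsub t by (rule eval_tm_cong) (use cs(1) in \<open>auto simp: \<sigma>_def e'_def e_def\<close>)
    let ?\<psi> = "Eq (Var 0) (tsub \<sigma> t) :: L_pred fm"
    have "{y \<in> univ N. sat_at N (y # map f cs) ?\<psi>} \<subseteq> {x}" by (auto simp: sat_at_def ev)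
    then have "finite {y \<in> univ N. sat_at N (y # map f cs) ?\<psi>}" using finite_subset by blast
    moreover have "sat_at N (x # map f cs) ?\<psi>" by (simp add: sat_at_def ev)
    moreover have "fv ?\<psi> \<subseteq> {..length (map f cs)}" using fvs[of t] cs(1) by auto
    moreover have "set (map f cs) \<subseteq> f ` set cs" by simp
    ultimately show "x \<in> acl N (f ` set cs)" using \<open>x \<in> D\<close> DU unfolding acl_def by blast
  qed
  have asS: "set as \<subseteq> predI N S_L"
  proof -
    have "set (map f cs) \<subseteq> univ N" using fU cs by auto
    then show ?thesis
      by (intro ent[unfolded entails_S_def, rule_format, of N as "map f cs"])
        (use modelN as sat cs(1) in auto)
  qed
  obtain E g where E: "N.subspace E" "D \<subseteq> E" "set as \<subseteq> E" "\<forall>x\<in>E. N.near D x"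
    and g: "N.linear_on E g" "\<forall>x\<in>D. g x = 0" "\<forall>x\<in>set as. g x \<noteq> 0"
  proof -
    obtain E where E: "N.subspace E" "D \<subseteq> E" "set as \<subseteq> E" "\<forall>x\<in>E. N.near D x"
      and gE: "\<forall>\<Gamma>. finite \<Gamma> \<longrightarrow> \<Gamma> \<subseteq> E - D \<longrightarrow> (\<exists>g. N.linear_on E g \<and> (\<forall>x\<in>D. g x = 0) \<and> (\<forall>x\<in>\<Gamma>. g x \<noteq> 0))"
      using N.ex_functional[OF D(1) asS] by (elim exE conjE) (rule that)
    have "set as \<subseteq> E - D" using E(3) D_acl disj by blast
    from gE[rule_format, OF finite_set this] show ?thesis by (elim exE conjE) (rule that[OF E])
  qed
  have EU: "E \<subseteq> univ N" using E by (simp add: N.subspace_def)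
  have fl: "floorI N x \<in> D" if "x \<in> E" for x
    by (rule N.near_floor[OF D]) (use that E EU in auto)
  have eD: "e i \<in> D" if "\<not> i < n" for i
  proof -
    have "e i = eval_tm N e' (Var i)" using that by (simp add: e'_def)
    then show ?thesis unfolding D_def by blast
  qed
  have eE: "range e \<subseteq> E"
  proof
    fix x assume "x \<in> range e"
    then obtain i where i: "x = e i" by blast
    show "x \<in> E"
    proof (cases "i < n")
      case True
      then have "e i \<in> set as" using as(1) by (simp add: e_def)
      then show ?thesis using E(3) i by blast
    next
      case False
      then show ?thesis using eD E(2) i by blast
    qed
  qed
  define v where "v i = g (as ! i)" for i
  have v0: "v i \<noteq> 0" if "i < n" for i using g(3) that as(1) by (simp add: v_def)
  have "N.eventually_small (\<lambda>d. sat N (\<lambda>i. addI N (e i) (scaleI N (g (e i)) d)) \<phi>)"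
  proof (rule N.perturb[where E = E])
    show "E \<subseteq> univ N" "zeroI N \<in> E" "oneI N \<in> E" using EU E(1,2) D(2) by (auto simp: N.subspace_def)
    show "x \<in> E \<Longrightarrow> y \<in> E \<Longrightarrow> addI N x y \<in> E" "x \<in> E \<Longrightarrow> scaleI N q x \<in> E" for x y q
      using E(1) by (auto simp: N.subspace_def)
    show "x \<in> E \<Longrightarrow> floorI N x \<in> E" for x using fl E(2) by blast
    show "x \<in> E \<Longrightarrow> y \<in> E \<Longrightarrow> g (addI N x y) = g x + g y" "x \<in> E \<Longrightarrow> g (scaleI N q x) = q * g x" for x y q
      using g(1) by (auto simp: N.linear_on_def)
    show "x \<in> E \<Longrightarrow> g (floorI N x) = 0" for x using fl g(2) by blast
  qed (use eE sat_e in auto)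
  then obtain d0 where d0: "d0 \<in> univ N" "lessI N (zeroI N) d0"
    "\<And>d. d \<in> univ N \<Longrightarrow> lessI N (zeroI N) d \<Longrightarrow> lessI N d d0 \<Longrightarrow>
       sat N (\<lambda>i. addI N (e i) (scaleI N (g (e i)) d)) \<phi>"
    unfolding N.eventually_small_def by blast
  \<comment> \<open>The formula \<open>\<chi>\<close> has the starting points in the variables from \<open>n + m\<close> on, and the end of the segment
     in the variable \<open>?b\<close>.\<close>
  let ?b = "n + m + n"
  let ?t = "Suc ?b"
  let ?line = "All ?t (Imp (Less Zero (Var ?t)) (Imp (Less (Var ?t) (Var ?b))
     (Alls [0..<n] (Imp (Conjs (map (\<lambda>i. Eq (Var i) (Add (Var (n + m + i)) (Scale (v i) (Var ?t)))) [0..<n])) \<phi>))))"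
  let ?dist = "Conjs (map (\<lambda>(i, j). Neg (Eq (Var (n + m + i)) (Var (n + m + j))))
      (filter (\<lambda>(i, j). i \<noteq> j) (List.product [0..<n] [0..<n])))"
  let ?\<chi> = "Conj (Less Zero (Var ?b)) (Conj ?dist ?line)"
  have \<chi>: "sat K h ?\<chi> \<longleftrightarrow> lessI K (zeroI K) (h ?b) \<and>
      (\<forall>i<n. \<forall>j<n. i \<noteq> j \<longrightarrow> h (n + m + i) \<noteq> h (n + m + j)) \<and>
      (\<forall>t\<in>univ K. lessI K (zeroI K) t \<longrightarrow> lessI K t (h ?b) \<longrightarrow>
        (\<forall>h'. range h' \<subseteq> univ K \<longrightarrow> (\<forall>i\<ge>n. h' i = (h(?t := t)) i) \<longrightarrow>
           (\<forall>i<n. h' i = addI K (h (n + m + i)) (scaleI K (v i) t)) \<longrightarrow> sat K h' \<phi>))"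
    if h: "range h \<subseteq> univ K" for K :: "(L_pred, 'a) struct" and h
  proof -
    have 1: "sat K h ?dist \<longleftrightarrow> (\<forall>i<n. \<forall>j<n. i \<noteq> j \<longrightarrow> h (n + m + i) \<noteq> h (n + m + j))"
      by auto
    have 2: "sat K h ?line \<longleftrightarrow> (\<forall>t\<in>univ K. lessI K (zeroI K) t \<longrightarrow> lessI K t (h ?b) \<longrightarrow>
        (\<forall>h'. range h' \<subseteq> univ K \<longrightarrow> (\<forall>i\<ge>n. h' i = (h(?t := t)) i) \<longrightarrow>
           (\<forall>i<n. h' i = addI K (h (n + m + i)) (scaleI K (v i) t)) \<longrightarrow> sat K h' \<phi>))"
    proof -
      have "sat K (h(?t := t)) (Alls [0..<n] (Imp (Conjs (map (\<lambda>i. Eq (Var i) (Add (Var (n + m + i)) (Scale (v i) (Var ?t)))) [0..<n])) \<phi>)) \<longleftrightarrow>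
        (\<forall>h'. range h' \<subseteq> univ K \<longrightarrow> (\<forall>i\<ge>n. h' i = (h(?t := t)) i) \<longrightarrow>
           (\<forall>i<n. h' i = addI K (h (n + m + i)) (scaleI K (v i) t)) \<longrightarrow> sat K h' \<phi>)" if t: "t \<in> univ K" for t
      proof -
        have key: "(sat K h' (Imp (Conjs (map (\<lambda>i. Eq (Var i) (Add (Var (n + m + i)) (Scale (v i) (Var ?t)))) [0..<n])) \<phi>)) \<longleftrightarrow>
          ((\<forall>i<n. h' i = addI K (h (n + m + i)) (scaleI K (v i) t)) \<longrightarrow> sat K h' \<phi>)"
          if h': "\<forall>i\<ge>n. h' i = (h(?t := t)) i" for h'
        proof -
          have "h' ?t = t" "\<And>i. i < n \<Longrightarrow> h' (n + m + i) = h (n + m + i)" using h' by auto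
          then show ?thesis unfolding sat_derived(2) sat_Conjs set_map ball_simps(9) by auto
        qed
        have AA: "(\<forall>i. i \<notin> set [0..<n] \<longrightarrow> h' i = (h(?t := t)) i) \<longleftrightarrow> (\<forall>i\<ge>n. h' i = (h(?t := t)) i)" for h'
          by (simp add: not_less)
        show ?thesis
          unfolding sat_Alls_iff[OF range_upd[OF h t]] AA by (intro iff_allI imp_cong refl key)
      qed
      then show ?thesis by simp
    qed
    show ?thesis unfolding sat.simps(2,5) 1 2 by simp
  qed
  define e1 where "e1 i = (if i < n then f zero else if i < n + m then f (cs ! (i - n))
      else if i < ?b then as ! (i - (n + m)) else if i = ?b then d0 else f zero)" for i
  define eM where "eM i = (if i < n then zero else if i < n + m then cs ! (i - n) else zero)" for i
  have eMU: "range eM \<subseteq> U" using csj by (auto simp: eM_def)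
  have e1U: "range e1 \<subseteq> univ N" using csj fU asi d0 by (auto simp: e1_def)
  have "sat N e1 ?\<chi>"
    unfolding \<chi>[OF e1U]
  proof (intro conjI allI impI ballI)
    show "lessI N (zeroI N) (e1 ?b)" using d0 by (simp add: e1_def)
    fix i j assume "i < n" "j < n" "i \<noteq> j"
    then show "e1 (n + m + i) \<noteq> e1 (n + m + j)" using as by (simp add: e1_def nth_eq_iff_index_eq)
  next
    fix t h'
    assume t: "t \<in> univ N" "lessI N (zeroI N) t" "lessI N t (e1 ?b)" and h': "range h' \<subseteq> univ N"
      "\<forall>i\<ge>n. h' i = (e1(?t := t)) i" "\<forall>i<n. h' i = addI N (e1 (n + m + i)) (scaleI N (v i) t)"
    have "sat N (\<lambda>i. addI N (e i) (scaleI N (g (e i)) t)) \<phi>" using d0(3) t by (simp add: e1_def)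
    moreover have "addI N (e i) (scaleI N (g (e i)) t) = h' i" if "i \<in> fv \<phi>" for i
    proof (cases "i < n")
      case True
      then show ?thesis using h' by (simp add: e_def e1_def v_def)
    next
      case False
      have "i < n + m" using that fv by auto
      then have "h' i = e i" using False h' by (simp add: e_def e1_def)
      moreover have "g (e i) = 0" using eD[OF False] g(2) by blast
      moreover have "e i \<in> univ N" using eU by blast
      ultimately show ?thesis using t N.add_scale_0 by simp
    qed
    ultimately show "sat N h' \<phi>" using sat_cong[of \<phi> "\<lambda>i. addI N (e i) (scaleI N (g (e i)) t)" h' N] by blast
  qed
  then have "\<not> sat N (f \<circ> eM) (Alls [n + m..<Suc ?b] (Neg ?\<chi>))"
  proof -
    have fe: "range (f \<circ> eM) \<subseteq> univ N" using eMU fU by auto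
    have "e1 i = (f \<circ> eM) i" if "i \<notin> set [n + m..<Suc ?b]" for i
      using that by (auto simp: e1_def eM_def)
    then show ?thesis using \<open>sat N e1 ?\<chi>\<close> e1U unfolding sat_Alls_iff[OF fe] sat.simps(4) by blast
  qed
  then have "\<not> sat M eM (Alls [n + m..<Suc ?b] (Neg ?\<chi>))" using elementary_sat[OF emb eMU] by blast
  then obtain h where h: "range h \<subseteq> U" "\<forall>i. i \<notin> set [n + m..<Suc ?b] \<longrightarrow> h i = eM i" "sat M h ?\<chi>"
    unfolding sat_Alls_iff[OF eMU] sat.simps(4) by blast
  define \<alpha> where "\<alpha> i = h (n + m + i)" for i
  define b where "b = h ?b"
  have \<alpha>U: "\<alpha> i \<in> U" for i using h(1) by (auto simp: \<alpha>_def)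
  have bU: "b \<in> U" using h(1) by (auto simp: b_def)
  have b0: "zero \<sqsubset> b" and \<alpha>d: "\<And>i j. i < n \<Longrightarrow> j < n \<Longrightarrow> i \<noteq> j \<Longrightarrow> \<alpha> i \<noteq> \<alpha> j"
    using h(3) unfolding \<chi>[OF h(1)] \<alpha>_def b_def by blast+
  have line: "sat_at M (map (\<lambda>i. \<alpha> i \<oplus> v i \<odot> t) [0..<n] @ cs) \<phi>" if t: "t \<in> U" "zero \<sqsubset> t" "t \<sqsubset> b" for t
  proof -
    let ?h = "\<lambda>i. if i < n then \<alpha> i \<oplus> v i \<odot> t else (h(?t := t)) i"
    have "range ?h \<subseteq> U" using h(1) \<alpha>U t(1) by auto
    then have "sat M ?h \<phi>" using h(3) t unfolding \<chi>[OF h(1)] by (auto simp: \<alpha>_def b_def)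
    moreover have "sat M (\<lambda>i. (map (\<lambda>i. \<alpha> i \<oplus> v i \<odot> t) [0..<n] @ cs) ! i) \<phi> \<longleftrightarrow> sat M ?h \<phi>"
    proof (rule sat_cong)
      fix i assume "i \<in> fv \<phi>"
      then have "i < n + m" using fv by auto
      then show "(map (\<lambda>i. \<alpha> i \<oplus> v i \<odot> t) [0..<n] @ cs) ! i = ?h i"
        using h(2) by (auto simp: nth_append eM_def)
    qed
    ultimately show ?thesis by (simp add: sat_at_def)
  qed
  let ?F = "(\<lambda>i. (v i, \<alpha> i)) ` {..<n}"
  let ?G = "(\<lambda>i. (v i, \<alpha> i)) ` I"
  have comm: "v i \<odot> t \<oplus> \<alpha> i = \<alpha> i \<oplus> v i \<odot> t" if "t \<in> U" for t i
    using add_commute \<alpha>U that by simp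
  have inS: "\<alpha> i \<oplus> v i \<odot> t \<in> predI M S_L" if t: "t \<in> U" "zero \<sqsubset> t" "t \<sqsubset> b" and i: "i < n" for t i
  proof -
    let ?as = "map (\<lambda>i. \<alpha> i \<oplus> v i \<odot> t) [0..<n]"
    have "set ?as \<subseteq> U" using \<alpha>U t by auto
    then have "set ?as \<subseteq> predI M S_L"
      by (intro ent[unfolded entails_S_def, rule_format, of M ?as cs]) (use T line[OF t] cs in auto)
    then show ?thesis using i by auto
  qed
  have "\<exists>t\<in>U. zero \<sqsubset> t \<and> t \<sqsubset> b \<and> (\<forall>(\<beta>, u)\<in>?F. \<beta> \<odot> t \<oplus> u \<in> P \<longleftrightarrow> (\<beta>, u) \<in> ?G)"
  proof -
    have "?F \<subseteq> (UNIV - {0}) \<times> U" using v0 \<alpha>U by auto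
    moreover have "?G \<subseteq> ?F" using I by auto
    moreover have "\<beta> \<odot> t \<oplus> u \<in> predI M S_L" if "(\<beta>, u) \<in> ?F" "t \<in> U" "zero \<sqsubset> t" "t \<sqsubset> b" for \<beta> u t
      using that inS comm by auto
    ultimately show ?thesis
      by (intro genericD[OF generic _ bU b0]; (simp; fail)?)
  qed
  then obtain t where t: "t \<in> U" "zero \<sqsubset> t" "t \<sqsubset> b"
    "\<forall>i<n. v i \<odot> t \<oplus> \<alpha> i \<in> P \<longleftrightarrow> (v i, \<alpha> i) \<in> ?G" by auto
  have "(v i, \<alpha> i) \<in> ?G \<longleftrightarrow> i \<in> I" if "i < n" for i
    using that \<alpha>d I by (auto; metis lessThan_iff subsetD)
  then have "\<forall>i<n. map (\<lambda>i. \<alpha> i \<oplus> v i \<odot> t) [0..<n] ! i \<in> P \<longleftrightarrow> i \<in> I"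
    using t(4) comm[OF t(1)] by simp
  moreover have "set (map (\<lambda>i. \<alpha> i \<oplus> v i \<odot> t) [0..<n]) \<subseteq> U" using \<alpha>U t by auto
  ultimately show "\<exists>as. length as = n \<and> set as \<subseteq> U \<and> sat_at M (as @ cs) \<phi> \<and> (\<forall>i<n. as ! i \<in> P \<longleftrightarrow> i \<in> I)"
    using line[OF t(1-3)] by (intro exI[of _ "map (\<lambda>i. \<alpha> i \<oplus> v i \<odot> t) [0..<n]"]) simp
qed

section \<open>Quantifier elimination for \<open>T\<^sub>G\<close>\<close>

context tmodel
begin

lemma finite_max: "finite A \<Longrightarrow> A \<noteq> {} \<Longrightarrow> A \<subseteq> U \<Longrightarrow> \<exists>m\<in>A. \<forall>a\<in>A. \<not> m \<sqsubset> a"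
proof (induction A rule: finite_ne_induct)
  case (singleton x)
  then show ?case using less_irrefl by auto
next
  case (insert x A)
  then obtain m where m: "m \<in> A" "\<forall>a\<in>A. \<not> m \<sqsubset> a" by auto
  show ?case
  proof (cases "m \<sqsubset> x")
    case True
    have "\<not> x \<sqsubset> a" if "a \<in> A" for a
      using less_trans[OF True, of a] m that insert.prems by auto
    then show ?thesis using less_irrefl insert.prems by auto
  next
    case False
    then show ?thesis using m by auto
  qed
qed

lemma finite_min: "finite A \<Longrightarrow> A \<noteq> {} \<Longrightarrow> A \<subseteq> U \<Longrightarrow> \<exists>m\<in>A. \<forall>a\<in>A. \<not> a \<sqsubset> m"
proof (induction A rule: finite_ne_induct)
  case (singleton x)
  then show ?case using less_irrefl by auto
next
  case (insert x A)
  then obtain m where m: "m \<in> A" "\<forall>a\<in>A. \<not> a \<sqsubset> m" by auto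
  show ?case
  proof (cases "x \<sqsubset> m")
    case True
    have "\<not> a \<sqsubset> x" if "a \<in> A" for a
      using less_trans[OF _ True, of a] m that insert.prems by auto
    then show ?thesis using less_irrefl insert.prems by auto
  next
    case False
    then show ?thesis using m by auto
  qed
qed

lemma ex_neighbours:
  assumes A: "finite A" "A \<subseteq> U" and s: "s \<in> U" "s \<notin> A" and l: "l \<in> A" "l \<sqsubset> s" and r: "r \<in> A" "s \<sqsubset> r"
  obtains a b where "a \<in> A" "b \<in> A" "a \<sqsubset> s" "s \<sqsubset> b"
    "\<And>c. c \<in> A \<Longrightarrow> c \<sqsubset> s \<Longrightarrow> \<not> a \<sqsubset> c" "\<And>c. c \<in> A \<Longrightarrow> s \<sqsubset> c \<Longrightarrow> \<not> c \<sqsubset> b"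
proof -
  have "\<exists>m\<in>{c \<in> A. c \<sqsubset> s}. \<forall>a\<in>{c \<in> A. c \<sqsubset> s}. \<not> m \<sqsubset> a"
    by (rule finite_max) (use A l in auto)
  moreover have "\<exists>m\<in>{c \<in> A. s \<sqsubset> c}. \<forall>a\<in>{c \<in> A. s \<sqsubset> c}. \<not> a \<sqsubset> m"
    by (rule finite_min) (use A r in auto)
  ultimately show ?thesis using that by blast
qed

lemma not_less_trans: "\<lbrakk>\<not> y \<sqsubset> x; y \<sqsubset> z; x \<in> U; y \<in> U; z \<in> U\<rbrakk> \<Longrightarrow> x \<sqsubset> z"
  using less_total less_trans by blast

lemma less_not_trans: "\<lbrakk>x \<sqsubset> y; \<not> z \<sqsubset> y; x \<in> U; y \<in> U; z \<in> U\<rbrakk> \<Longrightarrow> x \<sqsubset> z"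
  using less_total less_trans by blast

text \<open>
  The two points where \<open>\<beta> t + u\<close> takes the values \<open>0\<close> and \<open>1\<close>, for a pair \<open>(\<beta>, u)\<close>. If these are among the
  parameters with which \<open>s\<close> is compared, its position decides whether \<open>\<beta> s + u\<close> is in \<open>(0,1)\<close>.
\<close>

definition lo_tm :: "rat \<times> tm \<Rightarrow> tm" where "lo_tm p = Scale (- 1 / fst p) (snd p)"
definition hi_tm :: "rat \<times> tm \<Rightarrow> tm" where "hi_tm p = Scale (1 / fst p) (Add One (Scale (-1) (snd p)))"

lemma S_iff:
  assumes "fst p \<noteq> 0" "t \<in> U" "range e \<subseteq> U"
  shows "fst p \<odot> t \<oplus> eval_tm M e (snd p) \<in> predI M S_L \<longleftrightarrow>
    (if fst p > 0 then eval_tm M e (lo_tm p) \<sqsubset> t \<and> t \<sqsubset> eval_tm M e (hi_tm p)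
     else eval_tm M e (hi_tm p) \<sqsubset> t \<and> t \<sqsubset> eval_tm M e (lo_tm p))"
proof -
  obtain \<beta> u where p: "p = (\<beta>, u)" by force
  have \<beta>: "\<beta> \<noteq> 0" using assms p by simp
  let ?lo = "Scale (- 1 / \<beta>) (Var 1)" and ?hi = "Scale (1 / \<beta>) (Add One (Scale (-1) (Var 1)))"
  have uU: "eval_tm M e u \<in> U" using wf_eval[OF wf assms(3)] .
  show ?thesis
  proof (cases "\<beta> > 0")
    case True
    have b: "(of_rat \<beta> :: real) > 0" using True by simp
    have "sat real_struct h (Iff (Holds S_L (Add (Scale \<beta> (Var 0)) (Var 1))) (Conj (Less ?lo (Var 0)) (Less (Var 0) ?hi)))" for h
      using b by (auto simp: of_rat_divide of_rat_minus field_simps)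
    from tr[OF this, of "[t, eval_tm M e u]"] show ?thesis
      using True assms(2) uU by (simp add: p lo_tm_def hi_tm_def)
  next
    case False
    then have b: "(of_rat \<beta> :: real) < 0" using \<beta> by simp
    have "sat real_struct h (Iff (Holds S_L (Add (Scale \<beta> (Var 0)) (Var 1))) (Conj (Less ?hi (Var 0)) (Less (Var 0) ?lo)))" for h
      using b by (auto simp: of_rat_divide of_rat_minus field_simps)
    from tr[OF this, of "[t, eval_tm M e u]"] show ?thesis
      using False assms(2) uU by (simp add: p lo_tm_def hi_tm_def)
  qed
qed

definition same_order where
  "same_order C s e s' e' \<longleftrightarrow> (\<forall>u\<in>C. (s \<sqsubset> eval_tm M e u \<longleftrightarrow> s' \<sqsubset> eval_tm M e' u) \<and>
     (s = eval_tm M e u \<longleftrightarrow> s' = eval_tm M e' u))"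

lemma same_order_greater:
  assumes "same_order C s e s' e'" "u \<in> C" "s \<in> U" "s' \<in> U" "range e \<subseteq> U" "range e' \<subseteq> U"
  shows "eval_tm M e u \<sqsubset> s \<longleftrightarrow> eval_tm M e' u \<sqsubset> s'"
proof -
  have "eval_tm M e u \<in> U" "eval_tm M e' u \<in> U" using assms wf_eval[OF wf] by auto
  then have "eval_tm M e u \<sqsubset> s \<longleftrightarrow> \<not> s \<sqsubset> eval_tm M e u \<and> s \<noteq> eval_tm M e u"
    "eval_tm M e' u \<sqsubset> s' \<longleftrightarrow> \<not> s' \<sqsubset> eval_tm M e' u \<and> s' \<noteq> eval_tm M e' u"
    using less_total less_irrefl less_asym assms(3,4) by metis+
  then show ?thesis using assms(1,2) by (auto simp: same_order_def)
qed

lemma same_order_S: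
  assumes "same_order C s e s' e'" "lo_tm p \<in> C" "hi_tm p \<in> C" "fst p \<noteq> 0"
    "s \<in> U" "s' \<in> U" "range e \<subseteq> U" "range e' \<subseteq> U"
  shows "fst p \<odot> s \<oplus> eval_tm M e (snd p) \<in> predI M S_L \<longleftrightarrow> fst p \<odot> s' \<oplus> eval_tm M e' (snd p) \<in> predI M S_L"
  unfolding S_iff[OF assms(4,5,7)] S_iff[OF assms(4,6,8)]
  using same_order_greater[OF assms(1) _ assms(5-8)] assms(1-3) by (simp add: same_order_def)

text \<open>
  The coordinates of an element of the model, that is, the values of \<open>qtm\<close> and \<open>stm\<close>.
\<close>

definition qM :: "nat \<Rightarrow> 'a \<Rightarrow> 'a" where "qM N x = fl ((1 / of_nat N) \<odot> x)"
definition sM :: "nat \<Rightarrow> 'a \<Rightarrow> 'a" where "sM N x = x \<oplus> (- of_nat N) \<odot> qM N x"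

lemma eval_qtm: "eval_tm M e (qtm v N) = qM N (e v)" and eval_stm: "eval_tm M e (stm v N) = sM N (e v)"
  by (simp_all add: qtm_def stm_def qM_def sM_def)

lemma qM_U [simp]: "x \<in> U \<Longrightarrow> qM N x \<in> U" and sM_U [simp]: "x \<in> U \<Longrightarrow> sM N x \<in> U"
  by (simp_all add: qM_def sM_def)

lemma qM_int: "x \<in> U \<Longrightarrow> fl (qM N x) = qM N x"
  using tr[of "Eq (Floor (Floor (Scale (1 / of_nat N) (Var 0)))) (Floor (Scale (1 / of_nat N) (Var 0)))" "[x]"]
  by (simp add: qM_def)

lemma sM_bounds:
  assumes "N > 0" "x \<in> U"
  shows "\<not> sM N x \<sqsubset> zero" "sM N x \<sqsubset> of_nat N \<odot> one"
proof -
  have "sat real_struct e (Conj (Neg (Less (stm 0 N) Zero)) (Less (stm 0 N) (Scale (of_nat N) One)))" for e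
    using sv_bounds[OF assms(1), where v = 0 and e = e] by simp
  from tr[OF this, of "[x]"] assms show "\<not> sM N x \<sqsubset> zero" "sM N x \<sqsubset> of_nat N \<odot> one"
    by (simp_all add: eval_stm)
qed

lemma qM_sM_build:
  assumes "N > 0" "q \<in> U" "s \<in> U" "fl q = q" "\<not> s \<sqsubset> zero" "s \<sqsubset> of_nat N \<odot> one"
  shows "qM N (of_nat N \<odot> q \<oplus> s) = q" "sM N (of_nat N \<odot> q \<oplus> s) = s"
proof -
  let ?x = "Add (Scale (of_nat N) (Var 0)) (Var 1)"
  let ?q = "Floor (Scale (1 / of_nat N) ?x)"
  have "sat real_struct e (Imp (Eq (Floor (Var 0)) (Var 0)) (Imp (Neg (Less (Var 1) Zero)) (Imp (Less (Var 1) (Scale (of_nat N) One))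
     (Conj (Eq ?q (Var 0)) (Eq (Add ?x (Scale (- of_nat N) ?q)) (Var 1))))))" for e
  proof -
    have "\<lfloor>(N * x + y) / N\<rfloor> = \<lfloor>x\<rfloor>" if "of_int \<lfloor>x\<rfloor> = x" "0 \<le> y" "y < N" for x y :: real
    proof (rule floor_unique)
      have "(N * x + y) / N = x + y / N" using assms(1) by (simp add: field_simps)
      moreover have "0 \<le> y / N" "y / N < 1" using that assms(1) by auto
      ultimately show "of_int \<lfloor>x\<rfloor> \<le> (N * x + y) / N" "(N * x + y) / N < of_int \<lfloor>x\<rfloor> + 1" using that by linarith+
    qed
    then show ?thesis by (auto simp: of_rat_minus of_rat_divide not_less)
  qed
  from tr[OF this, of "[q, s]"] assms show q: "qM N (of_nat N \<odot> q \<oplus> s) = q"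
    by (simp add: qM_def)
  show "sM N (of_nat N \<odot> q \<oplus> s) = s"
    using tr[of "Eq (Add ?x (Scale (- of_nat N) (Var 0))) (Var 1)" "[q, s]"] assms
    by (simp add: sM_def q of_rat_minus)
qed

lemma q_test_term:
  assumes W: "finite W" and e: "range e \<subseteq> U" and x: "x \<in> U"
  obtains q where "q \<in> q_tests W"
    "\<And>w. w \<in> W \<Longrightarrow> fl (eval_tm M e w) \<sqsubset> qM N x \<longleftrightarrow> fl (eval_tm M e w) \<sqsubset> eval_tm M e q"
proof -
  obtain v where v: "v \<notin> (\<Union>w\<in>W. fv_tm w)"
    using ex_new_if_finite[of "\<Union>w\<in>W. fv_tm w"] W by auto
  obtain ws where ws: "set ws = W" using W by (rule finite_list[THEN exE])
  have "finite (q_tests W)" using W by (simp add: q_tests_def)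
  then obtain qs where qs: "set qs = q_tests W" by (rule finite_list[THEN exE])
  let ?\<theta> = "\<lambda>q w. Iff (Less (Floor w) (qtm v N)) (Less (Floor w) q) :: L_pred fm"
  let ?\<phi> = "Disjs (map (\<lambda>q. Conjs (map (?\<theta> q) ws)) qs)"
  have "sat real_struct h ?\<phi>" for h
  proof -
    obtain q k where q: "q \<in> q_tests W" "ev h q = of_int k"
      "\<forall>w\<in>W. \<lfloor>h v / N\<rfloor> \<le> \<lfloor>ev h w\<rfloor> \<longleftrightarrow> k \<le> \<lfloor>ev h w\<rfloor>"
      using ex_q_test[OF W, of h "\<lfloor>h v / N\<rfloor>"] by blast
    have "sat real_struct h (?\<theta> q w)" if "w \<in> W" for w
      using q(3) that by (auto simp: qv_int q(2) not_le[symmetric])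
    then show ?thesis
      unfolding sat_Disjs set_map bex_simps(7) sat_Conjs ball_simps(9) ws qs using q(1) by blast
  qed
  moreover have "range (e(v := x)) \<subseteq> U" by (rule range_upd[OF e x])
  ultimately have "sat M (e(v := x)) ?\<phi>" by (rule transfer[OF model])
  then obtain q where q: "q \<in> q_tests W" "\<forall>w\<in>W. sat M (e(v := x)) (?\<theta> q w)"
    unfolding sat_Disjs set_map bex_simps(7) sat_Conjs ball_simps(9) ws qs by blast
  have "v \<notin> fv_tm q" "w \<in> W \<Longrightarrow> v \<notin> fv_tm w" for w using q(1) v by (auto simp: q_tests_def)
  then show ?thesis using q that by (simp add: eval_qtm)
qed

end

locale generic_model = tmodel M for M :: "(L_pred, 'a) struct" +
  fixes P :: "'a set"
  assumes P_S: "P \<subseteq> predI M S_L" and generic: "generic M P"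
begin

abbreviation "MP \<equiv> expand M P"

lemma wf_MP: "wf_struct MP"
  using wf_expand[OF wf] P_S pred_S by blast

text \<open>
  Finitely many cells, given by assignments \<open>h j\<close> of the parameters, have a common point with prescribed
  membership in \<open>P\<close>, provided that they contain, up to membership in \<open>P\<close>, a common point \<open>s\<close> different from all parameters,
  and that no element is required both in \<open>P\<close> and outside. The point \<open>s\<close> lies in an open interval on which its
  position does not change, and genericity applies to this interval.
\<close>

lemma realise:
  fixes h :: "'j \<Rightarrow> nat \<Rightarrow> 'a"
  assumes J: "finite J" "J \<noteq> {}" and h: "\<And>j. j \<in> J \<Longrightarrow> range (h j) \<subseteq> U"
    and fin: "finite B" "finite C" and B0: "\<And>p. p \<in> B \<Longrightarrow> fst p \<noteq> 0"
    and thr: "lo_tm ` B \<union> hi_tm ` B \<subseteq> C" "Zero \<in> C" "c \<in> C"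
    and s: "s \<in> U" "zero \<sqsubset> s" "\<And>j. j \<in> J \<Longrightarrow> s \<sqsubset> eval_tm M (h j) c"
    and ne: "\<And>j u. j \<in> J \<Longrightarrow> u \<in> C \<Longrightarrow> s \<noteq> eval_tm M (h j) u"
    and pos: "\<And>j p. j \<in> J \<Longrightarrow> p \<in> pos j \<Longrightarrow> p \<in> B \<and> fst p \<odot> s \<oplus> eval_tm M (h j) (snd p) \<in> predI M S_L"
    and noconf: "\<And>j j' p p'. j \<in> J \<Longrightarrow> j' \<in> J \<Longrightarrow> p \<in> pos j \<Longrightarrow> p' \<in> B - pos j' \<Longrightarrow> fst p = fst p' \<Longrightarrow>
      eval_tm M (h j) (snd p) \<noteq> eval_tm M (h j') (snd p')"
  shows "\<exists>s'\<in>U. \<forall>j\<in>J. same_order C s (h j) s' (h j) \<and>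
    (\<forall>p\<in>B. fst p \<odot> s' \<oplus> eval_tm M (h j) (snd p) \<in> P \<longleftrightarrow> p \<in> pos j)"
proof -
  define A where "A = (\<lambda>(j, u). eval_tm M (h j) u) ` (J \<times> C)"
  have hU: "eval_tm M (h j) u \<in> U" if "j \<in> J" for j u using wf_eval[OF wf h[OF that]] .
  have memA: "eval_tm M (h j) u \<in> A" if "j \<in> J" "u \<in> C" for j u using that by (auto simp: A_def)
  obtain j0 where j0: "j0 \<in> J" using J by blast
  have A: "finite A" "A \<subseteq> U" "s \<notin> A" using J fin hU ne by (auto simp: A_def)
  have "zero \<in> A" using memA[OF j0 thr(2)] by simp
  then obtain a b where ab: "a \<in> A" "b \<in> A" "a \<sqsubset> s" "s \<sqsubset> b"
    "\<And>c. c \<in> A \<Longrightarrow> c \<sqsubset> s \<Longrightarrow> \<not> a \<sqsubset> c" "\<And>c. c \<in> A \<Longrightarrow> s \<sqsubset> c \<Longrightarrow> \<not> c \<sqsubset> b"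
    using ex_neighbours[OF A(1,2) s(1) A(3) _ s(2) memA[OF j0 thr(3)] s(3)[OF j0]] by blast
  have abU: "a \<in> U" "b \<in> U" using ab A by auto
  have order: "same_order C s (h j) t (h j)" if t: "t \<in> U" "a \<sqsubset> t" "t \<sqsubset> b" and j: "j \<in> J" for t j
    unfolding same_order_def
  proof
    fix u assume u: "u \<in> C"
    let ?c = "eval_tm M (h j) u"
    have c: "?c \<in> A" "?c \<in> U" "?c \<noteq> s" using memA[OF j u] hU[OF j] ne[OF j u] by auto
    show "(s \<sqsubset> ?c \<longleftrightarrow> t \<sqsubset> ?c) \<and> (s = ?c \<longleftrightarrow> t = ?c)"
    proof (cases "s \<sqsubset> ?c")
      case True
      then have "t \<sqsubset> ?c" using less_not_trans[OF t(3) ab(6)[OF c(1) True]] t abU c by blast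
      then show ?thesis using True less_irrefl c by auto
    next
      case False
      then have "?c \<sqsubset> s" using less_total[OF s(1) c(2)] c(3) by auto
      then have "?c \<sqsubset> t" using not_less_trans[OF ab(5)[OF c(1)] t(2)] t abU c by blast
      then show ?thesis using False less_irrefl less_asym c t(1) by metis
    qed
  qed
  have S_t: "fst p \<odot> t \<oplus> eval_tm M (h j) (snd p) \<in> predI M S_L \<longleftrightarrow> fst p \<odot> s \<oplus> eval_tm M (h j) (snd p) \<in> predI M S_L"
    if t: "t \<in> U" "a \<sqsubset> t" "t \<sqsubset> b" and j: "j \<in> J" and p: "p \<in> B" for t j p
    using same_order_S[OF order[OF t j] _ _ B0[OF p] s(1) t(1) h[OF j] h[OF j]] thr p by blast
  define F where "F = {(fst p, eval_tm M (h j) (snd p)) |j p. j \<in> J \<and> p \<in> B \<and>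
    fst p \<odot> s \<oplus> eval_tm M (h j) (snd p) \<in> predI M S_L}"
  define G where "G = {(fst p, eval_tm M (h j) (snd p)) |j p. j \<in> J \<and> p \<in> pos j}"
  have "F \<subseteq> (\<lambda>(j, p). (fst p, eval_tm M (h j) (snd p))) ` (J \<times> B)"
  proof
    fix z assume "z \<in> F"
    then obtain j p where "z = (fst p, eval_tm M (h j) (snd p))" "j \<in> J" "p \<in> B" by (auto simp: F_def)
    then show "z \<in> (\<lambda>(j, p). (fst p, eval_tm M (h j) (snd p))) ` (J \<times> B)" by (intro image_eqI[of _ _ "(j, p)"]) auto
  qed
  then have "finite F" using J fin by (auto intro: finite_subset)
  moreover have "F \<subseteq> (UNIV - {0}) \<times> U" using B0 hU by (fastforce simp: F_def)
  moreover have "G \<subseteq> F" using pos by (fastforce simp: F_def G_def)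
  moreover have "\<beta> \<odot> t \<oplus> u \<in> predI M S_L" if "(\<beta>, u) \<in> F" "t \<in> U" "a \<sqsubset> t" "t \<sqsubset> b" for \<beta> u t
    using that S_t by (auto simp: F_def)
  moreover have "a \<sqsubset> b" using less_trans ab(3,4) s(1) abU by blast
  ultimately obtain t where t: "t \<in> U" "a \<sqsubset> t" "t \<sqsubset> b" and tF: "\<forall>(\<beta>, u)\<in>F. \<beta> \<odot> t \<oplus> u \<in> P \<longleftrightarrow> (\<beta>, u) \<in> G"
    using genericD[OF generic abU, of F G] by blast
  have "fst p \<odot> t \<oplus> eval_tm M (h j) (snd p) \<in> P \<longleftrightarrow> p \<in> pos j" if j: "j \<in> J" and p: "p \<in> B" for j p
  proof (cases "fst p \<odot> s \<oplus> eval_tm M (h j) (snd p) \<in> predI M S_L")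
    case True
    then have "(fst p, eval_tm M (h j) (snd p)) \<in> F" unfolding F_def using j p by blast
    then have "fst p \<odot> t \<oplus> eval_tm M (h j) (snd p) \<in> P \<longleftrightarrow> (fst p, eval_tm M (h j) (snd p)) \<in> G" using tF by auto
    also have "\<dots> \<longleftrightarrow> p \<in> pos j"
    proof
      assume "(fst p, eval_tm M (h j) (snd p)) \<in> G"
      then obtain j' p' where "j' \<in> J" "p' \<in> pos j'" "fst p' = fst p" "eval_tm M (h j') (snd p') = eval_tm M (h j) (snd p)"
        unfolding G_def by auto
      then show "p \<in> pos j" using noconf[OF _ j, of j' p' p] p by blast
    next
      assume "p \<in> pos j" then show "(fst p, eval_tm M (h j) (snd p)) \<in> G" unfolding G_def using j by blast
    qed
    finally show ?thesis .
  next
    case False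
    then have "fst p \<odot> t \<oplus> eval_tm M (h j) (snd p) \<notin> predI M S_L" using S_t[OF t j p] by blast
    then show ?thesis using False pos[OF j] P_S by blast
  qed
  then show ?thesis using t order by blast
qed

text \<open>
  Whether an existential formula holds is decided by the positions of the parameters relative to each
  other and by finitely many conditions on parameters alone. Given a solution over \<open>e\<close>, its \<open>q\<close> is
  replaced by a test term. If its \<open>s\<close> is one of the parameters, the same parameter serves over \<open>e'\<close>;
  otherwise \<open>s\<close> lies between two neighbouring parameters, and \<open>realise\<close> gives a point between the
  corresponding ones over \<open>e'\<close>.
\<close>

lemma ex_determined:
  assumes "qf \<phi>"
  shows "\<exists>\<Delta>. finite \<Delta> \<and> (\<forall>\<delta>\<in>\<Delta>. qf \<delta>) \<and> (\<forall>e e'. range e \<subseteq> U \<longrightarrow> range e' \<subseteq> U \<longrightarrow>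
    agree \<Delta> MP e MP e' \<longrightarrow> sat MP e (Ex v \<phi>) \<longrightarrow> sat MP e' (Ex v \<phi>))"
proof -
  obtain N where N: "N > 0" "period v N \<phi>" using ex_period[OF assms] by blast
  obtain W T B Y where adm: "admissible v W T B Y"
    and det: "determines (basics (qtm v N) (stm v N) W T B Y) M P \<phi>"
    using ex_basics[OF N(1) assms N(2), where 'a = 'a] model P_S by blast
  define Q where "Q = q_tests W"
  define C where "C = {Zero, Scale (of_nat N) One} \<union> T \<union> lo_tm ` B \<union> hi_tm ` B"
  have fin: "finite W" "finite B" "finite C" "finite Q" "finite Y" using adm by (auto simp: admissible_def Q_def q_tests_def C_def)
  have B0: "fst p \<noteq> 0" "v \<notin> fv_tm (snd p)" if "p \<in> B" for p using adm that by (auto simp: admissible_def)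
  have fresh: "w \<in> W \<Longrightarrow> v \<notin> fv_tm w" "u \<in> C \<Longrightarrow> v \<notin> fv_tm u" "y \<in> Y \<Longrightarrow> v \<notin> fv y" for w u y
    using adm B0 by (auto simp: admissible_def C_def lo_tm_def hi_tm_def)
  define \<Delta> where "\<Delta> = (\<lambda>(w, q). Less (Floor w) q) ` (W \<times> Q) \<union> (\<lambda>(u, u'). Less u u') ` (C \<times> C) \<union>
    (\<lambda>(u, u'). Eq u u') ` (C \<times> C) \<union> (\<lambda>(p, u). Holds P_LP (Add (Scale (fst p) u) (snd p))) ` (B \<times> C) \<union>
    (\<lambda>(p, p'). Eq (snd p) (snd p')) ` (B \<times> B) \<union> Y"
  have "finite \<Delta>" using fin by (simp add: \<Delta>_def)
  moreover have "\<forall>\<delta>\<in>\<Delta>. qf \<delta>" using adm by (auto simp: \<Delta>_def admissible_def)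
  moreover have "sat MP e' (Ex v \<phi>)"
    if e: "range e \<subseteq> U" and e': "range e' \<subseteq> U" and ag: "agree \<Delta> MP e MP e'" and sat: "sat MP e (Ex v \<phi>)" for e e'
  proof -
    obtain x where x: "x \<in> U" "sat MP (e(v := x)) \<phi>" using sat by auto
    define s where "s = sM N x"
    have sU: "s \<in> U" "\<not> s \<sqsubset> zero" "s \<sqsubset> of_nat N \<odot> one" using sM_bounds[OF N(1) x(1)] x by (simp_all add: s_def)
    have eU: "eval_tm M e t \<in> U" "eval_tm M e' t \<in> U" for t using wf_eval[OF wf] e e' by auto
    have agW: "fl (eval_tm M e w) \<sqsubset> eval_tm M e q \<longleftrightarrow> fl (eval_tm M e' w) \<sqsubset> eval_tm M e' q"
      if "w \<in> W" "q \<in> Q" for w q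
    proof -
      have "Less (Floor w) q \<in> \<Delta>" using that by (auto simp: \<Delta>_def)
      then show ?thesis using ag by (force simp: agree_def)
    qed
    have agC: "eval_tm M e u \<sqsubset> eval_tm M e u' \<longleftrightarrow> eval_tm M e' u \<sqsubset> eval_tm M e' u'"
      "eval_tm M e u = eval_tm M e u' \<longleftrightarrow> eval_tm M e' u = eval_tm M e' u'"
      if "u \<in> C" "u' \<in> C" for u u'
    proof -
      have "Less u u' \<in> \<Delta>" "Eq u u' \<in> \<Delta>" using that by (auto simp: \<Delta>_def)
      then show "eval_tm M e u \<sqsubset> eval_tm M e u' \<longleftrightarrow> eval_tm M e' u \<sqsubset> eval_tm M e' u'"
        "eval_tm M e u = eval_tm M e u' \<longleftrightarrow> eval_tm M e' u = eval_tm M e' u'"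
        using ag unfolding agree_def by (metis sat.simps(1,2) eval_expand expand_simps(7))+
    qed
    have agP: "fst p \<odot> eval_tm M e u \<oplus> eval_tm M e (snd p) \<in> P \<longleftrightarrow> fst p \<odot> eval_tm M e' u \<oplus> eval_tm M e' (snd p) \<in> P"
      if "p \<in> B" "u \<in> C" for p u
    proof -
      have "Holds P_LP (Add (Scale (fst p) u) (snd p)) \<in> \<Delta>" using that by (force simp: \<Delta>_def)
      then show ?thesis using ag by (force simp: agree_def)
    qed
    have agB: "eval_tm M e (snd p) = eval_tm M e (snd p') \<longleftrightarrow> eval_tm M e' (snd p) = eval_tm M e' (snd p')"
      if "p \<in> B" "p' \<in> B" for p p'
    proof -
      have "Eq (snd p) (snd p') \<in> \<Delta>" using that by (force simp: \<Delta>_def)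
      then show ?thesis using ag unfolding agree_def by (metis sat.simps(1) eval_expand)
    qed
    have agY: "sat MP e y \<longleftrightarrow> sat MP e' y" if "y \<in> Y" for y using that ag by (auto simp: agree_def \<Delta>_def)
    obtain q where q: "q \<in> Q" "\<And>w. w \<in> W \<Longrightarrow> fl (eval_tm M e w) \<sqsubset> qM N x \<longleftrightarrow> fl (eval_tm M e w) \<sqsubset> eval_tm M e q"
      by (rule q_test_term[OF fin(1) e x(1), of N, folded Q_def]) (rule that)
    have q_int: "fl (eval_tm M e' q) = eval_tm M e' q"
    proof -
      have 1: "fl zero = zero" using tr[of "Eq (Floor Zero) Zero" "[]"] by simp
      have 2: "fl (fl y) = fl y" "fl (fl y \<oplus> one) = fl y \<oplus> one" if "y \<in> U" for y
        using tr[of "Conj (Eq (Floor (Floor (Var 0))) (Floor (Var 0))) (Eq (Floor (Add (Floor (Var 0)) One)) (Add (Floor (Var 0)) One))" "[y]"] that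
        by simp_all
      show ?thesis using q(1) 1 2 eU(2) by (auto simp: Q_def q_tests_def)
    qed
    have "\<exists>s'\<in>U. same_order C s e s' e' \<and>
      (\<forall>p\<in>B. fst p \<odot> s \<oplus> eval_tm M e (snd p) \<in> P \<longleftrightarrow> fst p \<odot> s' \<oplus> eval_tm M e' (snd p) \<in> P)"
    proof (cases "\<exists>u\<in>C. s = eval_tm M e u")
      case True
      then obtain u where u: "u \<in> C" "s = eval_tm M e u" by blast
      then show ?thesis
        using agC[OF u(1)] agP[OF _ u(1)] eU by (intro bexI[of _ "eval_tm M e' u"]) (auto simp: same_order_def)
    next
      case False
      have ZC: "Zero \<in> C" "Scale (of_nat N) One \<in> C" by (auto simp: C_def)
      have s0: "zero \<sqsubset> s" using less_total[OF closed(1) sU(1)] sU(2) False ZC(1) by force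
      obtain a b where "a \<in> eval_tm M e ` C" "b \<in> eval_tm M e ` C" and ab: "a \<sqsubset> s" "s \<sqsubset> b"
        "\<And>c. c \<in> eval_tm M e ` C \<Longrightarrow> c \<sqsubset> s \<Longrightarrow> \<not> a \<sqsubset> c" "\<And>c. c \<in> eval_tm M e ` C \<Longrightarrow> s \<sqsubset> c \<Longrightarrow> \<not> c \<sqsubset> b"
      proof (rule ex_neighbours[of "eval_tm M e ` C" s "eval_tm M e Zero" "eval_tm M e (Scale (of_nat N) One)"])
        show "finite (eval_tm M e ` C)" "eval_tm M e ` C \<subseteq> U" "s \<notin> eval_tm M e ` C" using fin eU False by auto
        show "eval_tm M e Zero \<in> eval_tm M e ` C" "eval_tm M e (Scale (of_nat N) One) \<in> eval_tm M e ` C"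
          using ZC by blast+
      qed (use sU s0 in auto)
      then obtain u1 u2 where u12: "u1 \<in> C" "u2 \<in> C" "a = eval_tm M e u1" "b = eval_tm M e u2" by blast
      let ?a = "eval_tm M e' u1" and ?b = "eval_tm M e' u2"
      have "a \<sqsubset> b" using less_trans[OF ab(1,2)] u12 eU sU by blast
      then have "?a \<sqsubset> ?b" using agC(1)[OF u12(1,2)] u12 by simp
      then have m: "?a \<sqsubset> mid ?a ?b" "mid ?a ?b \<sqsubset> ?b" "mid ?a ?b \<in> U" using mid[OF _ eU(2) eU(2)] eU by auto
      let ?m = "mid ?a ?b"
      have so: "same_order C s e ?m e'"
        unfolding same_order_def
      proof
        fix u assume u: "u \<in> C"
        let ?c = "eval_tm M e u" and ?c' = "eval_tm M e' u"
        have ne: "s \<noteq> ?c" using False u by blast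
        show "(s \<sqsubset> ?c \<longleftrightarrow> ?m \<sqsubset> ?c') \<and> (s = ?c \<longleftrightarrow> ?m = ?c')"
        proof (cases "s \<sqsubset> ?c")
          case True
          then have "\<not> ?c \<sqsubset> b" using ab(4) u by blast
          then have "\<not> ?c' \<sqsubset> ?b" using agC(1)[OF u u12(2)] u12 by simp
          then have "?m \<sqsubset> ?c'" using less_not_trans[OF m(2)] m(3) eU by blast
          then show ?thesis using True ne less_irrefl eU by auto
        next
          case f: False
          then have "?c \<sqsubset> s" using less_total[OF sU(1) eU(1)[of u]] ne by auto
          then have "\<not> a \<sqsubset> ?c" using ab(3) u by blast
          then have "\<not> ?a \<sqsubset> ?c'" using agC(1)[OF u12(1) u] u12 by simp
          then have "?c' \<sqsubset> ?m" using not_less_trans[OF _ m(1)] m(3) eU by blast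
          then show ?thesis using f ne less_irrefl less_asym eU m(3) by metis
        qed
      qed
      define pos where "pos = {p \<in> B. fst p \<odot> s \<oplus> eval_tm M e (snd p) \<in> P}"
      have "\<exists>s'\<in>U. \<forall>j\<in>{()}. same_order C ?m e' s' e' \<and>
         (\<forall>p\<in>B. fst p \<odot> s' \<oplus> eval_tm M e' (snd p) \<in> P \<longleftrightarrow> p \<in> pos)"
      proof (rule realise[where h = "\<lambda>_. e'" and pos = "\<lambda>_. pos" and c = "Scale (of_nat N) One"])
        show "zero \<sqsubset> ?m" using same_order_greater[OF so ZC(1) sU(1) m(3) e e'] s0 by simp
        show "?m \<sqsubset> eval_tm M e' (Scale (of_nat N) One)" if "j \<in> {()}" for j
          using so ZC(2) sU(3) by (auto simp: same_order_def)
        show "?m \<noteq> eval_tm M e' u" if "u \<in> C" for u using so False that by (auto simp: same_order_def)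
        show "p \<in> B \<and> fst p \<odot> ?m \<oplus> eval_tm M e' (snd p) \<in> predI M S_L" if "p \<in> pos" for p
        proof -
          have p: "p \<in> B" "fst p \<odot> s \<oplus> eval_tm M e (snd p) \<in> predI M S_L" using that P_S by (auto simp: pos_def)
          moreover have "lo_tm p \<in> C" "hi_tm p \<in> C" using p(1) by (auto simp: C_def)
          ultimately show ?thesis using same_order_S[OF so _ _ B0(1)[OF p(1)] sU(1) m(3) e e'] by blast
        qed
        show "eval_tm M e' (snd p) \<noteq> eval_tm M e' (snd p')" if "p \<in> pos" "p' \<in> B - pos" "fst p = fst p'" for p p'
          using that agB[of p p'] by (auto simp: pos_def)
        show "lo_tm ` B \<union> hi_tm ` B \<subseteq> C" by (auto simp: C_def)
      qed (use fin B0 ZC m e' in auto)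
      then obtain s' where "s' \<in> U" "same_order C ?m e' s' e'"
        "\<forall>p\<in>B. fst p \<odot> s' \<oplus> eval_tm M e' (snd p) \<in> P \<longleftrightarrow> p \<in> pos" by auto
      then show ?thesis using so by (intro bexI[of _ s']) (auto simp: same_order_def pos_def)
    qed
    then obtain s' where s': "s' \<in> U" "same_order C s e s' e'"
      "\<forall>p\<in>B. fst p \<odot> s \<oplus> eval_tm M e (snd p) \<in> P \<longleftrightarrow> fst p \<odot> s' \<oplus> eval_tm M e' (snd p) \<in> P" by blast
    have "Zero \<in> C" "Scale (of_nat N) One \<in> C" by (auto simp: C_def)
    then have s'b: "\<not> s' \<sqsubset> zero" "s' \<sqsubset> of_nat N \<odot> one"
      using s'(2) sU unfolding same_order_def by fastforce+
    let ?x' = "of_nat N \<odot> eval_tm M e' q \<oplus> s'"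
    have x': "?x' \<in> U" "qM N ?x' = eval_tm M e' q" "sM N ?x' = s'"
      using qM_sM_build[OF N(1) eU(2) s'(1) q_int s'b] s'(1) eU by auto
    have "agree (basics (qtm v N) (stm v N) W T B Y) MP (e(v := x)) MP (e'(v := ?x'))"
      unfolding agree_basics
    proof (intro conjI ballI)
      fix w assume w: "w \<in> W"
      show "fl (eval_tm M (e(v := x)) w) \<sqsubset> eval_tm M (e(v := x)) (qtm v N) \<longleftrightarrow>
        fl (eval_tm M (e'(v := ?x')) w) \<sqsubset> eval_tm M (e'(v := ?x')) (qtm v N)"
        using q(2)[OF w] agW[OF w q(1)] fresh(1)[OF w] x'(2) by (simp add: eval_qtm)
    next
      fix u assume "u \<in> T"
      then have u: "u \<in> C" by (auto simp: C_def)
      show "eval_tm M (e(v := x)) (stm v N) \<sqsubset> eval_tm M (e(v := x)) u \<longleftrightarrow>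
        eval_tm M (e'(v := ?x')) (stm v N) \<sqsubset> eval_tm M (e'(v := ?x')) u"
        "eval_tm M (e(v := x)) (stm v N) = eval_tm M (e(v := x)) u \<longleftrightarrow>
        eval_tm M (e'(v := ?x')) (stm v N) = eval_tm M (e'(v := ?x')) u"
        using s'(2) u fresh(2)[OF u] x'(3) by (simp_all add: eval_stm same_order_def flip: s_def)
    next
      fix p assume p: "p \<in> B"
      show "case p of (\<beta>, u) \<Rightarrow> \<beta> \<odot> eval_tm M (e(v := x)) (stm v N) \<oplus> eval_tm M (e(v := x)) u \<in> P \<longleftrightarrow>
        \<beta> \<odot> eval_tm M (e'(v := ?x')) (stm v N) \<oplus> eval_tm M (e'(v := ?x')) u \<in> P"
        using s'(3) p B0(2)[OF p] x'(3) by (simp add: split_beta eval_stm flip: s_def)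
    next
      fix y assume y: "y \<in> Y"
      show "sat MP (e(v := x)) y \<longleftrightarrow> sat MP (e'(v := ?x')) y"
        using agY[OF y] fresh(3)[OF y] by (simp add: sat_upd)
    qed
    then have "sat MP (e'(v := ?x')) \<phi>"
      using det x range_upd[OF e x(1)] range_upd[OF e' x'(1)] unfolding determines_def by blast
    then show ?thesis using x'(1) by auto
  qed
  ultimately show ?thesis by blast
qed

theorem quantifier_elimination:
  "\<exists>\<psi>. qf \<psi> \<and> (\<forall>e. range e \<subseteq> U \<longrightarrow> (sat MP e \<phi> \<longleftrightarrow> sat MP e \<psi>))"
proof (induction \<phi>)
  case (Neg \<phi>)
  then obtain \<psi> where "qf \<psi>" "\<forall>e. range e \<subseteq> U \<longrightarrow> (sat MP e \<phi> \<longleftrightarrow> sat MP e \<psi>)" by blast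
  then show ?case by (intro exI[of _ "Neg \<psi>"]) auto
next
  case (Conj \<phi> \<phi>')
  then obtain \<psi> \<psi>' where "qf \<psi>" "\<forall>e. range e \<subseteq> U \<longrightarrow> (sat MP e \<phi> \<longleftrightarrow> sat MP e \<psi>)"
    "qf \<psi>'" "\<forall>e. range e \<subseteq> U \<longrightarrow> (sat MP e \<phi>' \<longleftrightarrow> sat MP e \<psi>')" by blast
  then show ?case by (intro exI[of _ "Conj \<psi> \<psi>'"]) auto
next
  case (Ex v \<phi>)
  then obtain \<psi> where \<psi>: "qf \<psi>" "\<forall>e. range e \<subseteq> U \<longrightarrow> (sat MP e \<phi> \<longleftrightarrow> sat MP e \<psi>)" by blast
  obtain \<Delta> where \<Delta>: "finite \<Delta>" "\<forall>\<delta>\<in>\<Delta>. qf \<delta>" and det: "\<forall>e e'. range e \<subseteq> U \<longrightarrow> range e' \<subseteq> U \<longrightarrow>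
    agree \<Delta> MP e MP e' \<longrightarrow> sat MP e (Ex v \<psi>) \<longrightarrow> sat MP e' (Ex v \<psi>)"
    using ex_determined[OF \<psi>(1), of v] by (elim exE conjE) (rule that)
  have "\<exists>\<chi>. bool_comb \<Delta> \<chi> \<and> (\<forall>K e. K = MP \<and> range e \<subseteq> U \<longrightarrow> (sat K e (Ex v \<psi>) \<longleftrightarrow> sat K e \<chi>))"
  proof (rule ex_bool_comb[OF \<Delta>(1)])
    fix K e K' e'
    assume "K = MP \<and> range e \<subseteq> U" "K' = MP \<and> range e' \<subseteq> U" "agree \<Delta> K e K' e'" "sat K e (Ex v \<psi>)"
    then show "sat K' e' (Ex v \<psi>)" using det[rule_format, of e e'] by auto
  qed
  then obtain \<chi> where \<chi>: "bool_comb \<Delta> \<chi>" "\<forall>K e. K = MP \<and> range e \<subseteq> U \<longrightarrow> (sat K e (Ex v \<psi>) \<longleftrightarrow> sat K e \<chi>)"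
    by (elim exE conjE) (rule that)
  have "sat MP e (Ex v \<phi>) \<longleftrightarrow> sat MP e (Ex v \<psi>)" if "range e \<subseteq> U" for e
    unfolding sat.simps by (rule bex_cong) (use \<psi>(2) range_upd[OF that] in auto)
  moreover have "qf \<chi>" using bool_comb_qf[OF \<chi>(1)] \<Delta>(2) by blast
  ultimately show ?case using \<chi>(2)[rule_format, OF conjI[OF refl]] by (intro exI[of _ \<chi>]) simp
next
  case (Eq s t)
  then show ?case by (intro exI[of _ "Eq s t"]) simp
next
  case (Less s t)
  then show ?case by (intro exI[of _ "Less s t"]) simp
next
  case (Holds p t)
  then show ?case by (intro exI[of _ "Holds p t"]) simp
qed

end

section \<open>Inp-patterns of depth 3\<close>

lemma ramsey_colours:
  fixes c :: "nat \<Rightarrow> nat \<Rightarrow> 'c"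
  assumes "finite R" "\<And>i j. c i j \<in> R"
  obtains Z t where "infinite Z" "\<And>i j. i \<in> Z \<Longrightarrow> j \<in> Z \<Longrightarrow> i < j \<Longrightarrow> c i j = t"
proof -
  obtain g :: "'c \<Rightarrow> nat" where g: "inj_on g R" "g ` R = {0..<card R}"
    using ex_bij_betw_finite_nat[OF assms(1)] unfolding bij_betw_def by blast
  let ?f = "\<lambda>X. g (c (Min X) (Max X))"
  have "\<exists>Y t. Y \<subseteq> UNIV \<and> infinite Y \<and> t < card R \<and> (\<forall>x\<in>Y. \<forall>y\<in>Y. x \<noteq> y \<longrightarrow> ?f {x, y} = t)"
  proof (rule Ramsey2)
    show "infinite (UNIV :: nat set)" by simp
    have "g (c i j) < card R" for i j using g(2) assms(2)[of i j] by (metis atLeastLessThan_iff imageI)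
    then show "\<forall>x\<in>UNIV. \<forall>y\<in>UNIV. x \<noteq> y \<longrightarrow> ?f {x, y} < card R" by blast
  qed
  then obtain Y t where Y: "infinite Y" "\<forall>x\<in>Y. \<forall>y\<in>Y. x \<noteq> y \<longrightarrow> ?f {x, y} = t" by blast
  have eq: "g (c i j) = t" if "i \<in> Y" "j \<in> Y" "i < j" for i j
  proof -
    have "i \<noteq> j" using that by simp
    then have "?f {i, j} = t" by (rule Y(2)[THEN bspec, OF that(1), THEN bspec, OF that(2), THEN mp])
    then show ?thesis using that by (simp add: min_def max_def)
  qed
  show ?thesis
  proof (rule that[OF Y(1)])
    fix i j assume ij: "i \<in> Y" "j \<in> Y" "i < j"
    have "c i j \<in> {x \<in> R. g x = t}" using eq[OF ij] assms(2) by simp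
    moreover have "x = y" if "x \<in> {x \<in> R. g x = t}" "y \<in> {x \<in> R. g x = t}" for x y
      using that g(1) by (auto dest: inj_onD)
    ultimately show "c i j = (SOME x. x \<in> {x \<in> R. g x = t})" by (metis (no_types, lifting) someI)
  qed
qed

context tmodel
begin

definition convex_in :: "'a set \<Rightarrow> 'a set \<Rightarrow> bool" where
  "convex_in X A \<longleftrightarrow> A \<subseteq> X \<and> (\<forall>x\<in>A. \<forall>y\<in>A. \<forall>z\<in>X. x \<sqsubset> z \<longrightarrow> z \<sqsubset> y \<longrightarrow> z \<in> A)"

text \<open>
  From points \<open>p i j \<in> A i \<inter> A j\<close> take \<open>m i = min\<^sub>j p i j\<close>. The largest of the \<open>m i\<close> lies between \<open>m j\<close> and
  \<open>p i j\<close>, both in \<open>A j\<close>, for each \<open>j\<close>.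
\<close>

lemma helly:
  assumes J: "finite J" "J \<noteq> {}" and X: "X \<subseteq> U" and conv: "\<And>j. j \<in> J \<Longrightarrow> convex_in X (A j)"
    and meet: "\<And>i j. i \<in> J \<Longrightarrow> j \<in> J \<Longrightarrow> A i \<inter> A j \<noteq> {}"
  shows "\<exists>x. \<forall>j\<in>J. x \<in> A j"
proof -
  have AU: "A j \<subseteq> X" "A j \<subseteq> U" if "j \<in> J" for j using conv[OF that] X by (auto simp: convex_in_def)
  have "\<forall>i j. \<exists>x. i \<in> J \<longrightarrow> j \<in> J \<longrightarrow> x \<in> A i \<inter> A j" using meet by blast
  then obtain p where p: "\<And>i j. i \<in> J \<Longrightarrow> j \<in> J \<Longrightarrow> p i j \<in> A i \<inter> A j" by metis
  have "\<exists>x. x \<in> p i ` J \<and> (\<forall>j\<in>J. \<not> p i j \<sqsubset> x)" if "i \<in> J" for i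
    using finite_min[of "p i ` J"] J p[OF that] AU[OF that] by blast
  then obtain m where m: "\<And>i. i \<in> J \<Longrightarrow> m i \<in> p i ` J" "\<And>i j. i \<in> J \<Longrightarrow> j \<in> J \<Longrightarrow> \<not> p i j \<sqsubset> m i" by metis
  have mA: "m i \<in> A i" if "i \<in> J" for i using m(1)[OF that] p[OF that] by auto
  have "\<exists>x\<in>m ` J. \<forall>a\<in>m ` J. \<not> x \<sqsubset> a"
    by (rule finite_max) (use J mA AU(2) in auto)
  then obtain i where i: "i \<in> J" "\<And>j. j \<in> J \<Longrightarrow> \<not> m i \<sqsubset> m j" by auto
  have "m i \<in> A j" if j: "j \<in> J" for j
  proof -
    have in_U: "m i \<in> U" "m j \<in> U" "p i j \<in> U" "m i \<in> X" using mA AU i(1) j p[OF i(1) j] by blast+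
    have "m j \<sqsubset> m i \<or> m j = m i" using i(2)[OF j] less_total in_U by blast
    moreover have "m i \<sqsubset> p i j \<or> m i = p i j" using m(2)[OF i(1) j] less_total in_U by blast
    moreover have "m j \<in> A j" "p i j \<in> A j" using mA j p[OF i(1) j] by auto
    ultimately show ?thesis using conv[OF j] in_U(4) unfolding convex_in_def by metis
  qed
  then show ?thesis by blast
qed

lemma disjoint_convex:
  assumes X: "X \<subseteq> U" and V: "convex_in X V" "convex_in X V'" "V \<inter> V' = {}"
  shows "(\<forall>v\<in>V. \<forall>v'\<in>V'. v \<sqsubset> v') \<or> (\<forall>v\<in>V. \<forall>v'\<in>V'. v' \<sqsubset> v)"
proof (rule ccontr)
  assume "\<not> ?thesis"
  then obtain v1 v1' v v' where v: "v1 \<in> V" "v1' \<in> V'" "\<not> v1 \<sqsubset> v1'" "v \<in> V" "v' \<in> V'" "\<not> v' \<sqsubset> v" by blast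
  have sub: "V \<subseteq> X" "V' \<subseteq> X" using V by (auto simp: convex_in_def)
  have ne: "x \<noteq> y" if "x \<in> V" "y \<in> V'" for x y using that V by blast
  have U: "v1 \<in> U" "v1' \<in> U" "v \<in> U" "v' \<in> U" using v sub X by blast+
  have "v1' \<sqsubset> v1" "v \<sqsubset> v'" using less_total[OF U(1,2)] less_total[OF U(3,4)] v ne by blast+
  moreover have "v1 \<sqsubset> v' \<or> v' \<sqsubset> v1" using less_total[OF U(1,4)] v ne by blast
  ultimately have "v1 \<in> V' \<or> v' \<in> V" using V(1,2) v sub unfolding convex_in_def by blast
  then show False using v V(3) by blast
qed

text \<open>
  Disjoint convex sets are linearly ordered. Call an incidence \<open>(i, j)\<close> final for \<open>i\<close> if \<open>B j\<close> is the last
  set that meets \<open>A i\<close>, and final for \<open>j\<close> if \<open>A i\<close> is the last one that meets \<open>B j\<close>. Each incidence is final in one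
  of the two ways, since otherwise some later \<open>B j'\<close> meets \<open>A i\<close> and some later \<open>A i'\<close> meets \<open>B j\<close>,
  which is impossible.
\<close>

lemma incidences:
  assumes X: "X \<subseteq> U" and fin: "finite J" "finite J'"
    and A: "\<And>j. j \<in> J \<Longrightarrow> convex_in X (A j)" "\<And>i j. i \<in> J \<Longrightarrow> j \<in> J \<Longrightarrow> i \<noteq> j \<Longrightarrow> A i \<inter> A j = {}"
    and B: "\<And>j. j \<in> J' \<Longrightarrow> convex_in X (B j)" "\<And>i j. i \<in> J' \<Longrightarrow> j \<in> J' \<Longrightarrow> i \<noteq> j \<Longrightarrow> B i \<inter> B j = {}"
  shows "card {(i, j). i \<in> J \<and> j \<in> J' \<and> A i \<inter> B j \<noteq> {}} \<le> card J + card J'"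
proof -
  define E where "E = {(i, j). i \<in> J \<and> j \<in> J' \<and> A i \<inter> B j \<noteq> {}}"
  define E1 where "E1 = {(i, j) \<in> E. \<forall>j'. (i, j') \<in> E \<longrightarrow> j' \<noteq> j \<longrightarrow> (\<forall>v\<in>B j'. \<forall>v'\<in>B j. v \<sqsubset> v')}"
  define E2 where "E2 = {(i, j) \<in> E. \<forall>i'. (i', j) \<in> E \<longrightarrow> i' \<noteq> i \<longrightarrow> (\<forall>v\<in>A i'. \<forall>v'\<in>A i. v \<sqsubset> v')}"
  have sub: "j \<in> J \<Longrightarrow> A j \<subseteq> U" "j' \<in> J' \<Longrightarrow> B j' \<subseteq> U" for j j'
    using A(1)[of j] B(1)[of j'] X by (auto simp: convex_in_def)
  have "E \<subseteq> E1 \<union> E2"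
  proof (rule subsetI, rule ccontr)
    fix z assume z: "z \<in> E" "z \<notin> E1 \<union> E2"
    obtain i j where ij: "z = (i, j)" by force
    obtain j' where j': "(i, j') \<in> E" "j' \<noteq> j" "\<not> (\<forall>v\<in>B j'. \<forall>v'\<in>B j. v \<sqsubset> v')" using z ij by (auto simp: E1_def)
    obtain i' where i': "(i', j) \<in> E" "i' \<noteq> i" "\<not> (\<forall>v\<in>A i'. \<forall>v'\<in>A i. v \<sqsubset> v')" using z ij by (auto simp: E2_def)
    have J: "i \<in> J" "i' \<in> J" "j \<in> J'" "j' \<in> J'" using z ij i' j' by (auto simp: E_def)
    have 1: "\<forall>v\<in>B j'. \<forall>v'\<in>B j. v' \<sqsubset> v"
      using disjoint_convex[OF X B(1)[OF J(4)] B(1)[OF J(3)] B(2)[OF J(4,3) j'(2)]] j'(3) by blast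
    have 2: "\<forall>v\<in>A i'. \<forall>v'\<in>A i. v' \<sqsubset> v"
      using disjoint_convex[OF X A(1)[OF J(2)] A(1)[OF J(1)] A(2)[OF J(2,1) i'(2)]] i'(3) by blast
    obtain x y where xy: "x \<in> A i" "x \<in> B j'" "y \<in> A i'" "y \<in> B j" using i' j' by (auto simp: E_def)
    then have "x \<sqsubset> y" "y \<sqsubset> x" using 1 2 by blast+
    moreover have "x \<in> U" "y \<in> U" using xy sub J by blast+
    ultimately show False using less_asym[of x y] by blast
  qed
  moreover have "finite E" unfolding E_def by (rule finite_subset[of _ "J \<times> J'"]) (use fin in auto)
  moreover have fin12: "finite E1" "finite E2" using \<open>finite E\<close> by (auto simp: E1_def E2_def intro: finite_subset)
  moreover have "card E1 \<le> card J"
  proof (rule card_inj_on_le[of fst])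
    show "inj_on fst E1"
    proof (rule inj_onI)
      fix x y assume xy: "x \<in> E1" "y \<in> E1" "fst x = fst y"
      then obtain i j j' where x: "x = (i, j)" and y: "y = (i, j')" by (metis prod.collapse)
      show "x = y"
      proof (rule ccontr)
        assume "x \<noteq> y"
        then have "j \<noteq> j'" using x y by simp
        moreover have E: "(i, j) \<in> E" "(i, j') \<in> E" using xy x y by (auto simp: E1_def)
        ultimately have lt: "\<forall>v\<in>B j'. \<forall>v'\<in>B j. v \<sqsubset> v'" "\<forall>v\<in>B j. \<forall>v'\<in>B j'. v \<sqsubset> v'"
          using xy x y by (auto simp: E1_def)
        obtain a b where ab: "a \<in> B j" "b \<in> B j'" "j \<in> J'" "j' \<in> J'" using E by (auto simp: E_def)
        then have "a \<in> U" "b \<in> U" using sub by blast+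
        moreover have "a \<sqsubset> b" "b \<sqsubset> a" using lt ab(1,2) by blast+
        ultimately show False using less_asym[of a b] by blast
      qed
    qed
  qed (use fin in \<open>auto simp: E1_def E_def\<close>)
  moreover have "card E2 \<le> card J'"
  proof (rule card_inj_on_le[of snd])
    show "inj_on snd E2"
    proof (rule inj_onI)
      fix x y assume xy: "x \<in> E2" "y \<in> E2" "snd x = snd y"
      then obtain i i' j where x: "x = (i, j)" and y: "y = (i', j)" by (metis prod.collapse)
      show "x = y"
      proof (rule ccontr)
        assume "x \<noteq> y"
        then have "i \<noteq> i'" using x y by simp
        moreover have E: "(i, j) \<in> E" "(i', j) \<in> E" using xy x y by (auto simp: E2_def)
        ultimately have lt: "\<forall>v\<in>A i'. \<forall>v'\<in>A i. v \<sqsubset> v'" "\<forall>v\<in>A i. \<forall>v'\<in>A i'. v \<sqsubset> v'"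
          using xy x y by (auto simp: E2_def)
        obtain a b where ab: "a \<in> A i" "b \<in> A i'" "i \<in> J" "i' \<in> J" using E by (auto simp: E_def)
        then have "a \<in> U" "b \<in> U" using sub by blast+
        moreover have "a \<sqsubset> b" "b \<sqsubset> a" using lt ab(1,2) by blast+
        ultimately show False using less_asym[of a b] by blast
      qed
    qed
  qed (use fin in \<open>auto simp: E2_def E_def\<close>)
  ultimately have "card E \<le> card J + card J'"
    using card_mono[of "E1 \<union> E2" E] card_Un_le[of E1 E2] by simp
  then show ?thesis by (simp add: E_def)
qed

definition "ints = {q \<in> U. fl q = q}"

text \<open>
  The coordinate is selected by a Boolean: \<open>True\<close> stands for \<open>q\<close> and \<open>False\<close> for \<open>s\<close>.
\<close>

definition coord :: "nat \<Rightarrow> bool \<Rightarrow> 'a \<Rightarrow> 'a" where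
  "coord N \<tau> x = (if \<tau> then qM N x else sM N x)"

definition coord_range :: "bool \<Rightarrow> 'a set" where
  "coord_range \<tau> = (if \<tau> then ints else U)"

definition qcell where
  "qcell W e L = {q \<in> ints. {w \<in> W. fl (eval_tm M e w) \<sqsubset> q} = fst L}"

definition scell where
  "scell C e L = {s \<in> U. {u \<in> C. s \<sqsubset> eval_tm M e u} = fst (snd L) \<and> {u \<in> C. s = eval_tm M e u} = fst (snd (snd L))}"

lemma convex_qcell: "range e \<subseteq> U \<Longrightarrow> convex_in ints (qcell W e L)"
  unfolding convex_in_def
proof (intro conjI ballI impI)
  assume e: "range e \<subseteq> U"
  show "qcell W e L \<subseteq> ints" by (auto simp: qcell_def)
  fix x y z assume x: "x \<in> qcell W e L" and y: "y \<in> qcell W e L" and z: "z \<in> ints" "x \<sqsubset> z" "z \<sqsubset> y"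
  have U: "x \<in> U" "y \<in> U" "z \<in> U" using x y z by (auto simp: qcell_def ints_def)
  have "fl (eval_tm M e w) \<sqsubset> x \<Longrightarrow> fl (eval_tm M e w) \<sqsubset> z" "fl (eval_tm M e w) \<sqsubset> z \<Longrightarrow> fl (eval_tm M e w) \<sqsubset> y" for w
    using less_trans[OF _ z(2)] less_trans[OF _ z(3)] U wf_eval[OF wf e, of w] by auto
  then have "{w \<in> W. fl (eval_tm M e w) \<sqsubset> z} = fst L" using x y unfolding qcell_def by blast
  then show "z \<in> qcell W e L" using z by (simp add: qcell_def)
qed

lemma convex_scell: "range e \<subseteq> U \<Longrightarrow> convex_in U (scell C e L)"
  unfolding convex_in_def
proof (intro conjI ballI impI)
  assume e: "range e \<subseteq> U"
  show "scell C e L \<subseteq> U" by (auto simp: scell_def)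
  fix x y z assume x: "x \<in> scell C e L" and y: "y \<in> scell C e L" and z: "z \<in> U" "x \<sqsubset> z" "z \<sqsubset> y"
  have U: "x \<in> U" "y \<in> U" using x y by (auto simp: scell_def)
  have eU: "eval_tm M e u \<in> U" for u using wf_eval[OF wf e] .
  have 1: "y \<sqsubset> eval_tm M e u \<Longrightarrow> z \<sqsubset> eval_tm M e u" "z \<sqsubset> eval_tm M e u \<Longrightarrow> x \<sqsubset> eval_tm M e u" for u
    using less_trans[OF z(3), of "eval_tm M e u"] less_trans[OF z(2), of "eval_tm M e u"] U z eU by auto
  have "{u \<in> C. z \<sqsubset> eval_tm M e u} = fst (snd L)" using x y 1 unfolding scell_def by blast
  moreover have "{u \<in> C. z = eval_tm M e u} = {}"
  proof -
    have False if u: "u \<in> C" "z = eval_tm M e u" for u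
    proof -
      have "u \<in> {u \<in> C. x \<sqsubset> eval_tm M e u}" using u z by simp
      then have "y \<sqsubset> eval_tm M e u" using x y unfolding scell_def by blast
      then show False using z(3) u less_asym U z(1) by blast
    qed
    then show ?thesis by blast
  qed
  moreover have "fst (snd (snd L)) = {}"
  proof -
    have "x \<noteq> y" using z less_trans[OF z(2,3)] U less_irrefl by blast
    then have "\<not> (x = eval_tm M e u \<and> y = eval_tm M e u)" for u by metis
    then show ?thesis using x y unfolding scell_def by blast
  qed
  ultimately show "z \<in> scell C e L" using z(1) by (simp add: scell_def)
qed

lemma scell_same_order: "s \<in> scell C e L \<Longrightarrow> s' \<in> scell C e L \<Longrightarrow> same_order C s e s' e"
  unfolding scell_def same_order_def by blast

lemma same_order_scell: "s \<in> scell C e L \<Longrightarrow> s' \<in> U \<Longrightarrow> same_order C s e s' e \<Longrightarrow> s' \<in> scell C e L"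
  unfolding scell_def same_order_def by auto

end

context generic_model
begin

text \<open>
  The truth pattern of the basic conditions at \<open>x\<close>; the first component describes the position of \<open>q\<close>, the
  next two that of \<open>s\<close>, and the last one the conditions on \<open>P\<close>.
\<close>

definition cell_label where
  "cell_label N W C B e x = ({w \<in> W. fl (eval_tm M e w) \<sqsubset> qM N x}, {u \<in> C. sM N x \<sqsubset> eval_tm M e u},
     {u \<in> C. sM N x = eval_tm M e u}, {p \<in> B. fst p \<odot> sM N x \<oplus> eval_tm M e (snd p) \<in> P})"

lemma cell_label_iff:
  "x \<in> U \<Longrightarrow> cell_label N W C B e x = L \<longleftrightarrow> qM N x \<in> qcell W e L \<and> sM N x \<in> scell C e L \<and>
     {p \<in> B. fst p \<odot> sM N x \<oplus> eval_tm M e (snd p) \<in> P} = snd (snd (snd L))"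
  by (cases L) (auto simp: cell_label_def qcell_def scell_def ints_def qM_int)

text \<open>
  The members of the row with index in \<open>Z\<close> are covered by finitely many kinds of cells, and for each kind
  \<open>v\<close> the projections \<open>Fam v j\<close> to one of the coordinates are pairwise disjoint.
\<close>

definition thin_row ::
    "nat \<Rightarrow> (nat \<Rightarrow> nat \<Rightarrow> 'a) \<Rightarrow> LP_pred fm \<Rightarrow> nat set \<Rightarrow>
     ((tm set \<times> tm set \<times> tm set \<times> (rat \<times> tm) set) \<times> bool) set \<Rightarrow>
     ((tm set \<times> tm set \<times> tm set \<times> (rat \<times> tm) set) \<times> bool \<Rightarrow> nat \<Rightarrow> 'a set) \<Rightarrow> bool" where
  "thin_row N h \<psi> Z V Fam \<longleftrightarrow> infinite Z \<and> finite V \<and>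
    (\<forall>v\<in>V. (\<forall>j. convex_in (coord_range (snd v)) (Fam v j)) \<and> (\<forall>i\<in>Z. \<forall>j\<in>Z. i \<noteq> j \<longrightarrow> Fam v i \<inter> Fam v j = {})) \<and>
    (\<forall>j\<in>Z. \<forall>x\<in>U. sat MP ((h j)(0 := x)) \<psi> \<longrightarrow> (\<exists>v\<in>V. coord N (snd v) x \<in> Fam v j))"

text \<open>
  Colour a pair \<open>i < j\<close> by all relevant facts: for which labels the cells of \<open>i\<close> and \<open>j\<close> are disjoint in \<open>q\<close> or
  in \<open>s\<close>, which labels occur in the formula, and which parameters of conditions on \<open>P\<close> coincide. On a
  homogeneous set, consider a label that occurs and whose cells are disjoint in neither coordinate. By
  Helly's theorem \<open>k\<close> of its cells have a common point up to membership in \<open>P\<close>. A conflict about \<open>P\<close>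
  between different members would be an equality of parameters \<open>u(i) = u'(j)\<close> that holds for all
  \<open>i < j\<close> by homogeneity; comparing three indices gives \<open>u(j) = u'(j)\<close>, a conflict inside one nonempty
  cell. So \<open>realise\<close> contradicts the inconsistency of the row.
\<close>

lemma row_separated:
  fixes h :: "nat \<Rightarrow> nat \<Rightarrow> 'a"
  assumes qf: "qf \<psi>" and N: "N > 0" "period 0 N \<psi>" and h: "\<And>j. range (h j) \<subseteq> U"
    and incons: "\<And>J. finite J \<Longrightarrow> card J = k \<Longrightarrow> \<not> (\<exists>x\<in>U. \<forall>j\<in>J. sat MP ((h j)(0 := x)) \<psi>)" and k: "k > 0"
  shows "\<exists>Z V Fam. thin_row N h \<psi> Z V Fam"
proof -
  obtain W T B Y where adm: "admissible 0 W T B Y"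
    and det: "determines (basics (qtm 0 N) (stm 0 N) W T B Y) M P \<psi>"
    using ex_basics[OF N(1) qf N(2), where 'a = 'a] model P_S by blast
  define C where "C = {Zero, Scale (of_nat N) One} \<union> T \<union> lo_tm ` B \<union> hi_tm ` B"
  have fin: "finite W" "finite B" "finite C" using adm by (auto simp: admissible_def C_def)
  have B0: "fst p \<noteq> 0" "0 \<notin> fv_tm (snd p)" if "p \<in> B" for p using adm that by (auto simp: admissible_def)
  have fresh: "w \<in> W \<Longrightarrow> 0 \<notin> fv_tm w" "u \<in> C \<Longrightarrow> 0 \<notin> fv_tm u" "y \<in> Y \<Longrightarrow> 0 \<notin> fv y" for w u y
    using adm B0 by (auto simp: admissible_def C_def lo_tm_def hi_tm_def)
  have ZC: "Zero \<in> C" "Scale (of_nat N) One \<in> C" by (auto simp: C_def)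
  define D where "D j x \<longleftrightarrow> sat MP ((h j)(0 := x)) \<psi>" for j x
  define lb where "lb j x = cell_label N W C B (h j) x" for j x
  have D_lab: "D j y" if "lb j x = lb j y" "D j x" "x \<in> U" "y \<in> U" for j x y
  proof -
    have eq: "{w \<in> W. fl (eval_tm M (h j) w) \<sqsubset> qM N x} = {w \<in> W. fl (eval_tm M (h j) w) \<sqsubset> qM N y}"
      "{u \<in> C. sM N x \<sqsubset> eval_tm M (h j) u} = {u \<in> C. sM N y \<sqsubset> eval_tm M (h j) u}"
      "{u \<in> C. sM N x = eval_tm M (h j) u} = {u \<in> C. sM N y = eval_tm M (h j) u}"
      "{p \<in> B. fst p \<odot> sM N x \<oplus> eval_tm M (h j) (snd p) \<in> P} = {p \<in> B. fst p \<odot> sM N y \<oplus> eval_tm M (h j) (snd p) \<in> P}"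
      using that(1) by (simp_all add: lb_def cell_label_def)
    have "agree (basics (qtm 0 N) (stm 0 N) W T B Y) MP ((h j)(0 := x)) MP ((h j)(0 := y))"
      unfolding agree_basics
    proof (intro conjI ballI)
      fix w assume w: "w \<in> W"
      show "fl (eval_tm M ((h j)(0 := x)) w) \<sqsubset> eval_tm M ((h j)(0 := x)) (qtm 0 N) \<longleftrightarrow>
        fl (eval_tm M ((h j)(0 := y)) w) \<sqsubset> eval_tm M ((h j)(0 := y)) (qtm 0 N)"
        using eq(1) w fresh(1)[OF w] by (auto simp: eval_qtm)
    next
      fix u assume "u \<in> T"
      then have u: "u \<in> C" by (auto simp: C_def)
      show "eval_tm M ((h j)(0 := x)) (stm 0 N) \<sqsubset> eval_tm M ((h j)(0 := x)) u \<longleftrightarrow>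
        eval_tm M ((h j)(0 := y)) (stm 0 N) \<sqsubset> eval_tm M ((h j)(0 := y)) u"
        using eq(2) u fresh(2)[OF u] by (auto simp: eval_stm)
      show "eval_tm M ((h j)(0 := x)) (stm 0 N) = eval_tm M ((h j)(0 := x)) u \<longleftrightarrow>
        eval_tm M ((h j)(0 := y)) (stm 0 N) = eval_tm M ((h j)(0 := y)) u"
        using eq(3) u fresh(2)[OF u] by (auto simp: eval_stm)
    next
      fix p assume p: "p \<in> B"
      show "case p of (\<beta>, u) \<Rightarrow> \<beta> \<odot> eval_tm M ((h j)(0 := x)) (stm 0 N) \<oplus> eval_tm M ((h j)(0 := x)) u \<in> P \<longleftrightarrow>
        \<beta> \<odot> eval_tm M ((h j)(0 := y)) (stm 0 N) \<oplus> eval_tm M ((h j)(0 := y)) u \<in> P"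
        using eq(4) p B0(2)[OF p] by (auto simp: split_beta eval_stm)
    next
      fix y' assume y: "y' \<in> Y"
      show "sat MP ((h j)(0 := x)) y' \<longleftrightarrow> sat MP ((h j)(0 := y)) y'"
        using fresh(3)[OF y] by (simp add: sat_upd)
    qed
    then show ?thesis
      using det that range_upd[OF h] unfolding determines_def D_def by blast
  qed
  define Lab where "Lab = Pow W \<times> Pow C \<times> Pow C \<times> Pow B"
  have finL: "finite Lab" using fin by (simp add: Lab_def)
  have lbL: "lb j x \<in> Lab" for j x by (auto simp: lb_def cell_label_def Lab_def)
  define A where "A L j = qcell W (h j) L" for L :: "tm set \<times> tm set \<times> tm set \<times> (rat \<times> tm) set" and j
  define S where "S L j = scell C (h j) L" for L :: "tm set \<times> tm set \<times> tm set \<times> (rat \<times> tm) set" and j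
  define c where "c i j = ({L \<in> Lab. A L i \<inter> A L j = {}}, {L \<in> Lab. S L i \<inter> S L j = {}},
    {(p, p') \<in> B \<times> B. eval_tm M (h i) (snd p) = eval_tm M (h j) (snd p')},
    {L \<in> Lab. \<exists>x\<in>U. lb i x = L \<and> D i x})" for i j
  have "finite (Pow Lab \<times> Pow Lab \<times> Pow (B \<times> B) \<times> Pow Lab)" using finL fin by simp
  moreover have "c i j \<in> Pow Lab \<times> Pow Lab \<times> Pow (B \<times> B) \<times> Pow Lab" for i j by (auto simp: c_def)
  ultimately obtain Z t where Z: "infinite Z" "\<And>i j. i \<in> Z \<Longrightarrow> j \<in> Z \<Longrightarrow> i < j \<Longrightarrow> c i j = t"
    by (rule ramsey_colours[of _ c]) (rule that)
  obtain tA tS tB tE where t: "t = (tA, tS, tB, tE)" by (rule prod_cases4[of t])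
  have col: "{L \<in> Lab. A L i \<inter> A L j = {}} = tA" "{L \<in> Lab. S L i \<inter> S L j = {}} = tS"
    "{(p, p') \<in> B \<times> B. eval_tm M (h i) (snd p) = eval_tm M (h j) (snd p')} = tB"
    "{L \<in> Lab. \<exists>x\<in>U. lb i x = L \<and> D i x} = tE" if "i \<in> Z" "j \<in> Z" "i < j" for i j
    using Z(2)[OF that] unfolding c_def t prod.inject by blast+
  have bigger: "\<exists>j\<in>Z. i < j" for i using Z(1) unfolding infinite_nat_iff_unbounded by blast
  have E_iff: "(\<exists>x\<in>U. lb i x = L \<and> D i x) \<longleftrightarrow> L \<in> tE" if "i \<in> Z" "L \<in> Lab" for i L
  proof -
    obtain j where "j \<in> Z" "i < j" using bigger by blast
    then show ?thesis using col(4)[OF that(1), of j] that(2) by auto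
  qed
  have key: "L \<in> tA \<or> L \<in> tS" if L: "L \<in> tE" "L \<in> Lab" for L
  proof (rule ccontr)
    assume neg: "\<not> (L \<in> tA \<or> L \<in> tS)"
    obtain J where J: "J \<subseteq> Z" "finite J" "card J = k" using infinite_arbitrarily_large[OF Z(1)] by blast
    have Jne: "J \<noteq> {}" using J(3) k by auto
    have "\<forall>j. \<exists>x. j \<in> Z \<longrightarrow> x \<in> U \<and> lb j x = L \<and> D j x" using E_iff[OF _ L(2)] L(1) by blast
    then obtain x where x: "\<And>j. j \<in> Z \<Longrightarrow> x j \<in> U \<and> lb j (x j) = L \<and> D j (x j)" by metis
    have xc: "qM N (x j) \<in> A L j" "sM N (x j) \<in> S L j"
      "{p \<in> B. fst p \<odot> sM N (x j) \<oplus> eval_tm M (h j) (snd p) \<in> P} = snd (snd (snd L))" if "j \<in> Z" for j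
    proof -
      have "x j \<in> U" "cell_label N W C B (h j) (x j) = L" using x[OF that] by (auto simp: lb_def)
      then show "qM N (x j) \<in> A L j" "sM N (x j) \<in> S L j"
        "{p \<in> B. fst p \<odot> sM N (x j) \<oplus> eval_tm M (h j) (snd p) \<in> P} = snd (snd (snd L))"
        unfolding A_def S_def using cell_label_iff by blast+
    qed
    have meet: "A L i \<inter> A L j \<noteq> {} \<and> S L i \<inter> S L j \<noteq> {}" if "i \<in> Z" "j \<in> Z" for i j
    proof -
      have lt: "A L i \<inter> A L j \<noteq> {} \<and> S L i \<inter> S L j \<noteq> {}" if "i \<in> Z" "j \<in> Z" "i < j" for i j
        using col(1,2)[OF that] neg L(2) by blast
      consider "i < j" | "j < i" | "i = j" by linarith
      then show ?thesis
      proof cases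
        case 1 then show ?thesis using lt that by blast
      next
        case 2 then show ?thesis using lt[OF that(2,1)] by blast
      next
        case 3 then show ?thesis using xc[OF that(1)] by blast
      qed
    qed
    have "\<exists>q. \<forall>j\<in>J. q \<in> A L j"
    proof (rule helly[where X = ints])
      show "ints \<subseteq> U" by (auto simp: ints_def)
      show "convex_in ints (A L j)" if "j \<in> J" for j unfolding A_def by (rule convex_qcell[OF h])
      show "A L i \<inter> A L j \<noteq> {}" if "i \<in> J" "j \<in> J" for i j using meet[of i j] that J(1) by blast
    qed (use J Jne in auto)
    then obtain q where q: "\<forall>j\<in>J. q \<in> A L j" by blast
    have "\<exists>s. \<forall>j\<in>J. s \<in> S L j"
    proof (rule helly[where X = U])
      show "convex_in U (S L j)" if "j \<in> J" for j unfolding S_def by (rule convex_scell[OF h])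
      show "S L i \<inter> S L j \<noteq> {}" if "i \<in> J" "j \<in> J" for i j using meet[of i j] that J(1) by blast
    qed (use J Jne in auto)
    then obtain s where s: "\<forall>j\<in>J. s \<in> S L j" by blast
    obtain j0 where j0: "j0 \<in> J" using Jne by blast
    have j0Z: "j0 \<in> Z" using j0 J(1) by blast
    have qU: "q \<in> U" "fl q = q" using q j0 by (auto simp: A_def qcell_def ints_def)
    have sU: "s \<in> U" using s j0 by (auto simp: S_def scell_def)
    have so: "same_order C (sM N (x j)) (h j) s (h j)" if "j \<in> J" for j
      using scell_same_order xc(2) s that J(1) unfolding S_def by blast
    let ?ps = "snd (snd (snd L))"
    have ps: "p \<in> ?ps \<longleftrightarrow> fst p \<odot> sM N (x j) \<oplus> eval_tm M (h j) (snd p) \<in> P" if "p \<in> B" "j \<in> Z" for p j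
      using xc(3)[OF that(2)] that(1) by auto
    have psB: "?ps \<subseteq> B" using L(2) by (auto simp: Lab_def)
    have xb: "\<not> sM N (x j) \<sqsubset> zero" "sM N (x j) \<sqsubset> of_nat N \<odot> one" if "j \<in> Z" for j
      using sM_bounds[OF N(1)] x[OF that] by blast+
    have "\<exists>s'\<in>U. \<forall>j\<in>J. same_order C s (h j) s' (h j) \<and>
      (\<forall>p\<in>B. fst p \<odot> s' \<oplus> eval_tm M (h j) (snd p) \<in> P \<longleftrightarrow> p \<in> ?ps)"
    proof (cases "fst (snd (snd L)) = {}")
      case False
      then obtain u where u: "u \<in> fst (snd (snd L))" by blast
      have "s = sM N (x j)" if "j \<in> J" for j
      proof -
        have "s \<in> scell C (h j) L" "sM N (x j) \<in> scell C (h j) L" using s xc(2) that J(1) unfolding S_def by blast+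
        then have "s = eval_tm M (h j) u" "sM N (x j) = eval_tm M (h j) u" using u unfolding scell_def by blast+
        then show ?thesis by simp
      qed
      then show ?thesis using ps J(1) sU by (intro bexI[of _ s]) (auto simp: same_order_def)
    next
      case True
      have ne: "s \<noteq> eval_tm M (h j) u" if "j \<in> J" "u \<in> C" for j u
        using s that True unfolding S_def scell_def by blast
      show ?thesis
      proof (rule realise[where pos = "\<lambda>_. ?ps" and c = "Scale (of_nat N) One"])
        have "\<not> s \<sqsubset> eval_tm M (h j0) Zero" using so[OF j0, unfolded same_order_def, THEN bspec, OF ZC(1)] xb(1)[OF j0Z] by simp
        then show "zero \<sqsubset> s" using less_total[OF closed(1) sU] ne[OF j0 ZC(1)] by auto
        show "s \<sqsubset> eval_tm M (h j) (Scale (of_nat N) One)" if "j \<in> J" for j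
          using so[OF that, unfolded same_order_def, THEN bspec, OF ZC(2)] xb(2)[of j] that J(1) by auto
        show "p \<in> B \<and> fst p \<odot> s \<oplus> eval_tm M (h j) (snd p) \<in> predI M S_L" if "j \<in> J" "p \<in> ?ps" for j p
        proof -
          have p: "p \<in> B" and j: "j \<in> Z" using that psB J(1) by auto
          have "fst p \<odot> sM N (x j) \<oplus> eval_tm M (h j) (snd p) \<in> predI M S_L" using ps[OF p j] that(2) P_S by blast
          moreover have "lo_tm p \<in> C" "hi_tm p \<in> C" using p by (auto simp: C_def)
          moreover have "sM N (x j) \<in> U" using x[OF j] by simp
          ultimately show ?thesis using same_order_S[OF so[OF that(1)] _ _ B0(1)[OF p] _ sU h h] p by blast
        qed
        show "eval_tm M (h i) (snd p) \<noteq> eval_tm M (h j) (snd p')"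
          if ij: "i \<in> J" "j \<in> J" and p: "p \<in> ?ps" "p' \<in> B - ?ps" "fst p = fst p'" for i j p p'
        proof
          assume eq: "eval_tm M (h i) (snd p) = eval_tm M (h j) (snd p')"
          have pB: "p \<in> B" "p' \<in> B" using p psB by auto
          have no: "eval_tm M (h j) (snd p) \<noteq> eval_tm M (h j) (snd p')" if "j \<in> Z" for j
            using ps[OF pB(1) that] ps[OF pB(2) that] p by auto
          obtain j1 j2 j3 where j123: "j1 \<in> Z" "j2 \<in> Z" "j3 \<in> Z" "j1 < j2" "j2 < j3" using bigger Z(1) by (metis ex_in_conv finite.emptyI)
          have tB: "(r, r') \<in> tB \<longleftrightarrow> eval_tm M (h i) (snd r) = eval_tm M (h j) (snd r')"
            if "i \<in> Z" "j \<in> Z" "i < j" "r \<in> B" "r' \<in> B" for i j r r'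
            using col(3)[OF that(1-3)] that(4,5) by auto
          have j13: "j1 < j3" using j123 by simp
          consider "i < j" | "j < i" | "i = j" by linarith
          then show False
          proof cases
            case 1
            then have "(p, p') \<in> tB" using tB[of i j p p'] eq pB ij J(1) by blast
            then have "eval_tm M (h j1) (snd p) = eval_tm M (h j2) (snd p')" "eval_tm M (h j1) (snd p) = eval_tm M (h j3) (snd p')"
              "eval_tm M (h j2) (snd p) = eval_tm M (h j3) (snd p')"
              using tB[OF j123(1,2,4) pB] tB[OF j123(1,3) j13 pB] tB[OF j123(2,3,5) pB] by blast+
            then show False using no[OF j123(2)] by simp
          next
            case 2
            then have "(p', p) \<in> tB" using tB[of j i p' p] eq pB ij J(1) by auto
            then have "eval_tm M (h j1) (snd p') = eval_tm M (h j2) (snd p)" "eval_tm M (h j1) (snd p') = eval_tm M (h j3) (snd p)"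
              "eval_tm M (h j2) (snd p') = eval_tm M (h j3) (snd p)"
              using tB[OF j123(1,2,4) pB(2,1)] tB[OF j123(1,3) j13 pB(2,1)] tB[OF j123(2,3,5) pB(2,1)] by blast+
            then show False using no[OF j123(2)] by simp
          next
            case 3
            then show False using no[of j] eq ij J(1) by blast
          qed
        qed
        show "lo_tm ` B \<union> hi_tm ` B \<subseteq> C" by (auto simp: C_def)
      qed (use J Jne h fin B0 ZC sU ne in auto)
    qed
    then obtain s' where s': "s' \<in> U" "\<And>j. j \<in> J \<Longrightarrow> same_order C s (h j) s' (h j)"
      "\<And>j p. j \<in> J \<Longrightarrow> p \<in> B \<Longrightarrow> fst p \<odot> s' \<oplus> eval_tm M (h j) (snd p) \<in> P \<longleftrightarrow> p \<in> ?ps" by blast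
    have "\<not> s' \<sqsubset> eval_tm M (h j0) Zero" "s' \<sqsubset> eval_tm M (h j0) (Scale (of_nat N) One)"
      using so[OF j0, unfolded same_order_def, THEN bspec, OF ZC(1)] so[OF j0, unfolded same_order_def, THEN bspec, OF ZC(2)]
        s'(2)[OF j0, unfolded same_order_def, THEN bspec, OF ZC(1)] s'(2)[OF j0, unfolded same_order_def, THEN bspec, OF ZC(2)]
        xb[OF j0Z] by auto
    then have s'b: "\<not> s' \<sqsubset> zero" "s' \<sqsubset> of_nat N \<odot> one" by simp_all
    let ?y = "of_nat N \<odot> q \<oplus> s'"
    have y: "?y \<in> U" "qM N ?y = q" "sM N ?y = s'" using qM_sM_build[OF N(1) qU(1) s'(1) qU(2) s'b] qU s'(1) by auto
    have "D j ?y" if j: "j \<in> J" for j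
    proof -
      have jZ: "j \<in> Z" using j J(1) by blast
      have "qM N ?y \<in> qcell W (h j) L" using q j y(2) by (simp add: A_def)
      moreover have "sM N ?y \<in> scell C (h j) L"
        unfolding y(3) by (rule same_order_scell[OF _ s'(1) s'(2)[OF j]]) (use s j in \<open>auto simp: S_def\<close>)
      moreover have "{p \<in> B. fst p \<odot> sM N ?y \<oplus> eval_tm M (h j) (snd p) \<in> P} = ?ps"
        using s'(3)[OF j] y(3) psB by auto
      ultimately have "lb j ?y = L" unfolding lb_def using cell_label_iff[OF y(1)] by blast
      then show ?thesis using D_lab[of j "x j" ?y] x[OF jZ] y(1) by simp
    qed
    then show False using incons[OF J(2,3)] y(1) unfolding D_def by blast
  qed
  define V where "V = (tA \<inter> Lab) \<times> {True} \<union> (tS \<inter> Lab) \<times> {False}"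
  define Fam where "Fam v j = (if snd v then A (fst v) j else S (fst v) j)"
    for v :: "(tm set \<times> tm set \<times> tm set \<times> (rat \<times> tm) set) \<times> bool" and j
  have "finite V" using finL by (simp add: V_def)
  moreover have "convex_in (coord_range (snd v)) (Fam v j)" for v j
    using convex_qcell[OF h, of W j "fst v"] convex_scell[OF h, of C j "fst v"]
    by (cases "snd v") (simp_all add: coord_range_def Fam_def A_def S_def)
  moreover have "Fam v i \<inter> Fam v j = {}" if v: "v \<in> V" and ij: "i \<in> Z" "j \<in> Z" "i \<noteq> j" for v i j
  proof -
    have lt: "Fam v i \<inter> Fam v j = {}" if ij: "i \<in> Z" "j \<in> Z" "i < j" for i j
      using v col(1,2)[OF ij] by (auto simp: V_def Fam_def)
    show ?thesis
    proof (cases "i < j")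
      case True then show ?thesis using lt ij by blast
    next
      case False
      then have "j < i" using ij(3) by simp
      then show ?thesis using lt[OF ij(2,1)] by blast
    qed
  qed
  moreover have "\<exists>v\<in>V. coord N (snd v) x \<in> Fam v j" if j: "j \<in> Z" and x: "x \<in> U" "D j x" for j x
  proof -
    have L: "lb j x \<in> tE" "lb j x \<in> Lab" using E_iff[OF j lbL] x lbL by blast+
    have cells: "qM N x \<in> A (lb j x) j" "sM N x \<in> S (lb j x) j"
      using cell_label_iff[OF x(1), of N W C B "h j" "lb j x"] by (auto simp: lb_def A_def S_def)
    from key[OF L] show ?thesis
    proof
      assume "lb j x \<in> tA"
      then show ?thesis using cells L by (intro bexI[of _ "(lb j x, True)"]) (auto simp: V_def Fam_def coord_def)
    next
      assume "lb j x \<in> tS"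
      then show ?thesis using cells L by (intro bexI[of _ "(lb j x, False)"]) (auto simp: V_def Fam_def coord_def)
    qed
  qed
  ultimately show ?thesis using Z(1) unfolding D_def thin_row_def by (intro exI[of _ Z] exI[of _ V] exI[of _ Fam]) blast
qed


text \<open>
  After quantifier elimination the parameters of the different formulas can be given disjoint variables
  by substitution, and the existence of a common solution becomes one formula.
\<close>

lemma consistent_realised:
  fixes I :: "nat set"
  assumes cons: "consistent MP ((\<lambda>i. (\<phi> i, a i)) ` I)" and I: "finite I"
    and fv: "\<And>i. i \<in> I \<Longrightarrow> fv (\<phi> i) \<subseteq> {..length (a i)}" and a: "\<And>i. i \<in> I \<Longrightarrow> set (a i) \<subseteq> U"
  shows "\<exists>x\<in>U. \<forall>i\<in>I. sat_at MP (x # a i) (\<phi> i)"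
proof -
  obtain N f b where f: "elementary_embedding MP N f" and b: "b \<in> univ N"
    and sat: "\<And>i. i \<in> I \<Longrightarrow> sat_at N (b # map f (a i)) (\<phi> i)"
    using cons by (auto simp: consistent_def)
  have "\<forall>i. \<exists>\<psi>. qf \<psi> \<and> (\<forall>e. range e \<subseteq> U \<longrightarrow> (sat MP e (\<phi> i) \<longleftrightarrow> sat MP e \<psi>))"
    using quantifier_elimination by blast
  then obtain \<psi> where \<psi>: "\<And>i. qf (\<psi> i)" "\<And>i e. range e \<subseteq> U \<Longrightarrow> sat MP e (\<phi> i) \<longleftrightarrow> sat MP e (\<psi> i)" by metis
  have \<psi>N: "sat N e (\<phi> i) \<longleftrightarrow> sat N e (\<psi> i)" if "range e \<subseteq> univ N" for i e
  proof -
    have "sat N e (Iff (\<phi> i) (\<psi> i))"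
      by (rule elem_valid[OF f wf_MP _ that]) (use \<psi>(2) in simp)
    then show ?thesis by simp
  qed
  define e where "e i = pad zero (zero # (if i \<in> I then a i else []))" for i
  have eU: "range (e i) \<subseteq> U" for i unfolding e_def by (rule range_pad) (use a in auto)
  \<comment> \<open>Variable \<open>0\<close> is kept for the solution; variable \<open>Suc (prod_encode (i, k))\<close> plays the role of
     variable \<open>k\<close> in the formula with index \<open>i\<close>.\<close>
  define E where "E n = (case n of 0 \<Rightarrow> zero | Suc c \<Rightarrow> e (fst (prod_decode c)) (snd (prod_decode c)))" for n
  have EU: "range E \<subseteq> U"
  proof -
    have "E n \<in> U" for n using eU by (cases n) (auto simp: E_def)
    then show ?thesis by blast
  qed
  define \<sigma> where "\<sigma> i k = (if k = 0 then Var 0 else Var (Suc (prod_encode (i, k))))" for i k :: nat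
  obtain il where il: "set il = I" using I by (rule finite_list[THEN exE])
  let ?\<Theta> = "Conjs (map (\<lambda>i. fsub (\<sigma> i) (\<psi> i)) il)"
  have \<Theta>: "sat K (g(0 := c)) ?\<Theta> \<longleftrightarrow> (\<forall>i\<in>I. sat K (\<lambda>k. if k = 0 then c else g (Suc (prod_encode (i, k)))) (\<psi> i))"
    for K :: "(LP_pred, 'a) struct" and g c
  proof -
    have "sat K (g(0 := c)) (fsub (\<sigma> i) (\<psi> i)) \<longleftrightarrow> sat K (\<lambda>k. if k = 0 then c else g (Suc (prod_encode (i, k)))) (\<psi> i)" for i
      unfolding sat_fsub[OF \<psi>(1)] by (rule sat_cong) (simp add: \<sigma>_def)
    then show ?thesis unfolding sat_Conjs set_map ball_simps(9) il by simp
  qed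
  have "sat N ((f \<circ> E)(0 := b)) ?\<Theta>"
    unfolding \<Theta>
  proof
    fix i assume i: "i \<in> I"
    let ?e = "\<lambda>k. if k = 0 then b else (f \<circ> E) (Suc (prod_encode (i, k)))"
    have "f ` U \<subseteq> univ N" using f by (simp add: elementary_embedding_def)
    then have "range ?e \<subseteq> univ N" using b EU by auto
    moreover have "sat_at N (b # map f (a i)) (\<phi> i) \<longleftrightarrow> sat N ?e (\<phi> i)"
      unfolding sat_at_def
    proof (rule sat_cong)
      fix k assume "k \<in> fv (\<phi> i)"
      then have "k \<le> length (a i)" using fv[OF i] by auto
      then show "(b # map f (a i)) ! k = ?e k" using i by (cases k) (auto simp: E_def e_def pad_def)
    qed
    ultimately show "sat N ?e (\<psi> i)" using sat[OF i] \<psi>N by blast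
  qed
  then have "sat N (f \<circ> E) (Ex 0 ?\<Theta>)" using b by auto
  moreover have "range E \<subseteq> univ MP" using EU by simp
  ultimately have "sat MP E (Ex 0 ?\<Theta>)" by (simp only: elementary_sat[OF f])
  then obtain x where x: "x \<in> U" "sat MP (E(0 := x)) ?\<Theta>" unfolding sat.simps(6) by auto
  have "sat_at MP (x # a i) (\<phi> i)" if i: "i \<in> I" for i
  proof -
    let ?e = "\<lambda>k. if k = 0 then x else E (Suc (prod_encode (i, k)))"
    have "sat MP ?e (\<psi> i)" using x(2) i unfolding \<Theta> by blast
    moreover have "range ?e \<subseteq> U" using x(1) EU by auto
    ultimately have "sat MP ?e (\<phi> i)" using \<psi>(2) by blast
    moreover have "sat_at MP (x # a i) (\<phi> i) \<longleftrightarrow> sat MP ?e (\<phi> i)"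
      unfolding sat_at_def
    proof (rule sat_cong)
      fix k assume "k \<in> fv (\<phi> i)"
      then have "k \<le> length (a i)" using fv[OF i] by auto
      then show "(x # a i) ! k = ?e k" using i by (cases k) (auto simp: E_def e_def pad_def)
    qed
    ultimately show ?thesis by blast
  qed
  then show ?thesis using x(1) by blast
qed

lemma realised_consistent:
  assumes "x \<in> U" "\<And>\<phi> as. (\<phi>, as) \<in> \<Phi> \<Longrightarrow> sat_at MP (x # as) \<phi>"
  shows "consistent MP \<Phi>"
proof -
  have "elementary_embedding MP MP id" using wf_MP by (simp add: elementary_embedding_def)
  then show ?thesis
    unfolding consistent_def using assms by (intro exI[of _ MP] exI[of _ id]) auto
qed

lemma coord_range_U: "coord_range \<tau> \<subseteq> U"
  by (auto simp: coord_range_def ints_def)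

text \<open>
  The modulus \<open>N\<close> has to be the same in all three rows, since remainders for different moduli could not
  be compared. A path is bad for two rows and kinds of cells of the same coordinate if the corresponding
  convex sets meet; all paths are bad, and \<open>incidences\<close> bounds the bad ones.
\<close>

theorem no_inp_pattern: "\<not> inp_pattern MP 3 \<phi> k a"
proof
  assume inp: "inp_pattern MP 3 \<phi> k a"
  have row_i: "k i > 0" "\<exists>l. fv (\<phi> i) \<subseteq> {..l} \<and> (\<forall>j. length (a i j) = l \<and> set (a i j) \<subseteq> U)"
    "k_inconsistent MP (k i) (\<lambda>j. (\<phi> i, a i j))" if "i < 3" for i
    using inp that by (auto simp: inp_pattern_def)
  have fv: "fv (\<phi> i) \<subseteq> {..length (a i j)}" and aU: "set (a i j) \<subseteq> U" if "i < 3" for i j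
    using row_i(2)[OF that] by auto
  have "\<forall>i. \<exists>\<psi>. qf \<psi> \<and> (\<forall>e. range e \<subseteq> U \<longrightarrow> (sat MP e (\<phi> i) \<longleftrightarrow> sat MP e \<psi>))"
    using quantifier_elimination by blast
  then obtain \<psi> where \<psi>: "\<And>i. qf (\<psi> i)" "\<And>i e. range e \<subseteq> U \<Longrightarrow> sat MP e (\<phi> i) \<longleftrightarrow> sat MP e (\<psi> i)" by metis
  have "\<forall>i. \<exists>N>0. period 0 N (\<psi> i)" using ex_period \<psi>(1) by blast
  then obtain n where n: "\<And>i. n i > 0" "\<And>i. period 0 (n i) (\<psi> i)" by metis
  define N where "N = (\<Prod>i<3. n i)"
  have N: "N > 0" "\<And>i. i < 3 \<Longrightarrow> period 0 N (\<psi> i)"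
  proof -
    show "N > 0" using n(1) by (auto simp: N_def intro: prod_pos)
    show "i < 3 \<Longrightarrow> period 0 N (\<psi> i)" for i
      by (rule period_dvd[OF n(2)]) (simp add: N_def dvd_prodI)
  qed
  define h where "h i j = pad zero (zero # a i j)" for i j
  have hU: "range (h i j) \<subseteq> U" if "i < 3" for i j
    unfolding h_def by (rule range_pad) (use aU[OF that] in auto)
  have sat_h: "sat_at MP (x # a i j) (\<phi> i) \<longleftrightarrow> sat MP ((h i j)(0 := x)) (\<psi> i)" if "i < 3" "x \<in> U" for i j x
  proof -
    have "sat_at MP (x # a i j) (\<phi> i) \<longleftrightarrow> sat MP ((h i j)(0 := x)) (\<phi> i)"
      unfolding sat_at_def
    proof (rule sat_cong)
      fix k assume "k \<in> fv (\<phi> i)"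
      then have "k \<le> length (a i j)" using fv[OF that(1)] by blast
      then show "(x # a i j) ! k = ((h i j)(0 := x)) k" by (cases k) (auto simp: h_def pad_def)
    qed
    then show ?thesis using \<psi>(2) range_upd[OF hU[OF that(1)] that(2)] by blast
  qed
  have "\<exists>Z V Fam. thin_row N (h i) (\<psi> i) Z V Fam" if i: "i < 3" for i
  proof (rule row_separated[OF \<psi>(1) N(1) N(2)[OF i] hU[OF i] _ row_i(1)[OF i]])
    fix J :: "nat set" assume J: "finite J" "card J = k i"
    show "\<not> (\<exists>x\<in>U. \<forall>j\<in>J. sat MP ((h i j)(0 := x)) (\<psi> i))"
    proof
      assume "\<exists>x\<in>U. \<forall>j\<in>J. sat MP ((h i j)(0 := x)) (\<psi> i)"
      then obtain x where "x \<in> U" "\<forall>j\<in>J. sat_at MP (x # a i j) (\<phi> i)" using sat_h[OF i] by blast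
      then have "consistent MP ((\<lambda>j. (\<phi> i, a i j)) ` J)" by (intro realised_consistent) auto
      then show False using row_i(3)[OF i] J unfolding k_inconsistent_def by blast
    qed
  qed
  then obtain Z V Fam where Fam: "\<And>i. i < 3 \<Longrightarrow> thin_row N (h i) (\<psi> i) (Z i) (V i) (Fam i)" by metis
  have Z: "infinite (Z i)" and V: "finite (V i)" and conv: "\<And>v j. v \<in> V i \<Longrightarrow> convex_in (coord_range (snd v)) (Fam i v j)"
    and disj: "\<And>v j j'. v \<in> V i \<Longrightarrow> j \<in> Z i \<Longrightarrow> j' \<in> Z i \<Longrightarrow> j \<noteq> j' \<Longrightarrow> Fam i v j \<inter> Fam i v j' = {}"
    and cover: "\<And>j x. j \<in> Z i \<Longrightarrow> x \<in> U \<Longrightarrow> sat MP ((h i j)(0 := x)) (\<psi> i) \<Longrightarrow> \<exists>v\<in>V i. coord N (snd v) x \<in> Fam i v j"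
    if "i < 3" for i
    using Fam[OF that] unfolding thin_row_def by blast+
  define Ix where "Ix = {(i, i', v, v'). i < i' \<and> i' < (3::nat) \<and> v \<in> V i \<and> v' \<in> V i' \<and> snd v = snd v'}"
  have finIx: "finite Ix"
  proof (rule finite_subset)
    show "Ix \<subseteq> {..<3} \<times> {..<3} \<times> (\<Union>i<3. V i) \<times> (\<Union>i<3. V i)"
    proof
      fix t assume "t \<in> Ix"
      then obtain i i' v v' where t: "t = (i, i', v, v')" "i < i'" "i' < 3" "v \<in> V i" "v' \<in> V i'" by (auto simp: Ix_def)
      then have "i \<in> {..<3}" "i' \<in> {..<3}" by simp_all
      then show "t \<in> {..<3} \<times> {..<3} \<times> (\<Union>i<3. V i) \<times> (\<Union>i<3. V i)" using t by blast
    qed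
    show "finite ({..<3::nat} \<times> {..<3::nat} \<times> (\<Union>i<3. V i) \<times> (\<Union>i<3. V i))" using V by auto
  qed
  \<comment> \<open>At most \<open>card Ix * 2 m\<^sup>2\<close> paths are bad, so this \<open>m\<close> is large enough.\<close>
  define m where "m = 2 * card Ix + 1"
  have "\<forall>i. \<exists>J. i < 3 \<longrightarrow> J \<subseteq> Z i \<and> finite J \<and> card J = m" using infinite_arbitrarily_large[OF Z] by blast
  then obtain J where J: "\<And>i. i < 3 \<Longrightarrow> J i \<subseteq> Z i" "\<And>i. i < 3 \<Longrightarrow> finite (J i)" "\<And>i. i < 3 \<Longrightarrow> card (J i) = m" by metis
  define paths where "paths = (\<Pi>\<^sub>E i\<in>{..<3}. J i)"
  define bad where "bad = (\<lambda>(i, i', v, v'). {p \<in> paths. Fam i v (p i) \<inter> Fam i' v' (p i') \<noteq> {}})"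
  have card_paths: "card paths = m ^ 3" using J by (simp add: paths_def card_PiE)
  have "paths \<subseteq> (\<Union>t\<in>Ix. bad t)"
  proof
    fix p assume p: "p \<in> paths"
    have pJ: "p i \<in> J i" if "i < 3" for i using p that by (auto simp: paths_def)
    have "consistent MP ((\<lambda>i. (\<phi> i, a i (p i))) ` {..<3})" using inp by (simp add: inp_pattern_def)
    then obtain x where x: "x \<in> U" "\<forall>i\<in>{..<3}. sat_at MP (x # a i (p i)) (\<phi> i)"
      using consistent_realised[of \<phi> "\<lambda>i. a i (p i)" "{..<3}"] fv aU by auto
    have "\<exists>v\<in>V i. coord N (snd v) x \<in> Fam i v (p i)" if "i < 3" for i
      using cover[OF that _ x(1), of "p i"] x(2) sat_h[OF that x(1)] J(1)[OF that] pJ[OF that] that by auto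
    then obtain v where v: "\<And>i. i < 3 \<Longrightarrow> v i \<in> V i \<and> coord N (snd (v i)) x \<in> Fam i (v i) (p i)" by metis
    have "\<exists>i i'. i < i' \<and> i' < 3 \<and> snd (v i) = snd (v i')"
    proof -
      have "snd (v 0) = snd (v 1) \<or> snd (v 0) = snd (v 2) \<or> snd (v 1) = snd (v 2)" by auto
      moreover have "(0::nat) < 1" "(1::nat) < 3" "(0::nat) < 2" "(2::nat) < 3" "(1::nat) < 2" by simp_all
      ultimately show ?thesis by blast
    qed
    then obtain i i' where i: "i < i'" "i' < 3" "snd (v i) = snd (v i')" by blast
    then have "(i, i', v i, v i') \<in> Ix" using v[of i] v[of i'] by (simp add: Ix_def)
    moreover have "p \<in> bad (i, i', v i, v i')" using v[of i] v[of i'] i p by (auto simp: bad_def)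
    ultimately show "p \<in> (\<Union>t\<in>Ix. bad t)" by blast
  qed
  moreover have "finite paths" using J by (auto simp: paths_def intro: finite_PiE)
  then have finbad: "finite (bad t)" for t by (auto simp: bad_def split: prod.splits)
  ultimately have "card paths \<le> card (\<Union>t\<in>Ix. bad t)" using finIx by (intro card_mono) auto
  also have "\<dots> \<le> (\<Sum>t\<in>Ix. card (bad t))" by (rule card_UN_le[OF finIx])
  also have "\<dots> \<le> (\<Sum>t\<in>Ix. (m + m) * m)"
  proof (rule sum_mono)
    fix t assume "t \<in> Ix"
    then obtain i i' v v' where t: "t = (i, i', v, v')" and i: "i < i'" "i' < 3" "v \<in> V i" "v' \<in> V i'" "snd v = snd v'"
      by (auto simp: Ix_def)
    let ?i = "3 - i - i'"
    have i3: "?i < 3" "i < 3" "{..<3} = {i, i', ?i}" using i by auto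
    let ?E = "{(j, j'). j \<in> J i \<and> j' \<in> J i' \<and> Fam i v j \<inter> Fam i' v' j' \<noteq> {}}"
    have E: "card ?E \<le> m + m"
    proof -
      have "card ?E \<le> card (J i) + card (J i')"
      proof (rule incidences[OF coord_range_U[of "snd v"] J(2)[OF i3(2)] J(2)[OF i(2)]])
        show "convex_in (coord_range (snd v)) (Fam i v j)" for j using conv[OF i3(2) i(3)] .
        show "convex_in (coord_range (snd v)) (Fam i' v' j)" for j using conv[OF i(2,4)] i(5) by simp
        show "Fam i v j \<inter> Fam i v j' = {}" if "j \<in> J i" "j' \<in> J i" "j \<noteq> j'" for j j'
          using disj[OF i3(2) i(3)] J(1)[OF i3(2)] that by blast
        show "Fam i' v' j \<inter> Fam i' v' j' = {}" if "j \<in> J i'" "j' \<in> J i'" "j \<noteq> j'" for j j'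
          using disj[OF i(2) i(4)] J(1)[OF i(2)] that by blast
      qed
      then show ?thesis using J(3)[OF i3(2)] J(3)[OF i(2)] by simp
    qed
    have "card (bad t) \<le> card (?E \<times> J ?i)"
    proof (rule card_inj_on_le[of "\<lambda>p. ((p i, p i'), p ?i)"])
      show "inj_on (\<lambda>p. ((p i, p i'), p ?i)) (bad t)"
      proof (rule inj_onI)
        fix p p' assume p: "p \<in> bad t" "p' \<in> bad t" "((p i, p i'), p ?i) = ((p' i, p' i'), p' ?i)"
        then have pp: "p \<in> paths" "p' \<in> paths" by (auto simp: bad_def t)
        show "p = p'"
        proof (rule PiE_ext[OF pp[unfolded paths_def]])
          fix x :: nat assume "x \<in> {..<3}"
          then show "p x = p' x" unfolding i3(3) using p(3) by auto
        qed
      qed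
      show "(\<lambda>p. ((p i, p i'), p ?i)) ` bad t \<subseteq> ?E \<times> J ?i"
        using i3(1,2) i(2) by (auto simp: bad_def t paths_def)
      show "finite (?E \<times> J ?i)"
      proof (rule finite_cartesian_product)
        show "finite ?E" by (rule finite_subset[of _ "J i \<times> J i'"]) (use J(2)[OF i3(2)] J(2)[OF i(2)] in auto)
        show "finite (J ?i)" by (rule J(2)[OF i3(1)])
      qed
    qed
    also have "\<dots> \<le> (m + m) * m"
      using E J(3)[OF i3(1)] by (simp add: card_cartesian_product)
    finally show "card (bad t) \<le> (m + m) * m" .
  qed
  also have "\<dots> = (2 * card Ix) * m ^ 2" by (simp add: power2_eq_square algebra_simps)
  also have "\<dots> < m * m ^ 2" by (simp add: m_def)
  also have "\<dots> = m ^ 3" by (simp add: power3_eq_cube power2_eq_square)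
  finally show False using card_paths by simp
qed

end

theorem burden_less_3: "burden_less (TG_star :: (LP_pred, 'a::infinite) struct \<Rightarrow> bool) 3"
  unfolding burden_less_def
proof (intro notI, elim exE conjE)
  fix \<MM> :: "(LP_pred, 'a) struct" and \<phi> k a
  assume "TG_star \<MM>" and inp: "inp_pattern \<MM> 3 \<phi> k a"
  then obtain M P where MP: "\<MM> = expand M P" and TG: "TG_model M P" by (auto simp: TG_star_def)
  interpret generic_model M P
    by unfold_locales (use TG TG_model_generic[OF TG] in \<open>auto simp: TG_model_def\<close>)
  show False using inp no_inp_pattern MP by simp
qed

section \<open>A model of \<open>T\<^sub>G\<^sup>*\<close> and a pattern of depth 2\<close>

lemma sqrt2_irrational: "sqrt 2 \<noteq> of_rat q"
proof
  assume q: "sqrt 2 = of_rat q"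
  then have "sqrt 2 \<in> \<rat>" by simp
  then obtain m n :: nat where n: "n \<noteq> 0" and eq: "\<bar>sqrt 2\<bar> = m / n" and cop: "coprime m n"
    by (rule Rats_abs_nat_div_natE)
  have "real m = sqrt 2 * n" using n eq by (simp add: field_simps)
  then have "(real m)\<^sup>2 = 2 * (real n)\<^sup>2" by (simp add: power_mult_distrib)
  then have m: "m\<^sup>2 = 2 * n\<^sup>2" by (metis of_nat_eq_iff of_nat_mult of_nat_numeral of_nat_power)
  then have "even m" by (metis dvd_triv_left even_power pos2)
  then obtain k where "m = 2 * k" by blast
  then have "n\<^sup>2 = 2 * k\<^sup>2" using m by (simp add: power_mult_distrib)
  then have "even n" by (metis dvd_triv_left even_power pos2)
  then show False using \<open>even m\<close> cop coprime_common_divisor[of m n 2] by simp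
qed

text \<open>
  The countable model is \<open>\<rat> + \<rat> \<surd>2\<close> as a substructure of the reals. Elements outside \<open>\<rat>\<close>, the definable
  closure of the empty set, are recognised by their coefficient at \<open>\<surd>2\<close>, which is a linear function.
\<close>

definition pt :: "rat \<Rightarrow> rat \<Rightarrow> real" where
  "pt p q = of_rat p + of_rat q * sqrt 2"

definition Qsqrt2 :: "real set" where
  "Qsqrt2 = {pt p q |p q. True}"

definition sqrt2_coeff :: "real \<Rightarrow> rat" where
  "sqrt2_coeff x = (THE q. \<exists>p. x = pt p q)"

lemma pt_inj: "pt p q = pt p' q' \<longleftrightarrow> p = p' \<and> q = q'"
proof
  assume eq: "pt p q = pt p' q'"
  have "q = q'"
  proof (rule ccontr)
    assume ne: "q \<noteq> q'"
    then have "of_rat (q - q') \<noteq> (0 :: real)" by simp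
    moreover have "of_rat (q - q') * sqrt 2 = of_rat (p' - p)"
      using eq by (simp add: pt_def of_rat_diff algebra_simps)
    ultimately have "sqrt 2 = of_rat ((p' - p) / (q - q'))" by (simp add: of_rat_divide field_simps)
    then show False using sqrt2_irrational by blast
  qed
  then show "p = p' \<and> q = q'" using eq by (simp add: pt_def)
qed simp

lemma sqrt2_coeff_pt [simp]: "sqrt2_coeff (pt p q) = q"
  unfolding sqrt2_coeff_def by (rule the_equality) (auto simp: pt_inj)

lemma pt_Qsqrt2 [simp]: "pt p q \<in> Qsqrt2"
  by (auto simp: Qsqrt2_def)

lemma pt_add: "pt p q + pt p' q' = pt (p + p') (q + q')"
  by (simp add: pt_def of_rat_add algebra_simps)

lemma pt_scale: "of_rat r * pt p q = pt (r * p) (r * q)"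
  by (simp add: pt_def of_rat_mult algebra_simps)

lemma pt_rat: "of_rat p = pt p 0"
  by (simp add: pt_def)

lemma Qsqrt2_closed:
  "x \<in> Qsqrt2 \<Longrightarrow> y \<in> Qsqrt2 \<Longrightarrow> x + y \<in> Qsqrt2" "x \<in> Qsqrt2 \<Longrightarrow> of_rat r * x \<in> Qsqrt2" "of_rat p \<in> Qsqrt2"
proof -
  have E: "\<exists>p q. x = pt p q" if "x \<in> Qsqrt2" for x using that by (auto simp: Qsqrt2_def)
  show "x \<in> Qsqrt2 \<Longrightarrow> y \<in> Qsqrt2 \<Longrightarrow> x + y \<in> Qsqrt2" by (metis E pt_add pt_Qsqrt2)
  show "x \<in> Qsqrt2 \<Longrightarrow> of_rat r * x \<in> Qsqrt2" by (metis E pt_scale pt_Qsqrt2)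
  show "of_rat p \<in> Qsqrt2" by (simp add: pt_rat)
qed

lemma sqrt2_coeff_add: "x \<in> Qsqrt2 \<Longrightarrow> y \<in> Qsqrt2 \<Longrightarrow> sqrt2_coeff (x + y) = sqrt2_coeff x + sqrt2_coeff y"
  by (auto simp: Qsqrt2_def pt_add)

lemma sqrt2_coeff_scale: "x \<in> Qsqrt2 \<Longrightarrow> sqrt2_coeff (of_rat r * x) = r * sqrt2_coeff x"
  by (auto simp: Qsqrt2_def pt_scale)

lemma sqrt2_coeff_rat: "sqrt2_coeff (of_rat p) = 0"
  by (simp add: pt_rat)

lemma countable_Qsqrt2: "countable Qsqrt2"
proof -
  have "Qsqrt2 = (\<lambda>(p, q). pt p q) ` UNIV" by (auto simp: Qsqrt2_def)
  then show ?thesis by (metis countable_image countableI_type)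
qed

definition M2 :: "(L_pred, real) struct" where
  "M2 = real_struct\<lparr>univ := Qsqrt2, predI := (\<lambda>_. {0<..<1} \<inter> Qsqrt2)\<rparr>"

lemma M2_simps [simp]:
  "univ M2 = Qsqrt2" "zeroI M2 = 0" "oneI M2 = 1"
  "addI M2 = (+)" "floorI M2 = (\<lambda>x. of_int \<lfloor>x\<rfloor>)"
  "scaleI M2 = (\<lambda>q x. of_rat q * x)" "lessI M2 = (<)"
  "predI M2 p = {0<..<1} \<inter> Qsqrt2"
  by (auto simp: M2_def real_struct_def)

lemma wf_M2: "wf_struct M2"
proof -
  have "of_int z \<in> Qsqrt2" for z using Qsqrt2_closed(3)[of "of_int z"] by simp
  moreover have "0 \<in> Qsqrt2" "1 \<in> Qsqrt2" using Qsqrt2_closed(3)[of 0] Qsqrt2_closed(3)[of 1] by simp_all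
  ultimately show ?thesis by (auto simp: wf_struct_def Qsqrt2_closed)
qed

lemma eval_M2: "eval_tm M2 e t = ev e t"
  by (induction t) auto

lemma sat_M2: "range e \<subseteq> Qsqrt2 \<Longrightarrow> qf \<psi> \<Longrightarrow> sat M2 e \<psi> \<longleftrightarrow> sat real_struct e \<psi>"
proof (induction \<psi>)
  case (Holds p t)
  then show ?case using wf_eval[OF wf_M2, of e t] by (auto simp: eval_M2)
qed (auto simp: eval_M2)

lemma univ_model_M2: "univ_model M2"
  by (auto simp: univ_model_def wf_M2 sat_M2)

lemma model_M2: "is_model M2 theory_T"
  by (rule univ_model_is_model[OF univ_model_M2])

text \<open>
  The tasks of the recursion: an interval, finitely many pairs, and the subset of those to be sent into \<open>P\<close>.
\<close>

definition requirement :: "real \<times> real \<times> (rat \<times> real) set \<times> (rat \<times> real) set \<Rightarrow> bool" where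
  "requirement = (\<lambda>(a, b, F, G). a \<in> Qsqrt2 \<and> b \<in> Qsqrt2 \<and> a < b \<and> finite F \<and> F \<subseteq> (UNIV - {0}) \<times> Qsqrt2 \<and> G \<subseteq> F \<and>
     (\<forall>(\<beta>, u)\<in>F. \<forall>t\<in>Qsqrt2. a < t \<longrightarrow> t < b \<longrightarrow> of_rat \<beta> * t + u \<in> {0<..<1} \<inter> Qsqrt2))"

lemma countable_requirements: "countable (Collect requirement)"
proof (rule countable_subset)
  let ?Fin = "{F. finite F \<and> F \<subseteq> (UNIV :: rat set) \<times> Qsqrt2}"
  show "Collect requirement \<subseteq> Qsqrt2 \<times> Qsqrt2 \<times> ?Fin \<times> ?Fin"
    by (auto simp: requirement_def dest: finite_subset)
  have "countable ?Fin" by (intro countable_Collect_finite_subset countable_SIGMA countableI_type countable_Qsqrt2)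
  then show "countable (Qsqrt2 \<times> Qsqrt2 \<times> ?Fin \<times> ?Fin)" by (intro countable_SIGMA countable_Qsqrt2)
qed

text \<open>
  All conditions exclude only finitely many values of the coefficient of \<open>t\<close> at \<open>\<surd>2\<close>, and for every
  coefficient the corresponding \<open>t\<close> are dense.
\<close>

lemma ex_generic_point:
  assumes req: "requirement (a, b, F, G)" and C: "finite C" "C \<subseteq> Qsqrt2"
  shows "\<exists>t\<in>Qsqrt2. a < t \<and> t < b \<and> (\<forall>(\<beta>, u)\<in>F. sqrt2_coeff (of_rat \<beta> * t + u) \<noteq> 0 \<and> of_rat \<beta> * t + u \<notin> C) \<and>
    inj_on (\<lambda>(\<beta>, u). of_rat \<beta> * t + u) F"
proof -
  have F: "finite F" "F \<subseteq> (UNIV - {0}) \<times> Qsqrt2" and ab: "a < b" using req by (auto simp: requirement_def)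
  \<comment> \<open>The coefficients for which a coordinate would be rational, two coordinates would be equal, or a
     coordinate would lie in \<open>C\<close>.\<close>
  define Bad where "Bad = (\<lambda>(\<beta>, u). - sqrt2_coeff u / \<beta>) ` F \<union> (\<lambda>((\<beta>, u), (\<beta>', u')). (sqrt2_coeff u' - sqrt2_coeff u) / (\<beta> - \<beta>')) ` (F \<times> F) \<union>
    (\<lambda>((\<beta>, u), c). (sqrt2_coeff c - sqrt2_coeff u) / \<beta>) ` (F \<times> C)"
  have "finite Bad" using F C by (simp add: Bad_def)
  then obtain c where c: "c \<notin> Bad" using ex_new_if_finite[OF infinite_UNIV_char_0] by blast
  obtain p where p: "a - of_rat c * sqrt 2 < of_rat p" "of_rat p < b - of_rat c * sqrt 2"
    using of_rat_dense[of "a - of_rat c * sqrt 2" "b - of_rat c * sqrt 2"] ab by auto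
  define t where "t = pt p c"
  have "t \<in> Qsqrt2" "sqrt2_coeff t = c" by (simp_all add: t_def)
  moreover have "a < t" "t < b" using p by (simp_all add: t_def pt_def)
  ultimately have t: "t \<in> Qsqrt2" "sqrt2_coeff t = c" "a < t" "t < b" by blast+
  have it: "sqrt2_coeff (of_rat \<beta> * t + u) = \<beta> * c + sqrt2_coeff u" if "u \<in> Qsqrt2" for \<beta> u
    using that t by (simp add: sqrt2_coeff_add sqrt2_coeff_scale Qsqrt2_closed)
  have "sqrt2_coeff (of_rat \<beta> * t + u) \<noteq> 0 \<and> of_rat \<beta> * t + u \<notin> C" if bu: "(\<beta>, u) \<in> F" for \<beta> u
  proof -
    have b: "\<beta> \<noteq> 0" "u \<in> Qsqrt2" using bu F by auto
    have "- sqrt2_coeff u / \<beta> \<in> Bad" using bu by (force simp: Bad_def)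
    then have "c \<noteq> - sqrt2_coeff u / \<beta>" using c by blast
    then have "\<beta> * c + sqrt2_coeff u \<noteq> 0" using b by (auto simp: field_simps add_eq_0_iff)
    moreover have "of_rat \<beta> * t + u \<noteq> d" if d: "d \<in> C" for d
    proof
      assume "of_rat \<beta> * t + u = d"
      then have "\<beta> * c + sqrt2_coeff u = sqrt2_coeff d" using it[OF b(2)] by metis
      then have "c = (sqrt2_coeff d - sqrt2_coeff u) / \<beta>" using b by (simp add: field_simps)
      moreover have "(sqrt2_coeff d - sqrt2_coeff u) / \<beta> \<in> Bad" using bu d by (force simp: Bad_def)
      ultimately show False using c by simp
    qed
    ultimately show ?thesis using it[OF b(2)] by auto
  qed
  moreover have "inj_on (\<lambda>(\<beta>, u). of_rat \<beta> * t + u) F"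
  proof (rule inj_onI, clarify)
    fix \<beta> u \<beta>' u'
    assume bu: "(\<beta>, u) \<in> F" "(\<beta>', u') \<in> F" and eq: "of_rat \<beta> * t + u = of_rat \<beta>' * t + u'"
    have u: "u \<in> Qsqrt2" "u' \<in> Qsqrt2" using bu F by auto
    have i: "\<beta> * c + sqrt2_coeff u = \<beta>' * c + sqrt2_coeff u'" using it[OF u(1)] it[OF u(2)] eq by metis
    have "\<beta> = \<beta>'"
    proof (rule ccontr)
      assume ne: "\<beta> \<noteq> \<beta>'"
      have "c = (sqrt2_coeff u' - sqrt2_coeff u) / (\<beta> - \<beta>')" using i ne by (simp add: field_simps)
      moreover have "(sqrt2_coeff u' - sqrt2_coeff u) / (\<beta> - \<beta>') \<in> Bad"
        unfolding Bad_def by (intro UnI1 UnI2 image_eqI[of _ _ "((\<beta>, u), (\<beta>', u'))"]) (use bu in auto)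
      ultimately show False using c by simp
    qed
    then show "\<beta> = \<beta>' \<and> u = u'" using eq by simp
  qed
  ultimately show ?thesis using t by (intro bexI[of _ t]) auto
qed

text \<open>
  The tasks are enumerated, and the point chosen for each task is such that its coordinates are
  irrational, pairwise different, and different from those of all previous tasks. So putting some of them
  into \<open>P\<close> does not interfere with other tasks.
\<close>

lemma ex_generic_predicate: "\<exists>P \<subseteq> predI M2 S_L. generic M2 P \<and> (\<forall>x\<in>P. sqrt2_coeff x \<noteq> 0)"
proof -
  let ?R = "Collect requirement"
  have "requirement (of_rat 0, of_rat 1, {}, {})"
    using Qsqrt2_closed(3)[of 0] Qsqrt2_closed(3)[of 1] by (simp add: requirement_def)
  then have "?R \<noteq> {}" by blast
  define r where "r = from_nat_into ?R"
  have req: "requirement (r k)" for k using from_nat_into[OF \<open>?R \<noteq> {}\<close>] by (simp add: r_def)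
  have surj: "\<exists>k. r k = x" if "requirement x" for x
    using from_nat_into_surj[OF countable_requirements] that by (simp add: r_def)
  define A where "A k = fst (r k)" for k
  define B where "B k = fst (snd (r k))" for k
  define F where "F k = fst (snd (snd (r k)))" for k
  define G where "G k = snd (snd (snd (r k)))" for k
  have rk: "r k = (A k, B k, F k, G k)" for k by (simp add: A_def B_def F_def G_def)
  have GF: "G k \<subseteq> F k" and Ffin: "finite (F k)" and FX: "F k \<subseteq> (UNIV - {0}) \<times> Qsqrt2" for k
    using req[of k] unfolding rk by (auto simp: requirement_def)
  define val where "val t = (\<lambda>(\<beta>, u). of_rat \<beta> * t + (u :: real))" for t
  define good where "good f k t \<longleftrightarrow> t \<in> Qsqrt2 \<and> A k < t \<and> t < B k \<and>
    (\<forall>p\<in>F k. sqrt2_coeff (val t p) \<noteq> 0 \<and> (\<forall>j<k. val t p \<notin> val (f j) ` F j)) \<and> inj_on (val t) (F k)" for f k t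
  have "\<exists>f. \<forall>k. good f k (f k)"
  proof (rule dependent_wellorder_choice)
    fix t and f g :: "nat \<Rightarrow> real" and k
    assume "\<And>j. j < k \<Longrightarrow> f j = g j"
    then show "good f k t = good g k t" by (simp add: good_def)
  next
    fix k f assume IH: "\<And>j. j < k \<Longrightarrow> good f j (f j)"
    let ?C = "\<Union>j<k. val (f j) ` F j"
    have finC: "finite ?C" using Ffin by simp
    have "val (f j) p \<in> Qsqrt2" if "j < k" "p \<in> F j" for j p
    proof -
      have "f j \<in> Qsqrt2" using IH[OF that(1)] by (simp add: good_def)
      moreover have "snd p \<in> Qsqrt2" using FX[of j] that(2) by auto
      ultimately show ?thesis by (simp add: val_def split_beta Qsqrt2_closed)
    qed
    then have subC: "?C \<subseteq> Qsqrt2" by auto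
    obtain t where "t \<in> Qsqrt2" "A k < t" "t < B k"
      "\<forall>(\<beta>, u)\<in>F k. sqrt2_coeff (of_rat \<beta> * t + u) \<noteq> 0 \<and> of_rat \<beta> * t + u \<notin> ?C"
      "inj_on (\<lambda>(\<beta>, u). of_rat \<beta> * t + u) (F k)"
      using ex_generic_point[OF req[of k, unfolded rk] finC subC] by (elim bexE conjE) (rule that)
    then have "good f k t" unfolding good_def val_def by (auto simp: split_beta)
    then show "\<exists>t. good f k t" by blast
  qed
  then obtain f where f: "\<And>k. good f k (f k)" by blast
  define P where "P = (\<Union>k. val (f k) ` G k)"
  have "P \<subseteq> {0<..<1} \<inter> Qsqrt2"
  proof
    fix x assume "x \<in> P"
    then obtain k \<beta> u where x: "(\<beta>, u) \<in> G k" "x = of_rat \<beta> * f k + u" by (auto simp: P_def val_def)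
    have "\<forall>(\<beta>, u)\<in>F k. \<forall>t\<in>Qsqrt2. A k < t \<longrightarrow> t < B k \<longrightarrow> of_rat \<beta> * t + u \<in> {0<..<1} \<inter> Qsqrt2"
      using req[of k] unfolding rk requirement_def prod.case by blast
    then have "of_rat \<beta> * f k + u \<in> {0<..<1} \<inter> Qsqrt2"
      using f[of k, unfolded good_def] x(1) GF[of k] by (auto simp del: IntE)
    then show "x \<in> {0<..<1} \<inter> Qsqrt2" using x(2) by simp
  qed
  moreover have "generic M2 P"
    unfolding generic_def
  proof (intro ballI allI impI)
    fix a b F' G'
    assume "a \<in> univ M2" "b \<in> univ M2" "lessI M2 a b" "finite F'" "F' \<subseteq> (UNIV - {0}) \<times> univ M2" "G' \<subseteq> F'"
      "\<forall>(\<beta>, u)\<in>F'. \<forall>t\<in>univ M2. lessI M2 a t \<longrightarrow> lessI M2 t b \<longrightarrow> addI M2 (scaleI M2 \<beta> t) u \<in> predI M2 S_L"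
    then have "requirement (a, b, F', G')" by (simp add: requirement_def)
    then obtain k where k: "r k = (a, b, F', G')" using surj by blast
    then have k': "A k = a" "B k = b" "F k = F'" "G k = G'" by (simp_all add: A_def B_def F_def G_def)
    have fk: "f k \<in> Qsqrt2" "a < f k" "f k < b" using f[of k] k' by (simp_all add: good_def)
    have "val (f k) p \<in> P \<longleftrightarrow> p \<in> G'" if p: "p \<in> F'" for p
    proof
      assume "val (f k) p \<in> P"
      then obtain j p' where j: "p' \<in> G j" "val (f k) p = val (f j) p'" by (auto simp: P_def)
      have pF: "p \<in> F k" "p' \<in> F j" using p k' j GF by auto
      have "\<not> j < k" using f[of k] pF j(2) unfolding good_def by (metis image_eqI)
      moreover have "\<not> k < j" using f[of j] pF j(2) unfolding good_def by (metis image_eqI)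
      ultimately have "j = k" by simp
      then have "p = p'" using f[of k] pF j(2) unfolding good_def by (auto dest: inj_onD)
      then show "p \<in> G'" using j(1) \<open>j = k\<close> k' by simp
    next
      assume "p \<in> G'"
      then show "val (f k) p \<in> P" using k' by (auto simp: P_def)
    qed
    then show "\<exists>t\<in>univ M2. lessI M2 a t \<and> lessI M2 t b \<and>
        (\<forall>(\<beta>, u)\<in>F'. addI M2 (scaleI M2 \<beta> t) u \<in> P \<longleftrightarrow> (\<beta>, u) \<in> G')"
      using fk by (intro bexI[of _ "f k"]) (auto simp: val_def)
  qed
  moreover have "\<forall>x\<in>P. sqrt2_coeff x \<noteq> 0" using f GF by (fastforce simp: P_def good_def)
  ultimately show ?thesis by (intro exI[of _ P]) simp
qed

text \<open>
  An element with nonzero coefficient at \<open>\<surd>2\<close> can be moved by \<open>perturb\<close>, where \<open>g\<close> is that coefficient, so it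
  is not the only solution of a formula without parameters.
\<close>

lemma dcl_rational:
  assumes "fv \<psi> \<subseteq> {0}" "{x \<in> Qsqrt2. sat M2 (\<lambda>_. x) \<psi>} = {a}"
  shows "sqrt2_coeff a = 0"
proof -
  interpret tmodel M2 by unfold_locales (rule model_M2)
  have a: "a \<in> Qsqrt2" "sat M2 (\<lambda>_. a) \<psi>" using assms(2) by blast+
  have int: "of_int z \<in> Qsqrt2" "sqrt2_coeff (of_int z) = 0" for z
    using Qsqrt2_closed(3)[of "of_int z"] sqrt2_coeff_rat[of "of_int z"] by simp_all
  have "eventually_small (\<lambda>d. sat M2 (\<lambda>i. addI M2 a (scaleI M2 (sqrt2_coeff a) d)) \<psi>)"
    by (rule perturb[where E = Qsqrt2 and g = sqrt2_coeff])
      (use a int int[of 0] int[of 1] in \<open>auto simp: Qsqrt2_closed sqrt2_coeff_add sqrt2_coeff_scale\<close>)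
  then obtain d where d: "d \<in> Qsqrt2" "0 < d" "sat M2 (\<lambda>i. a + of_rat (sqrt2_coeff a) * d) \<psi>"
    using eventually_small_ex by fastforce
  moreover have "a + of_rat (sqrt2_coeff a) * d \<in> Qsqrt2" using a d by (simp add: Qsqrt2_closed)
  ultimately have "a + of_rat (sqrt2_coeff a) * d = a" using assms(2) by blast
  then show ?thesis using d(2) by simp
qed

lemma generic_transport:
  assumes \<iota>: "inj_on \<iota> (univ M)" and wf: "wf_struct M" and P: "P \<subseteq> univ M" and generic: "generic M P"
  shows "generic (transport \<iota> M) (\<iota> ` P)"
  unfolding generic_def
proof (intro ballI allI impI)
  interpret transported \<iota> M using \<iota> wf by unfold_locales
  let ?N = "transport \<iota> M"
  fix a b F G
  assume "a \<in> univ ?N" "b \<in> univ ?N" and ab: "lessI ?N a b" and F: "finite F" "F \<subseteq> (UNIV - {0}) \<times> univ ?N" "G \<subseteq> F"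
    and range: "\<forall>(\<beta>, u)\<in>F. \<forall>t\<in>univ ?N. lessI ?N a t \<longrightarrow> lessI ?N t b \<longrightarrow> addI ?N (scaleI ?N \<beta> t) u \<in> predI ?N S_L"
  then obtain a0 b0 where a0: "a0 \<in> univ M" "a = \<iota> a0" and b0: "b0 \<in> univ M" "b = \<iota> b0" by auto
  have cl: "x \<in> univ M \<Longrightarrow> scaleI M \<beta> x \<in> univ M" "x \<in> univ M \<Longrightarrow> y \<in> univ M \<Longrightarrow> addI M x y \<in> univ M" for x y \<beta>
    using wf by (auto simp: wf_struct_def)
  have pS: "predI M S_L \<subseteq> univ M" using wf by (auto simp: wf_struct_def)
  define F0 where "F0 = {(\<beta>, u). u \<in> univ M \<and> (\<beta>, \<iota> u) \<in> F}"
  define G0 where "G0 = {(\<beta>, u). u \<in> univ M \<and> (\<beta>, \<iota> u) \<in> G}"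
  have "\<exists>t\<in>univ M. lessI M a0 t \<and> lessI M t b0 \<and>
    (\<forall>(\<beta>, u)\<in>F0. addI M (scaleI M \<beta> t) u \<in> P \<longleftrightarrow> (\<beta>, u) \<in> G0)"
  proof (rule genericD[OF generic a0(1) b0(1)])
    show "lessI M a0 b0" using ab a0 b0 by simp
    have "inj_on (\<lambda>(\<beta>, u). (\<beta>, \<iota> u)) F0" using \<iota> by (auto simp: inj_on_def F0_def)
    moreover have "(\<lambda>(\<beta>, u). (\<beta>, \<iota> u)) ` F0 \<subseteq> F" by (auto simp: F0_def)
    ultimately show "finite F0" using F(1) by (meson finite_imageD finite_subset)
    show "F0 \<subseteq> (UNIV - {0}) \<times> univ M" "G0 \<subseteq> F0" using F by (auto simp: F0_def G0_def)
    fix \<beta> u t assume t: "(\<beta>, u) \<in> F0" "t \<in> univ M" "lessI M a0 t" "lessI M t b0"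
    then have u: "u \<in> univ M" "(\<beta>, \<iota> u) \<in> F" by (auto simp: F0_def)
    then have "addI ?N (scaleI ?N \<beta> (\<iota> t)) (\<iota> u) \<in> predI ?N S_L" using range t a0 b0 by auto
    then have "\<iota> (addI M (scaleI M \<beta> t) u) \<in> \<iota> ` predI M S_L" using t(2) u cl by simp
    then show "addI M (scaleI M \<beta> t) u \<in> predI M S_L"
      using inj_on_image_mem_iff[OF \<iota> _ pS] t(2) u cl by blast
  qed
  then obtain t where t: "t \<in> univ M" "lessI M a0 t" "lessI M t b0"
    "\<forall>(\<beta>, u)\<in>F0. addI M (scaleI M \<beta> t) u \<in> P \<longleftrightarrow> (\<beta>, u) \<in> G0" by blast
  have "addI ?N (scaleI ?N \<beta> (\<iota> t)) u \<in> \<iota> ` P \<longleftrightarrow> (\<beta>, u) \<in> G" if bu: "(\<beta>, u) \<in> F" for \<beta> u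
  proof -
    obtain u0 where u0: "u0 \<in> univ M" "u = \<iota> u0" using bu F(2) by auto
    have "addI ?N (scaleI ?N \<beta> (\<iota> t)) u = \<iota> (addI M (scaleI M \<beta> t) u0)" using u0 t(1) cl by simp
    moreover have "\<iota> (addI M (scaleI M \<beta> t) u0) \<in> \<iota> ` P \<longleftrightarrow> addI M (scaleI M \<beta> t) u0 \<in> P"
      by (rule inj_on_image_mem_iff[OF \<iota> _ P]) (use u0 t(1) cl in blast)
    moreover have "addI M (scaleI M \<beta> t) u0 \<in> P \<longleftrightarrow> (\<beta>, u0) \<in> G0" using t(4) bu u0 by (auto simp: F0_def)
    ultimately show ?thesis using u0 by (auto simp: G0_def)
  qed
  then show "\<exists>t\<in>univ ?N. lessI ?N a t \<and> lessI ?N t b \<and>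
      (\<forall>(\<beta>, u)\<in>F. addI ?N (scaleI ?N \<beta> t) u \<in> \<iota> ` P \<longleftrightarrow> (\<beta>, u) \<in> G)"
    using t a0 b0 by (intro bexI[of _ "\<iota> t"]) auto
qed

text \<open>
  The universe of the model is a countable subset of the infinite type.
\<close>

theorem ex_TG_star:
  obtains \<iota> :: "real \<Rightarrow> 'a::infinite" and P where "inj_on \<iota> Qsqrt2" "TG_star (expand (transport \<iota> M2) P)"
    "P \<subseteq> \<iota> ` Qsqrt2"
proof -
  obtain f :: "nat \<Rightarrow> 'a" where f: "inj f" using infinite_countable_subset[OF infinite_UNIV] by metis
  define \<iota> where "\<iota> = f \<circ> to_nat_on Qsqrt2"
  have inj: "inj_on \<iota> Qsqrt2"
    unfolding \<iota>_def by (rule comp_inj_on[OF inj_on_to_nat_on[OF countable_Qsqrt2]]) (use f in \<open>auto intro: inj_on_subset\<close>)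
  interpret transported \<iota> M2 by unfold_locales (use inj wf_M2 in auto)
  let ?N = "transport \<iota> M2"
  obtain P where P: "P \<subseteq> predI M2 S_L" "generic M2 P" "\<And>x. x \<in> P \<Longrightarrow> sqrt2_coeff x \<noteq> 0" using ex_generic_predicate by blast
  have PX: "P \<subseteq> Qsqrt2" using P(1) by auto
  have "TG_model ?N (\<iota> ` P)"
  proof (rule generic_TG_model)
    show "is_model ?N theory_T"
      by (rule univ_model_is_model[OF univ_model_transport[OF _ univ_model_M2]]) (use inj in simp)
    show "\<iota> ` P \<subseteq> predI ?N S_L" using P(1) by auto
    show "generic ?N (\<iota> ` P)" by (rule generic_transport) (use inj wf_M2 PX P(2) in auto)
  qed
  moreover have "\<iota> ` P \<inter> dcl ?N {} = {}"
  proof (rule ccontr)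
    assume "\<iota> ` P \<inter> dcl ?N {} \<noteq> {}"
    then obtain x where x: "x \<in> P" "\<iota> x \<in> dcl ?N {}" by blast
    then obtain \<psi> where \<psi>: "fv \<psi> \<subseteq> {0}" "{y \<in> univ ?N. sat_at ?N [y] \<psi>} = {\<iota> x}"
      by (auto simp: dcl_def)
    have sat: "sat_at ?N [\<iota> y] \<psi> \<longleftrightarrow> sat M2 (\<lambda>_. y) \<psi>" if "y \<in> Qsqrt2" for y
    proof -
      have "sat_at ?N [\<iota> y] \<psi> \<longleftrightarrow> sat ?N (\<iota> \<circ> (\<lambda>_. y)) \<psi>"
        unfolding sat_at_def by (rule sat_cong) (use \<psi>(1) in auto)
      also have "\<dots> \<longleftrightarrow> sat M2 (\<lambda>_. y) \<psi>" by (rule sat_transport) (use that in auto)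
      finally show ?thesis .
    qed
    have xX: "x \<in> Qsqrt2" using x PX by blast
    have "{y \<in> Qsqrt2. sat M2 (\<lambda>_. y) \<psi>} = {x}"
    proof (rule set_eqI)
      fix y
      show "y \<in> {y \<in> Qsqrt2. sat M2 (\<lambda>_. y) \<psi>} \<longleftrightarrow> y \<in> {x}"
      proof (cases "y \<in> Qsqrt2")
        case True
        then have "sat M2 (\<lambda>_. y) \<psi> \<longleftrightarrow> \<iota> y \<in> {y \<in> univ ?N. sat_at ?N [y] \<psi>}" using sat by simp
        also have "\<dots> \<longleftrightarrow> \<iota> y = \<iota> x" using \<psi>(2) by simp
        also have "\<dots> \<longleftrightarrow> y = x" using inj True xX by (auto dest: inj_onD)
        finally show ?thesis using True by simp
      qed (use xX in auto)
    qed
    then show False using dcl_rational[OF \<psi>(1)] P(3)[OF x(1)] by blast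
  qed
  ultimately have "TG_star (expand ?N (\<iota> ` P))" by (auto simp: TG_star_def)
  then show ?thesis using inj PX by (intro that[of \<iota> "\<iota> ` P"]) auto
qed

text \<open>
  Both rows consist of equations between a coordinate of \<open>x\<close> and a parameter, so two members of a row
  contradict each other in every elementary extension, because embeddings are injective.
\<close>

theorem not_burden_less_2:
  assumes "\<kappa> \<le> 2"
  shows "\<not> burden_less (TG_star :: (LP_pred, 'a::infinite) struct \<Rightarrow> bool) \<kappa>"
proof -
  obtain \<iota> :: "real \<Rightarrow> 'a" and P where inj: "inj_on \<iota> Qsqrt2" and TG: "TG_star (expand (transport \<iota> M2) P)"
    and P: "P \<subseteq> \<iota> ` Qsqrt2" by (rule ex_TG_star)
  interpret transported \<iota> M2 by unfold_locales (use inj wf_M2 in auto)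
  let ?M = "expand (transport \<iota> M2) P"
  have wf: "wf_struct ?M" by (rule wf_expand[OF wf_transport]) (use P in simp)
  define \<phi> where "\<phi> i = (if i = (0::nat) then Eq (Floor (Var 0)) (Var 1)
     else Eq (Add (Var 0) (Scale (-1) (Floor (Var 0)))) (Var 1) :: LP_pred fm)" for i
  define c where "c i j = (if i = (0::nat) then real j else 1 / (real j + 2))" for i j
  have cX: "c i j \<in> Qsqrt2" for i j
    using Qsqrt2_closed(3)[of "of_nat j"] Qsqrt2_closed(3)[of "1 / (of_nat j + 2)"] by (simp add: c_def of_rat_divide of_rat_add)
  have c_inj: "c i j = c i j' \<longleftrightarrow> j = j'" for i j j' by (auto simp: c_def field_simps)
  have incons: "k_inconsistent ?M 2 (\<lambda>j. (\<phi> i, [\<iota> (c i j)]))" for i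
    unfolding k_inconsistent_def
  proof (intro allI impI notI)
    fix J :: "nat set" assume J: "card J = 2" and cons: "consistent ?M ((\<lambda>j. (\<phi> i, [\<iota> (c i j)])) ` J)"
    obtain j j' where j: "J = {j, j'}" "j \<noteq> j'" using J by (auto simp: card_2_iff)
    obtain N f b where f: "elementary_embedding ?M N f" and b: "\<forall>j\<in>J. sat_at N [b, f (\<iota> (c i j))] (\<phi> i)"
      using cons by (auto simp: consistent_def)
    then have "f (\<iota> (c i j)) = f (\<iota> (c i j'))" using j by (auto simp: sat_at_def \<phi>_def split: if_splits)
    then have "\<iota> (c i j) = \<iota> (c i j')" using elementary_inj[OF f] cX by (auto dest: inj_onD)
    then show False using inj cX c_inj j(2) by (auto dest: inj_onD)
  qed
  have "inp_pattern ?M \<kappa> \<phi> (\<lambda>_. 2) (\<lambda>i j. [\<iota> (c i j)])"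
    unfolding inp_pattern_def
  proof (intro conjI allI impI)
    fix i
    show "(2::nat) > 0" by simp
    show "\<exists>l. fv (\<phi> i) \<subseteq> {..l} \<and> (\<forall>j. length [\<iota> (c i j)] = l \<and> set [\<iota> (c i j)] \<subseteq> univ ?M)"
      using cX by (intro exI[of _ 1]) (auto simp: \<phi>_def)
    show "k_inconsistent ?M 2 (\<lambda>j. (\<phi> i, [\<iota> (c i j)]))" by (rule incons)
  next
    fix \<eta> :: "nat \<Rightarrow> nat"
    define x where "x = c 0 (\<eta> 0) + c 1 (\<eta> 1)"
    have x: "x \<in> Qsqrt2" using cX Qsqrt2_closed(1) by (simp add: x_def)
    have fl: "\<lfloor>x\<rfloor> = int (\<eta> 0)"
      by (rule floor_unique) (auto simp: x_def c_def)
    have intX: "of_int z \<in> Qsqrt2" for z using Qsqrt2_closed(3)[of "of_int z"] by simp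
    have sat: "sat_at ?M [\<iota> x, \<iota> (c i (\<eta> i))] (\<phi> i)" if "i < \<kappa>" for i
    proof (cases "i = 0")
      case True
      then show ?thesis using x by (simp add: sat_at_def \<phi>_def fl c_def)
    next
      case False
      then have i: "i = 1" using that assms by simp
      have "of_rat (- 1) * real (\<eta> 0) \<in> Qsqrt2" using Qsqrt2_closed(2)[OF Qsqrt2_closed(3)[of "of_nat (\<eta> 0)"], of "-1"] by simp
      then show ?thesis
        using x intX[of "int (\<eta> 0)"] by (simp add: sat_at_def \<phi>_def fl i of_rat_minus) (simp add: x_def c_def)
    qed
    have "elementary_embedding ?M ?M id" using wf by (simp add: elementary_embedding_def)
    then show "consistent ?M ((\<lambda>i. (\<phi> i, [\<iota> (c i (\<eta> i))])) ` {..<\<kappa>})"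
      unfolding consistent_def using sat x by (intro exI[of _ ?M] exI[of _ id]) (auto intro!: bexI[of _ "\<iota> x"])
  qed
  then show ?thesis unfolding burden_less_def using TG by blast
qed

theorem proposition3p15:
  shows "has_burden (TG_star :: (LP_pred, 'a::infinite) struct \<Rightarrow> bool) 2"
  unfolding has_burden_def
proof (intro conjI allI impI)
  show "burden_less (TG_star :: (LP_pred, 'a) struct \<Rightarrow> bool) (Suc 2)"
    using burden_less_3 by (simp add: numeral_3_eq_3)
  show "Suc 2 \<le> \<kappa>" if "burden_less (TG_star :: (LP_pred, 'a) struct \<Rightarrow> bool) \<kappa>" for \<kappa>
    using that not_burden_less_2[of \<kappa>] by (meson not_less_eq_eq)
qed

end
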